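(* If $f\in S^*(\mathbb{R}^d)$ is an almost periodic distribution with locally finite spectrum $\Gamma$, then $\hat f$ is a measure.
   Context: $S(\mathbb{R}^d)$ is the Schwartz space and $S^*(\mathbb{R}^d)$ is the space of temperate (tempered) distributions. The Fourier transform of a test function is $\hat\varphi(y)=\int_{\mathbb{R}^d}\varphi(x)e^{-2\pi i\langle x,y\rangle}dx$, and for $f\in S^*(\mathbb{R}^d)$ it is defined by $\hat f(\varphi)=f(\hat\varphi)$. The spectrum of $f$ is the support of $\hat f$. A measure means a complex-valued (locally finite, Radon) measure on $\mathbb{R}^d$. A set is locally finite if its intersection with every ball is finite. A continuous function $g$ on $\mathbb{R}^d$ is almost periodic if for every $\varepsilon>0$ the set $\{\tau\in\mathbb{R}^d:\sup_{x}|g(x+\tau)-g(x)|<\varepsilon\}$ is relatively dense (i.e. for some $R<\infty$ it meets every ball of radius $R$). A distribution $f\in S^*(\mathbb{R}^d)$ is almost periodic if $t\mapsto(\psi\star f)(t)=f(\psi(t-\cdot))$ is an almost periodic function for every $C^\infty$ function $\psi$ on $\mathbb{R}^d$ with compact support. *)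

theory Defs
  imports "HOL-Analysis.Analysis"
begin

text \<open>
  The space \<open>\<real>\<^sup>d\<close> is an arbitrary type of class \<^class>\<open>euclidean_space\<close>, with \<open>d = DIM('a)\<close>.
\<close>

section \<open>Smooth functions\<close>

definition partial_deriv :: "'a::euclidean_space \<Rightarrow> ('a \<Rightarrow> complex) \<Rightarrow> 'a \<Rightarrow> complex" where
  "partial_deriv b \<phi> x = frechet_derivative \<phi> (at x) b"

text \<open>
  Multi-indices are represented by lists of basis vectors; a vector \<open>b\<close> occurring \<open>m\<close> times
  in the list means \<open>m\<close> derivatives in direction \<open>b\<close>.
\<close>

definition iter_deriv :: "'a::euclidean_space list \<Rightarrow> ('a \<Rightarrow> complex) \<Rightarrow> 'a \<Rightarrow> complex" where
  "iter_deriv bs \<phi> = foldr partial_deriv bs \<phi>"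

definition smooth_fun :: "('a::euclidean_space \<Rightarrow> complex) \<Rightarrow> bool" where
  "smooth_fun \<phi> \<longleftrightarrow> (\<forall>bs\<in>lists Basis. \<forall>x. iter_deriv bs \<phi> differentiable (at x))"

definition fun_support :: "('a::topological_space \<Rightarrow> complex) \<Rightarrow> 'a set" where
  "fun_support \<phi> = closure (support_on UNIV \<phi>)"

definition test_funs :: "('a::euclidean_space \<Rightarrow> complex) set" where
  "test_funs = {\<phi>. smooth_fun \<phi> \<and> compact (fun_support \<phi>)}"

section \<open>The Schwartz space and tempered distributions\<close>

definition schwartz_funs :: "('a::euclidean_space \<Rightarrow> complex) set" where
  "schwartz_funs = {\<phi>. smooth_fun \<phi> \<and>
     (\<forall>k. \<forall>bs\<in>lists Basis. bounded (range (\<lambda>x. norm x ^ k *\<^sub>R iter_deriv bs \<phi> x)))}"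

text \<open>The supremum is finite, hence meaningful as a real number, for Schwartz functions.\<close>

definition schwartz_seminorm ::
    "nat \<Rightarrow> 'a::euclidean_space list \<Rightarrow> ('a \<Rightarrow> complex) \<Rightarrow> real" where
  "schwartz_seminorm k bs \<phi> = (SUP x. norm x ^ k * norm (iter_deriv bs \<phi> x))"

definition schwartz_topology :: "('a::euclidean_space \<Rightarrow> complex) topology" where
  "schwartz_topology = topology_generated_by
     {{\<psi> \<in> schwartz_funs. schwartz_seminorm k bs (\<lambda>x. \<psi> x - \<phi> x) < \<epsilon>} | k bs \<phi> \<epsilon>.
        bs \<in> lists Basis \<and> \<phi> \<in> schwartz_funs \<and> \<epsilon> > 0}"

text \<open>
  Functionals are total functions in HOL; only their values on Schwartz functions matter here.
\<close>

definition tempered_distribution :: "(('a::euclidean_space \<Rightarrow> complex) \<Rightarrow> complex) \<Rightarrow> bool" where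
  "tempered_distribution f \<longleftrightarrow>
     (\<forall>\<phi>\<in>schwartz_funs. \<forall>\<psi>\<in>schwartz_funs. \<forall>a b.
        f (\<lambda>x. a * \<phi> x + b * \<psi> x) = a * f \<phi> + b * f \<psi>) \<and>
     continuous_map schwartz_topology euclidean f"

section \<open>Fourier transform and spectrum\<close>

definition fourier :: "('a::euclidean_space \<Rightarrow> complex) \<Rightarrow> 'a \<Rightarrow> complex" where
  "fourier \<phi> y = (LINT x|lborel. \<phi> x * exp (- 2 * of_real pi * \<i> * of_real (x \<bullet> y)))"

definition fourier_dist ::
    "(('a::euclidean_space \<Rightarrow> complex) \<Rightarrow> complex) \<Rightarrow> ('a \<Rightarrow> complex) \<Rightarrow> complex" where
  "fourier_dist f \<phi> = f (fourier \<phi>)"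

definition dist_support :: "(('a::euclidean_space \<Rightarrow> complex) \<Rightarrow> complex) \<Rightarrow> 'a set" where
  "dist_support F =
     - \<Union>{U. open U \<and> (\<forall>\<phi>\<in>test_funs. fun_support \<phi> \<subseteq> U \<longrightarrow> F \<phi> = 0)}"

definition spectrum :: "(('a::euclidean_space \<Rightarrow> complex) \<Rightarrow> complex) \<Rightarrow> 'a set" where
  "spectrum f = dist_support (fourier_dist f)"

definition locally_finite_set :: "'a::metric_space set \<Rightarrow> bool" where
  "locally_finite_set A \<longleftrightarrow> (\<forall>x r. finite (A \<inter> ball x r))"

section \<open>Almost periodicity\<close>

definition relatively_dense :: "'a::metric_space set \<Rightarrow> bool" where
  "relatively_dense E \<longleftrightarrow> (\<exists>R. \<forall>x. E \<inter> ball x R \<noteq> {})"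

text \<open>The supremum is taken in the extended nonnegative reals, as it may be infinite.\<close>

definition almost_periodic :: "('a::euclidean_space \<Rightarrow> complex) \<Rightarrow> bool" where
  "almost_periodic g \<longleftrightarrow> continuous_on UNIV g \<and>
     (\<forall>\<epsilon>>0. relatively_dense {\<tau>. (SUP x. ennreal (norm (g (x + \<tau>) - g x))) < ennreal \<epsilon>})"

definition almost_periodic_distribution ::
    "(('a::euclidean_space \<Rightarrow> complex) \<Rightarrow> complex) \<Rightarrow> bool" where
  "almost_periodic_distribution f \<longleftrightarrow>
     tempered_distribution f \<and> (\<forall>\<psi>\<in>test_funs. almost_periodic (\<lambda>t. f (\<lambda>x. \<psi> (t - x))))"

section \<open>Complex Radon measures as distributions\<close>

text \<open>
  On a Euclidean space a Borel measure that is finite on compact sets is automatically regular.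
\<close>

definition radon_measure :: "'a::euclidean_space measure \<Rightarrow> bool" where
  "radon_measure \<mu> \<longleftrightarrow> sets \<mu> = sets borel \<and> (\<forall>K. compact K \<longrightarrow> emeasure \<mu> K < \<infinity>)"

text \<open>
  A complex Radon measure need not have finite total variation, so in general it is a set function
  on the bounded Borel sets only.  It is given here in the form
  \<open>(\<mu>\<^sub>1 - \<mu>\<^sub>2) + \<i> (\<mu>\<^sub>3 - \<mu>\<^sub>4)\<close> with positive Radon measures \<open>\<mu>\<^sub>1, \<dots>, \<mu>\<^sub>4\<close>.  The integrals below
  always exist, the integrands being continuous with compact support.
\<close>

definition is_complex_measure :: "(('a::euclidean_space \<Rightarrow> complex) \<Rightarrow> complex) \<Rightarrow> bool" where
  "is_complex_measure F \<longleftrightarrow>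
     (\<exists>\<mu>\<^sub>1 \<mu>\<^sub>2 \<mu>\<^sub>3 \<mu>\<^sub>4.
        radon_measure \<mu>\<^sub>1 \<and> radon_measure \<mu>\<^sub>2 \<and> radon_measure \<mu>\<^sub>3 \<and> radon_measure \<mu>\<^sub>4 \<and>
        (\<forall>\<phi>\<in>test_funs. F \<phi> =
           (integral\<^sup>L \<mu>\<^sub>1 \<phi> - integral\<^sup>L \<mu>\<^sub>2 \<phi>) + \<i> * (integral\<^sup>L \<mu>\<^sub>3 \<phi> - integral\<^sup>L \<mu>\<^sub>4 \<phi>)))"

end

theory Submission
  imports Defs "HOL-Probability.Characteristic_Functions" "HOL-Probability.Sinc_Integral"
begin

text \<open>
  For test functions \<open>\<psi>\<close>, \<open>\<eta>\<close> the function \<open>fourier (fourier \<psi> \<cdot> \<eta>)\<close> is the convolution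
  \<open>\<integral> \<psi> (t - x) fourier \<eta> t dt\<close>, so that \<open>fourier_dist f (fourier \<psi> \<cdot> \<eta>)\<close> is the integral of
  \<open>g t \<cdot> fourier \<eta> t\<close> with \<open>g t = f (\<psi> (t - x))\<close>. Almost periodicity enters only through the boundedness
  of \<open>g\<close>, which bounds this value by a multiple of the \<open>L\<^sup>1\<close> norm of \<open>fourier \<eta>\<close>.

  Near an isolated point \<open>\<gamma>\<close> of the spectrum, a test function \<open>\<phi>\<close> with \<open>\<phi> \<gamma> = 0\<close> can be written
  \<open>fourier \<psi> \<cdot> \<eta>\<close> with \<open>\<eta> \<gamma> = 0\<close>, and multiplying \<open>\<eta>\<close> by a cut-off to a small ball around \<open>\<gamma>\<close> does not
  change the value of \<open>fourier_dist f\<close>. By Wiener's lemma the \<open>L\<^sup>1\<close> norm of the Fourier transform of the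
  cut-off function tends to 0 with the radius, so \<open>fourier_dist f \<phi> = 0\<close>. Hence no derivatives of
  point masses occur and \<open>fourier_dist f\<close> is a locally finite sum of point masses.
\<close>

section \<open>Calculus of smooth functions\<close>

text \<open>Why only point masses survive: the norm sending \<open>\<phi>\<close> to the L^1 norm of
  \<open>fourier \<phi>\<close> is invariant under dilations, whereas a derivative of a point mass
  scales with the dilation factor. A functional bounded in this norm and living at one point
  therefore sees only the value there; this is spectral synthesis for a single point, and Wiener's
  lemma is its quantitative form. The bound cannot be stated for \<open>f\<close> itself, which need
  not be a function; only its convolutions with test functions are bounded. Hence the division by
  \<open>fourier \<psi>\<close>, carried out near \<gamma>, where \<open>fourier \<psi>\<close> is
  close to 1. Two obstacles shape the rest. A tempered distribution is known only as a linear
  functional continuous for the seminorm topology, so it passes under an integral by way of finite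
  sums that converge in every seminorm, uniformly in \<open>x\<close>. And Wiener's lemma needs
  \<open>\<eta>\<close> to be itself a Fourier transform, hence an inversion formula.\<close>

primrec times_diff :: "nat \<Rightarrow> ('a::euclidean_space \<Rightarrow> complex) \<Rightarrow> bool" where
  "times_diff 0 \<phi> = (\<forall>x. \<phi> differentiable (at x))"
| "times_diff (Suc n) \<phi> =
     ((\<forall>x. \<phi> differentiable (at x)) \<and> (\<forall>b\<in>Basis. times_diff n (partial_deriv b \<phi>)))"

lemma times_diff_differentiable: "times_diff n \<phi> \<Longrightarrow> \<phi> differentiable (at x)"
  by (cases n) auto

lemma times_diff_SucD: "times_diff (Suc n) \<phi> \<Longrightarrow> times_diff n \<phi>"
  by (induction n arbitrary: \<phi>) auto

text \<open>An explicit derivative \<open>D\<close> takes the place of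
  \<open>frechet_derivative\<close>: order n + 1 follows from order n of the coefficients
  \<open>D x b\<close>. The closure properties below rest on this step.\<close>

lemma times_diff_SucI:
  assumes "\<And>x. (\<phi> has_derivative D x) (at x)"
    and "\<And>b. b \<in> Basis \<Longrightarrow> times_diff n (\<lambda>x. D x b)"
  shows "times_diff (Suc n) \<phi>"
proof -
  have "partial_deriv b \<phi> = (\<lambda>x. D x b)" for b
    using frechet_derivative_at[OF assms(1)] by (auto simp: partial_deriv_def)
  then show ?thesis using assms by (auto simp: differentiable_def)
qed

lemma partial_deriv_eq:
  "(\<phi> has_derivative D) (at x) \<Longrightarrow> partial_deriv b \<phi> x = D b"
  using frechet_derivative_at by (fastforce simp: partial_deriv_def)

lemma differentiable_has_derivative:
  "\<phi> differentiable (at x) \<Longrightarrow> (\<phi> has_derivative (\<lambda>h. partial_deriv h \<phi> x)) (at x)"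
  using frechet_derivative_works unfolding partial_deriv_def by blast

lemma iter_deriv_Nil [simp]: "iter_deriv [] \<phi> = \<phi>"
  by (simp add: iter_deriv_def)

lemma iter_deriv_Cons: "iter_deriv (b # bs) \<phi> = partial_deriv b (iter_deriv bs \<phi>)"
  by (simp add: iter_deriv_def)

lemma iter_deriv_snoc: "iter_deriv (bs @ [b]) \<phi> = iter_deriv bs (partial_deriv b \<phi>)"
  by (simp add: iter_deriv_def)

text \<open>The two sides peel derivatives off opposite ends: \<open>iter_deriv\<close> has the
  outermost one at the head of the list, \<open>times_diff\<close> strips the innermost one, which
  is the last list element. Recursion from inside suits inductions over sums, products and
  reciprocals.\<close>

lemma times_diff_iff:
  "times_diff n \<phi> \<longleftrightarrow>
     (\<forall>bs\<in>lists Basis. length bs \<le> n \<longrightarrow> (\<forall>x. iter_deriv bs \<phi> differentiable (at x)))"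
proof (induction n arbitrary: \<phi>)
  case (Suc n)
  show ?case (is "?L = ?R")
  proof
    assume L: ?L
    show ?R
    proof (intro ballI impI)
      fix bs :: "'a list" assume bs: "bs \<in> lists Basis" "length bs \<le> Suc n"
      show "\<forall>x. iter_deriv bs \<phi> differentiable (at x)"
      proof (cases bs rule: rev_cases)
        case (snoc cs c)
        then have "times_diff n (partial_deriv c \<phi>)" using L bs by auto
        then show ?thesis using bs snoc by (simp add: Suc iter_deriv_snoc)
      qed (use L in auto)
    qed
  next
    assume R: ?R
    have "times_diff n (partial_deriv b \<phi>)" if "b \<in> Basis" for b
      unfolding Suc
    proof (intro ballI impI)
      fix bs :: "'a list" assume bs: "bs \<in> lists Basis" "length bs \<le> n"
      with that R have "\<forall>x. iter_deriv (bs @ [b]) \<phi> differentiable (at x)" by auto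
      then show "\<forall>x. iter_deriv bs (partial_deriv b \<phi>) differentiable (at x)"
        by (simp add: iter_deriv_snoc)
    qed
    moreover have "\<forall>x. \<phi> differentiable (at x)" using R[rule_format, of "[]"] by simp
    ultimately show ?L by simp
  qed
qed auto

lemma smooth_fun_iff: "smooth_fun \<phi> \<longleftrightarrow> (\<forall>n. times_diff n \<phi>)"
  unfolding smooth_fun_def times_diff_iff by auto

lemma smooth_fun_differentiable: "smooth_fun \<phi> \<Longrightarrow> \<phi> differentiable (at x)"
  using smooth_fun_iff times_diff_differentiable by blast

lemma smooth_fun_has_derivative:
  "smooth_fun \<phi> \<Longrightarrow> (\<phi> has_derivative (\<lambda>h. partial_deriv h \<phi> x)) (at x)"
  by (simp add: differentiable_has_derivative smooth_fun_differentiable)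

lemma smooth_fun_continuous: "smooth_fun \<phi> \<Longrightarrow> continuous_on S \<phi>"
  by (metis continuous_at_imp_continuous_on differentiable_imp_continuous_within smooth_fun_differentiable)

lemma smooth_fun_partial_deriv: "smooth_fun \<phi> \<Longrightarrow> b \<in> Basis \<Longrightarrow> smooth_fun (partial_deriv b \<phi>)"
  unfolding smooth_fun_iff using times_diff.simps(2) by blast

lemma smooth_fun_iter_deriv: "smooth_fun \<phi> \<Longrightarrow> bs \<in> lists Basis \<Longrightarrow> smooth_fun (iter_deriv bs \<phi>)"
  by (induction bs) (auto simp: iter_deriv_Cons smooth_fun_partial_deriv)

section \<open>Closure of smooth functions under algebra, reciprocals and affine maps\<close>

lemma times_diff_const: "times_diff n (\<lambda>x. c)"
proof (induction n arbitrary: c)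
  case (Suc n)
  show ?case by (rule times_diff_SucI[OF has_derivative_const]) (rule Suc)
qed simp

lemma times_diff_add:
  "times_diff n \<phi> \<Longrightarrow> times_diff n \<psi> \<Longrightarrow> times_diff n (\<lambda>x. \<phi> x + \<psi> x)"
proof (induction n arbitrary: \<phi> \<psi>)
  case (Suc n)
  show ?case
    by (rule times_diff_SucI[OF has_derivative_add[OF differentiable_has_derivative differentiable_has_derivative]])
      (use Suc in \<open>auto\<close>)
qed auto

lemma times_diff_mult:
  "times_diff n \<phi> \<Longrightarrow> times_diff n \<psi> \<Longrightarrow> times_diff n (\<lambda>x. \<phi> x * \<psi> x)"
proof (induction n arbitrary: \<phi> \<psi>)
  case (Suc n)
  show ?case
    by (rule times_diff_SucI[OF has_derivative_mult[OF differentiable_has_derivative differentiable_has_derivative]])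
      (use Suc in \<open>auto intro!: times_diff_add Suc.IH times_diff_SucD[of n \<phi>] times_diff_SucD[of n \<psi>]\<close>)
qed auto

lemma times_diff_inverse:
  "times_diff n \<phi> \<Longrightarrow> (\<And>x. \<phi> x \<noteq> 0) \<Longrightarrow> times_diff n (\<lambda>x. inverse (\<phi> x))"
proof (induction n arbitrary: \<phi>)
  case (Suc n)
  \<comment> \<open>The derivative of the reciprocal contains the reciprocal itself, one order
    lower.\<close>
  have "times_diff n (\<lambda>x. inverse (\<phi> x))" using Suc times_diff_SucD by blast
  moreover have "times_diff n (partial_deriv b \<phi>)" if "b \<in> Basis" for b
    using Suc that by simp
  ultimately have "times_diff n (\<lambda>x. (-1) * (inverse (\<phi> x) * partial_deriv b \<phi> x * inverse (\<phi> x)))"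
    if "b \<in> Basis" for b
    using that by (intro times_diff_mult times_diff_const)
  then show ?case
    by (intro times_diff_SucI[OF Deriv.has_derivative_inverse[OF _ differentiable_has_derivative]])
      (use Suc in \<open>auto\<close>)
qed (auto simp: field_differentiable_def)

lemma times_diff_affine:
  "times_diff n \<phi> \<Longrightarrow> times_diff n (\<lambda>x. \<phi> (c *\<^sub>R x + v))"
proof (induction n arbitrary: \<phi>)
  case 0
  then show ?case
    by (auto intro!: differentiable_compose[of \<phi> "\<lambda>x. c *\<^sub>R x + v"] derivative_intros)
next
  case (Suc n)
  have *: "((\<lambda>x. \<phi> (c *\<^sub>R x + v)) has_derivative (\<lambda>h. partial_deriv (c *\<^sub>R h) \<phi> (c *\<^sub>R x + v))) (at x)" for x
    using Suc.prems
    by (intro has_derivative_compose[OF _ differentiable_has_derivative, where f="\<lambda>x. c *\<^sub>R x + v"])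
      (auto intro!: derivative_eq_intros)
  have "partial_deriv (c *\<^sub>R b) \<phi> x = of_real c * partial_deriv b \<phi> x" for b x
    using Suc.prems
      linear_scale[OF has_derivative_linear[OF differentiable_has_derivative[of \<phi> x]], of c b]
    by (auto simp: scaleR_conv_of_real)
  with * have *: "((\<lambda>x. \<phi> (c *\<^sub>R x + v)) has_derivative (\<lambda>h. of_real c * partial_deriv h \<phi> (c *\<^sub>R x + v))) (at x)" for x
    by simp
  show ?case
    by (rule times_diff_SucI[OF *]) (use Suc in \<open>auto intro!: times_diff_mult times_diff_const\<close>)
qed

lemma times_diff_inner: "times_diff n (\<lambda>x. of_real (x \<bullet> v))"
proof (cases n)
  case 0
  then show ?thesis by (auto intro!: derivative_eq_intros simp: differentiable_def)
next
  case (Suc m)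
  have *: "((\<lambda>x. complex_of_real (x \<bullet> v)) has_derivative (\<lambda>h. of_real (h \<bullet> v))) (at x)" for x
    by (auto intro!: derivative_eq_intros)
  show ?thesis unfolding Suc by (rule times_diff_SucI[OF *]) (rule times_diff_const)
qed

lemma smooth_fun_const: "smooth_fun (\<lambda>x. c)"
  by (simp add: smooth_fun_iff times_diff_const)

lemma smooth_fun_add: "smooth_fun \<phi> \<Longrightarrow> smooth_fun \<psi> \<Longrightarrow> smooth_fun (\<lambda>x. \<phi> x + \<psi> x)"
  by (simp add: smooth_fun_iff times_diff_add)

lemma smooth_fun_mult: "smooth_fun \<phi> \<Longrightarrow> smooth_fun \<psi> \<Longrightarrow> smooth_fun (\<lambda>x. \<phi> x * \<psi> x)"
  by (simp add: smooth_fun_iff times_diff_mult)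

lemma smooth_fun_cmult: "smooth_fun \<phi> \<Longrightarrow> smooth_fun (\<lambda>x. c * \<phi> x)"
  by (simp add: smooth_fun_mult smooth_fun_const)

lemma smooth_fun_diff: "smooth_fun \<phi> \<Longrightarrow> smooth_fun \<psi> \<Longrightarrow> smooth_fun (\<lambda>x. \<phi> x - \<psi> x)"
  using smooth_fun_add[of \<phi> "\<lambda>x. (-1) * \<psi> x"] smooth_fun_cmult[of \<psi> "-1"] by simp

lemma smooth_fun_inverse: "smooth_fun \<phi> \<Longrightarrow> (\<And>x. \<phi> x \<noteq> 0) \<Longrightarrow> smooth_fun (\<lambda>x. inverse (\<phi> x))"
  by (simp add: smooth_fun_iff times_diff_inverse)

lemma smooth_fun_affine: "smooth_fun \<phi> \<Longrightarrow> smooth_fun (\<lambda>x. \<phi> (c *\<^sub>R x + v))"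
  by (simp add: smooth_fun_iff times_diff_affine)

lemma smooth_fun_inner: "smooth_fun (\<lambda>x. of_real (x \<bullet> v))"
  by (simp add: smooth_fun_iff times_diff_inner)

lemma smooth_fun_exp_inner: "smooth_fun (\<lambda>x. exp (c * of_real (x \<bullet> v)))"
proof -
  have D: "((\<lambda>x. exp (c * of_real (x \<bullet> v))) has_derivative
      (\<lambda>h. (c * of_real (h \<bullet> v)) * exp (c * of_real (x \<bullet> v)))) (at x)" for x :: 'a
    by (rule has_derivative_eq_rhs[OF has_derivative_compose[OF _
          DERIV_exp[unfolded has_field_derivative_def], where f="\<lambda>x. c * of_real (x \<bullet> v)"]])
      (auto intro!: derivative_eq_intros)
  have "times_diff n (\<lambda>x. exp (c * of_real (x \<bullet> v)))" for n
  proof (induction n)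
    case 0
    then show ?case using D by (auto simp: differentiable_def)
  next
    case (Suc n)
    then show ?case
      by (intro times_diff_SucI[OF D]) (intro times_diff_mult times_diff_const)
  qed
  then show ?thesis by (simp add: smooth_fun_iff)
qed

section \<open>Iterated derivatives of sums, multiples and reflections\<close>

lemma iter_deriv_add:
  assumes "smooth_fun \<phi>" "smooth_fun \<psi>" "bs \<in> lists Basis"
  shows "iter_deriv bs (\<lambda>x. \<phi> x + \<psi> x) = (\<lambda>x. iter_deriv bs \<phi> x + iter_deriv bs \<psi> x)"
  using assms(3)
proof (induction bs)
  case (Cons b bs)
  have "partial_deriv b (\<lambda>x. iter_deriv bs \<phi> x + iter_deriv bs \<psi> x) x =
      partial_deriv b (iter_deriv bs \<phi>) x + partial_deriv b (iter_deriv bs \<psi>) x" for x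
    using Cons assms
    by (intro partial_deriv_eq has_derivative_add smooth_fun_has_derivative smooth_fun_iter_deriv) auto
  then show ?case using Cons by (auto simp: iter_deriv_Cons)
qed simp

lemma iter_deriv_cmult:
  assumes "smooth_fun \<phi>" "bs \<in> lists Basis"
  shows "iter_deriv bs (\<lambda>x. c * \<phi> x) = (\<lambda>x. c * iter_deriv bs \<phi> x)"
  using assms(2)
proof (induction bs)
  case (Cons b bs)
  have "partial_deriv b (\<lambda>x. c * iter_deriv bs \<phi> x) x = c * partial_deriv b (iter_deriv bs \<phi>) x" for x
    using Cons assms
    by (intro partial_deriv_eq has_derivative_mult_right smooth_fun_has_derivative smooth_fun_iter_deriv) auto
  then show ?case using Cons by (auto simp: iter_deriv_Cons)
qed simp

lemma iter_deriv_reflect: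
  assumes "smooth_fun \<phi>" "bs \<in> lists Basis"
  shows "iter_deriv bs (\<lambda>x. \<phi> (v - x)) = (\<lambda>x. (-1) ^ length bs * iter_deriv bs \<phi> (v - x))"
  using assms(2)
proof (induction bs)
  case (Cons b bs)
  let ?g = "iter_deriv bs \<phi>"
  have s: "smooth_fun ?g" using Cons assms smooth_fun_iter_deriv by auto
  have "partial_deriv b (\<lambda>x. (-1) ^ length bs * ?g (v - x)) x =
      (-1) ^ length bs * partial_deriv (-b) ?g (v - x)" for x
    by (intro partial_deriv_eq has_derivative_mult_right
        has_derivative_compose[OF _ smooth_fun_has_derivative[OF s], where f="\<lambda>x. v - x"])
      (auto intro!: derivative_eq_intros)
  moreover have "partial_deriv (-b) ?g y = - partial_deriv b ?g y" for y
    using linear_neg[OF has_derivative_linear[OF smooth_fun_has_derivative[OF s]]] by simp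
  ultimately show ?case using Cons by (auto simp: iter_deriv_Cons)
qed simp

section \<open>Supports and bump functions\<close>

lemma fun_support_altdef: "fun_support \<phi> = closure {x. \<phi> x \<noteq> 0}"
  by (simp add: fun_support_def support_on_def)

lemma not_in_fun_support_iff: "x \<notin> fun_support \<phi> \<longleftrightarrow> (\<exists>U. open U \<and> x \<in> U \<and> (\<forall>y\<in>U. \<phi> y = 0))"
  unfolding fun_support_altdef closure_iff_nhds_not_empty by blast

lemma in_fun_supportI: "\<phi> x \<noteq> 0 \<Longrightarrow> x \<in> fun_support \<phi>"
  unfolding fun_support_altdef using closure_subset by fastforce

lemma fun_support_mono: "(\<And>x. \<psi> x = 0 \<Longrightarrow> \<phi> x = 0) \<Longrightarrow> fun_support \<phi> \<subseteq> fun_support \<psi>"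
  unfolding fun_support_altdef by (rule closure_mono) auto

lemma fun_support_partial_deriv: "fun_support (partial_deriv b \<phi>) \<subseteq> fun_support \<phi>"
proof
  fix x assume "x \<in> fun_support (partial_deriv b \<phi>)"
  show "x \<in> fun_support \<phi>"
  proof (rule ccontr)
    assume "x \<notin> fun_support \<phi>"
    then obtain U where U: "open U" "x \<in> U" "\<forall>y\<in>U. \<phi> y = 0"
      unfolding not_in_fun_support_iff by blast
    have "partial_deriv b \<phi> y = 0" if "y \<in> U" for y
    proof -
      have "((\<lambda>_. 0) has_derivative (\<lambda>_. 0)) (at y)" by simp
      then have "(\<phi> has_derivative (\<lambda>_. 0)) (at y)"
        by (rule has_derivative_transform_within_open[OF _ U(1) that]) (use U in auto)
      then show ?thesis by (rule partial_deriv_eq)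
    qed
    then have "x \<notin> fun_support (partial_deriv b \<phi>)" unfolding not_in_fun_support_iff using U by blast
    with \<open>x \<in> fun_support (partial_deriv b \<phi>)\<close> show False by simp
  qed
qed

section \<open>Operations on test functions\<close>

lemma test_funs_iff: "\<phi> \<in> test_funs \<longleftrightarrow> smooth_fun \<phi> \<and> bounded {x. \<phi> x \<noteq> 0}"
  by (simp add: test_funs_def fun_support_altdef)

lemma test_funs_smooth: "\<phi> \<in> test_funs \<Longrightarrow> smooth_fun \<phi>"
  by (simp add: test_funs_iff)

lemma test_funs_add:
  assumes "\<phi> \<in> test_funs" "\<psi> \<in> test_funs"
  shows "(\<lambda>x. \<phi> x + \<psi> x) \<in> test_funs"
proof -
  have "{x. \<phi> x + \<psi> x \<noteq> 0} \<subseteq> {x. \<phi> x \<noteq> 0} \<union> {x. \<psi> x \<noteq> 0}" by auto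
  from bounded_subset[OF _ this] assms show ?thesis by (simp add: test_funs_iff smooth_fun_add)
qed

lemma test_funs_mult:
  assumes "\<phi> \<in> test_funs" "smooth_fun \<psi>"
  shows "(\<lambda>x. \<phi> x * \<psi> x) \<in> test_funs"
proof -
  have "{x. \<phi> x * \<psi> x \<noteq> 0} \<subseteq> {x. \<phi> x \<noteq> 0}" by auto
  from bounded_subset[OF _ this] assms show ?thesis by (simp add: test_funs_iff smooth_fun_mult)
qed

lemma test_funs_mult2: "\<phi> \<in> test_funs \<Longrightarrow> smooth_fun \<psi> \<Longrightarrow> (\<lambda>x. \<psi> x * \<phi> x) \<in> test_funs"
  using test_funs_mult[of \<phi> \<psi>] by (simp add: mult.commute)

lemma test_funs_cmult: "\<phi> \<in> test_funs \<Longrightarrow> (\<lambda>x. c * \<phi> x) \<in> test_funs"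
  by (simp add: test_funs_mult2 smooth_fun_const)

lemma test_funs_diff: "\<phi> \<in> test_funs \<Longrightarrow> \<psi> \<in> test_funs \<Longrightarrow> (\<lambda>x. \<phi> x - \<psi> x) \<in> test_funs"
  using test_funs_add[of \<phi> "\<lambda>x. (-1) * \<psi> x"] test_funs_cmult[of \<psi> "-1"] by simp

lemma test_funs_partial_deriv: "\<phi> \<in> test_funs \<Longrightarrow> b \<in> Basis \<Longrightarrow> partial_deriv b \<phi> \<in> test_funs"
  unfolding test_funs_def using fun_support_partial_deriv[of b \<phi>]
  by (auto simp: smooth_fun_partial_deriv fun_support_def compact_eq_bounded_closed intro: bounded_subset)

lemma test_funs_iter_deriv: "\<phi> \<in> test_funs \<Longrightarrow> bs \<in> lists Basis \<Longrightarrow> iter_deriv bs \<phi> \<in> test_funs"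
  by (induction bs) (auto simp: iter_deriv_Cons test_funs_partial_deriv)

lemma test_funs_affine:
  assumes "\<phi> \<in> test_funs" "c \<noteq> 0"
  shows "(\<lambda>x. \<phi> (c *\<^sub>R x + v)) \<in> test_funs"
proof -
  from assms obtain a where a: "\<And>x. \<phi> x \<noteq> 0 \<Longrightarrow> norm x \<le> a"
    by (auto simp: test_funs_iff bounded_iff)
  have "norm x \<le> (a + norm v) / \<bar>c\<bar>" if "\<phi> (c *\<^sub>R x + v) \<noteq> 0" for x
  proof -
    have "\<bar>c\<bar> * norm x \<le> norm (c *\<^sub>R x + v) + norm v"
      using norm_triangle_ineq4[of "c *\<^sub>R x + v" v] by simp
    with a[OF that] have "\<bar>c\<bar> * norm x \<le> a + norm v" by linarith
    then show ?thesis using assms(2) by (simp add: field_simps)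
  qed
  then have "bounded {x. \<phi> (c *\<^sub>R x + v) \<noteq> 0}" by (auto simp: bounded_iff)
  then show ?thesis using assms by (simp add: test_funs_iff smooth_fun_affine)
qed

lemma test_funs_reflect: "\<phi> \<in> test_funs \<Longrightarrow> (\<lambda>x. \<phi> (v - x)) \<in> test_funs"
  using test_funs_affine[of \<phi> "-1" v] by simp

lemma test_funs_bounded_support:
  assumes "\<phi> \<in> test_funs"
  obtains r where "r > 0" "\<And>x. norm x \<ge> r \<Longrightarrow> \<phi> x = 0"
proof -
  from assms obtain a where "\<And>x. \<phi> x \<noteq> 0 \<Longrightarrow> norm x \<le> a"
    by (auto simp: test_funs_iff bounded_iff)
  then show ?thesis by (intro that[of "max a 0 + 1"]) force+
qed

section \<open>Infinitely flat functions and smooth cut-offs\<close>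

lemma has_derivative_quadratic_bound:
  fixes f :: "'a::real_normed_vector \<Rightarrow> 'b::real_normed_vector"
  assumes "bounded_linear L" "\<And>h. norm (f (x + h) - f x - L h) \<le> K * (norm h)\<^sup>2"
  shows "(f has_derivative L) (at x)"
  unfolding has_derivative_at
proof (intro conjI assms(1))
  have "((\<lambda>h::'a. K * norm h) \<longlongrightarrow> K * norm (0::'a)) (at 0)"
    by (intro tendsto_intros)
  then have *: "((\<lambda>h::'a. K * norm h) \<longlongrightarrow> 0) (at 0)" by simp
  show "(\<lambda>h. norm (f (x + h) - f x - L h) / norm h) \<midarrow>0\<rightarrow> 0"
  proof (rule tendsto_sandwich[OF _ _ tendsto_const *])
    show "\<forall>\<^sub>F h in at 0. norm (f (x + h) - f x - L h) / norm h \<le> K * norm h"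
      using assms(2) by (auto simp: eventually_at_filter power2_eq_square field_simps)
  qed auto
qed

text \<open>Differentiating exp(-1/t) only produces further negative powers of t, so the family over
  all \<open>m\<close> is closed under differentiation up to linear combinations;
  \<open>m = 0\<close> is the classical smooth function that is not analytic.\<close>

definition flat :: "nat \<Rightarrow> real \<Rightarrow> real" where
  "flat m t = (if t \<le> 0 then 0 else exp (- 1 / t) / t ^ m)"

lemma power_div_fact_le_exp:
  fixes x :: real
  assumes "x \<ge> 0"
  shows "x ^ n / fact n \<le> exp x"
proof -
  have "(\<Sum>k\<in>{n}. x ^ k /\<^sub>R fact k) \<le> (\<Sum>k. x ^ k /\<^sub>R fact k)"
    using assms by (intro sum_le_suminf summable_exp_generic) auto
  then show ?thesis by (simp add: exp_def divide_inverse_commute)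
qed

text \<open>With u = 1/t the exponential series gives exp u \<ge> u^(m+2) / (m+2)!. The two extra
  powers leave \<open>t\<^sup>2\<close>, the quadratic remainder that makes the derivative at 0
  vanish.\<close>

lemma flat_bound: "\<bar>flat m t\<bar> \<le> fact (m + 2) * t\<^sup>2"
proof (cases "t \<le> 0")
  case False
  then have t: "t > 0" by simp
  define u where "u = 1 / t"
  have u: "u > 0" using t by (simp add: u_def)
  have "u ^ (m + 2) \<le> fact (m + 2) * exp u"
    using power_div_fact_le_exp[of u "m + 2"] u by (simp only: divide_le_eq fact_gt_zero mult.commute if_True)
  then have "exp (- u) * u ^ (m + 2) \<le> exp (- u) * (fact (m + 2) * exp u)"
    by (intro mult_left_mono) auto
  also have "\<dots> = fact (m + 2)"
    by (simp add: exp_minus del: fact_Suc add_2_eq_Suc')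
  finally have "exp (- u) * u ^ (m + 2) * t\<^sup>2 \<le> fact (m + 2) * t\<^sup>2"
    by (intro mult_right_mono) auto
  moreover have "flat m t = exp (- u) * u ^ (m + 2) * t\<^sup>2"
    using t by (simp add: flat_def u_def power_add power_divide power2_eq_square)
  moreover have "flat m t \<ge> 0" by (simp add: flat_def)
  ultimately show ?thesis by simp
qed (simp add: flat_def)

lemma flat_has_derivative:
  "(flat m has_real_derivative flat (m + 2) t - real m * flat (m + 1) t) (at t)"
proof (cases t "0::real" rule: linorder_cases)
  case less
  have "((\<lambda>_. 0) has_real_derivative 0) (at t)" by simp
  then have "(flat m has_real_derivative 0) (at t)"
    by (rule has_field_derivative_transform_within_open[where S="{..<0}"]) (use less in \<open>auto simp: flat_def\<close>)
  with less show ?thesis by (simp add: flat_def)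
next
  case greater
  have "((\<lambda>t. exp (- 1 / t) / t ^ m) has_real_derivative
      (exp (- 1 / t) / t ^ (m + 2) - real m * (exp (- 1 / t) / t ^ (m + 1)))) (at t)"
  proof (rule DERIV_cong)
    show "((\<lambda>t. exp (- 1 / t) / t ^ m) has_real_derivative
        ((exp (- 1 / t) * (1 / t\<^sup>2)) * t ^ m - exp (- 1 / t) * (real m * t ^ (m - 1))) / (t ^ m * t ^ m)) (at t)"
      using greater by (auto intro!: derivative_eq_intros simp: power2_eq_square)
    have "real m * t ^ (m - 1) = real m * t ^ m / t"
      using greater by (cases m) auto
    then show "((exp (- 1 / t) * (1 / t\<^sup>2)) * t ^ m - exp (- 1 / t) * (real m * t ^ (m - 1))) / (t ^ m * t ^ m) =
        exp (- 1 / t) / t ^ (m + 2) - real m * (exp (- 1 / t) / t ^ (m + 1))"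
      using greater by (simp add: diff_divide_distrib power_add power2_eq_square mult_ac)
  qed
  then have "(flat m has_real_derivative (exp (- 1 / t) / t ^ (m + 2) - real m * (exp (- 1 / t) / t ^ (m + 1)))) (at t)"
    by (rule has_field_derivative_transform_within_open[where S="{0<..}"]) (use greater in \<open>auto simp: flat_def\<close>)
  with greater show ?thesis by (simp add: flat_def)
next
  case equal
  have "(flat m has_derivative (\<lambda>h. 0)) (at 0)"
    by (rule has_derivative_quadratic_bound[where K="fact (m + 2)"])
      (use flat_bound[of m] in \<open>auto simp: flat_def[of m 0]\<close>)
  with equal show ?thesis by (simp add: flat_def has_field_derivative_def lambda_zero)
qed

text \<open>The argument is quadratic because \<open>x \<bullet> x\<close> is smooth, unlike the
  norm. Its derivative is a combination of \<open>flat\<close> functions times a linear form, so the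
  induction runs with \<open>m\<close> arbitrary.\<close>

lemma smooth_fun_flat:
  "smooth_fun (\<lambda>x::'a::euclidean_space. of_real (flat m (a * (x \<bullet> x) + c)))"
proof -
  have D: "((\<lambda>x::'a. complex_of_real (flat m (a * (x \<bullet> x) + c))) has_derivative
     (\<lambda>h. (of_real (flat (m + 2) (a * (x \<bullet> x) + c)) + of_real (- real m) * of_real (flat (m + 1) (a * (x \<bullet> x) + c)))
        * (of_real (2 * a) * of_real (x \<bullet> h)))) (at x)" for x m
    by (rule has_derivative_eq_rhs[OF has_derivative_of_real[OF has_derivative_compose[OF _
          flat_has_derivative[unfolded has_field_derivative_def], where f="\<lambda>x. a * (x \<bullet> x) + c"]]])
      (auto intro!: derivative_eq_intros simp: algebra_simps inner_commute)
  have "times_diff n (\<lambda>x::'a. complex_of_real (flat m (a * (x \<bullet> x) + c)))" for n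
  proof (induction n arbitrary: m)
    case 0
    then show ?case using D by (auto simp: differentiable_def)
  next
    case (Suc n)
    then show ?case
      by (intro times_diff_SucI[OF D] times_diff_mult times_diff_add times_diff_const times_diff_inner)
  qed
  then show ?thesis by (simp add: smooth_fun_iff)
qed

text \<open>The quotient p / (p + q), where p is positive exactly for |x| < 2 and q exactly for |x|
  > 1, so that the denominator never vanishes. It is then dilated by \<open>r\<close> and moved to
  \<open>c\<close>.\<close>

lemma bump_exists:
  fixes c :: "'a::euclidean_space"
  assumes "r > 0"
  obtains \<beta> :: "'a \<Rightarrow> real" where
    "(\<lambda>x. of_real (\<beta> x)) \<in> test_funs" "\<And>x. 0 \<le> \<beta> x" "\<And>x. \<beta> x \<le> 1"
    "\<And>x. dist c x \<le> r \<Longrightarrow> \<beta> x = 1" "\<And>x. dist c x \<ge> 2 * r \<Longrightarrow> \<beta> x = 0"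
proof -
  define p where "p = (\<lambda>x::'a. flat 0 (- 1 * (x \<bullet> x) + 4))"
  define q where "q = (\<lambda>x::'a. flat 0 (1 * (x \<bullet> x) + (- 1)))"
  have nn: "p x \<ge> 0" "q x \<ge> 0" for x by (auto simp: p_def q_def flat_def)
  have pos: "p x + q x > 0" for x
    by (cases "x \<bullet> x < 4") (auto simp: p_def q_def flat_def add_pos_nonneg)
  define \<beta> where "\<beta> = (\<lambda>x. p x * inverse (p x + q x))"
  have "smooth_fun (\<lambda>x. complex_of_real (p x) * inverse (of_real (p x) + of_real (q x)))"
  proof (intro smooth_fun_mult smooth_fun_inverse smooth_fun_add)
    show "complex_of_real (p x) + complex_of_real (q x) \<noteq> 0" for x
      using pos[of x] by (metis less_irrefl of_real_add of_real_eq_0_iff)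
  qed (simp_all only: p_def q_def smooth_fun_flat)
  then have sm: "smooth_fun (\<lambda>x. complex_of_real (\<beta> x))" by (simp add: \<beta>_def)
  have sm: "smooth_fun (\<lambda>x. of_real (\<beta> ((1 / r) *\<^sub>R (x - c))))"
    using smooth_fun_affine[OF sm, of "1 / r" "- (1 / r) *\<^sub>R c"] by (simp add: algebra_simps)
  have zero: "\<beta> ((1 / r) *\<^sub>R (x - c)) = 0" if "dist c x \<ge> 2 * r" for x
  proof -
    have "norm ((1 / r) *\<^sub>R (x - c)) \<ge> 2"
      unfolding norm_scaleR using that assms by (simp add: dist_norm norm_minus_commute field_simps)
    then have "(norm ((1 / r) *\<^sub>R (x - c)))\<^sup>2 \<ge> 2\<^sup>2" by (intro power_mono) auto
    then have "p ((1 / r) *\<^sub>R (x - c)) = 0" unfolding p_def flat_def dot_square_norm by simp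
    then show ?thesis by (simp add: \<beta>_def)
  qed
  show ?thesis
  proof (rule that)
    have "{x. complex_of_real (\<beta> ((1 / r) *\<^sub>R (x - c))) \<noteq> 0} \<subseteq> cball c (2 * r)"
      using zero by (force simp: not_le)
    from bounded_subset[OF bounded_cball this] sm
    show "(\<lambda>x. complex_of_real (\<beta> ((1 / r) *\<^sub>R (x - c)))) \<in> test_funs"
      by (simp only: test_funs_iff)
  next
    show "0 \<le> \<beta> ((1 / r) *\<^sub>R (x - c))" "\<beta> ((1 / r) *\<^sub>R (x - c)) \<le> 1" for x
      using nn pos[of "(1 / r) *\<^sub>R (x - c)"] by (auto simp: \<beta>_def field_simps)
  next
    fix x assume "dist c x \<le> r"
    then have "norm ((1 / r) *\<^sub>R (x - c)) \<le> 1" using assms by (simp add: dist_norm norm_minus_commute)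
    then have "q ((1 / r) *\<^sub>R (x - c)) = 0" unfolding q_def flat_def dot_square_norm
      by (simp add: power_le_one)
    then show "\<beta> ((1 / r) *\<^sub>R (x - c)) = 1" using pos[of "(1 / r) *\<^sub>R (x - c)"] by (simp add: \<beta>_def)
  qed (rule zero)
qed

section \<open>The Fourier transform of integrable functions\<close>

lemma continuous_bounded_support_integrable:
  fixes \<phi> :: "'a::euclidean_space \<Rightarrow> complex"
  assumes "continuous_on UNIV \<phi>" "\<And>x. norm x \<ge> r \<Longrightarrow> \<phi> x = 0"
  shows "integrable lborel \<phi>"
proof -
  have "integrable lborel (\<lambda>x. indicator (cball 0 r) x *\<^sub>R \<phi> x)"
    by (intro borel_integrable_compact continuous_on_subset[OF assms(1)]) auto
  also have "(\<lambda>x. indicator (cball 0 r) x *\<^sub>R \<phi> x) = \<phi>"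
    using assms(2) by (auto simp: indicator_def fun_eq_iff)
  finally show ?thesis .
qed

lemma test_funs_continuous: "\<phi> \<in> test_funs \<Longrightarrow> continuous_on S \<phi>"
  by (simp add: smooth_fun_continuous test_funs_smooth)

lemma test_funs_measurable: "\<phi> \<in> test_funs \<Longrightarrow> \<phi> \<in> borel_measurable borel"
  by (simp add: borel_measurable_continuous_onI test_funs_continuous)

lemma test_funs_integrable:
  assumes "\<phi> \<in> test_funs"
  shows "integrable lborel \<phi>"
proof -
  obtain r where "\<And>x. norm x \<ge> r \<Longrightarrow> \<phi> x = 0"
    using test_funs_bounded_support[OF assms] by blast
  with assms show ?thesis
    by (auto intro: continuous_bounded_support_integrable test_funs_continuous)
qed

lemma test_funs_bounded:
  assumes "\<phi> \<in> test_funs"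
  obtains M where "M > 0" "\<And>x. norm (\<phi> x) \<le> M"
proof -
  obtain r where r: "\<And>x. norm x \<ge> r \<Longrightarrow> \<phi> x = 0"
    using test_funs_bounded_support[OF assms] by blast
  have "compact (\<phi> ` cball 0 r)"
    using assms by (intro compact_continuous_image test_funs_continuous) auto
  then obtain M where M: "\<And>x. norm x \<le> r \<Longrightarrow> norm (\<phi> x) \<le> M"
    by (force dest!: compact_imp_bounded simp: bounded_iff)
  show ?thesis
  proof (rule that[of "max M 1"])
    show "norm (\<phi> x) \<le> max M 1" for x
      using M[of x] r[of x] by (cases "norm x \<le> r") auto
  qed simp
qed

section \<open>Affine changes of variables in Lebesgue integrals\<close>

lemma lborel_integral_affine:
  fixes F :: "'a::euclidean_space \<Rightarrow> 'b::{banach, second_countable_topology}"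
  assumes [measurable]: "F \<in> borel_measurable borel" and "c \<noteq> 0"
  shows "(LINT x|lborel. F x) = \<bar>c\<bar> ^ DIM('a) *\<^sub>R (LINT x|lborel. F (t + c *\<^sub>R x))"
proof -
  have "(LINT x|lborel. F x) =
      (LINT x|density (distr lborel borel (\<lambda>x. t + c *\<^sub>R x)) (\<lambda>_. ennreal (\<bar>c\<bar> ^ DIM('a))). F x)"
    using lborel_affine[OF assms(2), of t] by (simp add: ennreal_power)
  then show ?thesis by (simp add: integral_density integral_distr)
qed

lemma lborel_integral_translate:
  fixes F :: "'a::euclidean_space \<Rightarrow> 'b::{banach, second_countable_topology}"
  assumes "F \<in> borel_measurable borel"
  shows "(LINT x|lborel. F (x + t)) = (LINT x|lborel. F x)"
  using lborel_integral_affine[OF assms, of 1 t] by (simp add: add.commute)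

lemma lborel_integral_reflect:
  fixes F :: "'a::euclidean_space \<Rightarrow> 'b::{banach, second_countable_topology}"
  assumes "F \<in> borel_measurable borel"
  shows "(LINT x|lborel. F (t - x)) = (LINT x|lborel. F x)"
  using lborel_integral_affine[OF assms, of "-1" t] by simp

lemma lborel_integrable_affine:
  fixes F :: "'a::euclidean_space \<Rightarrow> 'b::{banach, second_countable_topology}"
  assumes "integrable lborel F" "c \<noteq> 0"
  shows "integrable lborel (\<lambda>x. F (t + c *\<^sub>R x))"
proof -
  have [measurable]: "F \<in> borel_measurable borel" using assms by auto
  have "integrable (density (distr lborel borel (\<lambda>x. t + c *\<^sub>R x)) (\<lambda>_. ennreal (\<bar>c\<bar> ^ DIM('a)))) F"
    using assms lborel_affine[OF assms(2), of t] by (simp add: ennreal_power)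
  then have "integrable lborel (\<lambda>x. \<bar>c\<bar> ^ DIM('a) *\<^sub>R F (t + c *\<^sub>R x))"
    by (simp add: integrable_density integrable_distr_eq)
  from integrable_scaleR_right[OF this, of "1 / \<bar>c\<bar> ^ DIM('a)"] show ?thesis
    using assms(2) by simp
qed

section \<open>Characters and the basic rules for the Fourier transform\<close>

definition wave :: "'a::euclidean_space \<Rightarrow> 'a \<Rightarrow> complex" where
  "wave y x = exp (- 2 * of_real pi * \<i> * of_real (x \<bullet> y))"

lemma fourier_eq: "fourier \<phi> y = (LINT x|lborel. \<phi> x * wave y x)"
  by (simp add: fourier_def wave_def)

lemma norm_wave [simp]: "norm (wave y x) = 1"
  by (simp add: wave_def norm_exp_eq_Re)

lemma wave_commute: "wave y x = wave x y"
  by (simp add: wave_def inner_commute)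

lemma wave_add_right: "wave y (x + z) = wave y x * wave y z"
  by (simp add: wave_def inner_add_left algebra_simps flip: exp_add)

lemma wave_add_left: "wave (y + z) x = wave y x * wave z x"
  by (simp add: wave_def inner_add_right algebra_simps flip: exp_add)

lemma wave_zero [simp]: "wave 0 x = 1" "wave x 0 = 1"
  by (simp_all add: wave_def)

lemma wave_scaleR: "wave (c *\<^sub>R y) x = wave y (c *\<^sub>R x)"
  by (simp add: wave_def)

lemma wave_minus: "wave (- y) x = wave y (- x)"
  by (simp add: wave_def)

lemma cnj_wave: "cnj (wave y x) = wave (- y) x"
  by (simp add: wave_def exp_cnj)

lemma wave_minus_mult [simp]: "wave (- y) x * wave y x = 1" "wave y x * wave (- y) x = 1"
  by (simp_all flip: wave_add_left)

lemma smooth_fun_wave: "smooth_fun (wave y)"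
  unfolding wave_def by (rule smooth_fun_exp_inner)

lemma continuous_wave [continuous_intros]:
  "continuous_on S f \<Longrightarrow> continuous_on S g \<Longrightarrow> continuous_on S (\<lambda>x. wave (f x) (g x))"
  unfolding wave_def by (intro continuous_intros)

lemma wave_measurable [measurable]:
  assumes [measurable]: "f \<in> borel_measurable M" "g \<in> borel_measurable M"
  shows "(\<lambda>x. wave (f x) (g x)) \<in> borel_measurable M"
  unfolding wave_def by measurable

lemma integrable_mult_wave:
  assumes "integrable lborel u"
  shows "integrable lborel (\<lambda>x. u x * wave y x)"
proof (rule Bochner_Integration.integrable_bound[OF assms])
  have [measurable]: "u \<in> borel_measurable borel" using assms by auto
  show "(\<lambda>x. u x * wave y x) \<in> borel_measurable lborel" by measurable
qed (simp add: norm_mult)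

lemma norm_fourier_le: "norm (fourier u y) \<le> (LINT x|lborel. norm (u x))"
proof -
  have "norm (fourier u y) \<le> (LINT x|lborel. norm (u x * wave y x))"
    unfolding fourier_eq by (rule integral_norm_bound)
  then show ?thesis by (simp add: norm_mult)
qed

lemma fourier_continuous:
  assumes "integrable lborel u"
  shows "continuous_on UNIV (fourier u)"
proof (rule continuous_at_imp_continuous_on, rule ballI)
  fix y :: 'a
  have [measurable]: "u \<in> borel_measurable borel" using assms by auto
  show "isCont (fourier u) y"
    unfolding continuous_at_sequentially comp_def
  proof (intro allI impI)
    fix Y assume Y: "Y \<longlonglongrightarrow> y"
    show "(\<lambda>n. fourier u (Y n)) \<longlonglongrightarrow> fourier u y"
      unfolding fourier_eq
    proof (rule integral_dominated_convergence[where w="\<lambda>x. norm (u x)"])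
      show "AE x in lborel. (\<lambda>n. u x * wave (Y n) x) \<longlonglongrightarrow> u x * wave y x"
        unfolding wave_def using Y by (intro AE_I2 tendsto_intros)
    qed (use assms in \<open>auto simp: norm_mult\<close>)
  qed
qed

lemma fourier_measurable: "integrable lborel u \<Longrightarrow> fourier u \<in> borel_measurable borel"
  by (intro borel_measurable_continuous_onI fourier_continuous)

text \<open>The product |u x| |v y| dominates the integrand, which is therefore integrable over the
  product space.\<close>

lemma fubini_bounded_kernel:
  fixes u :: "'a::euclidean_space \<Rightarrow> complex" and v :: "'b::euclidean_space \<Rightarrow> complex"
  assumes "integrable lborel u" "integrable lborel v"
    and [measurable]: "(\<lambda>p. K (fst p) (snd p)) \<in> borel_measurable (borel \<Otimes>\<^sub>M borel)"
    and K: "\<And>x y. norm (K x y) \<le> (1::real)"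
  shows "(LINT y|lborel. (LINT x|lborel. u x * K x y) * v y) =
         (LINT x|lborel. u x * (LINT y|lborel. K x y * v y))"
proof -
  have [measurable]: "u \<in> borel_measurable borel" "v \<in> borel_measurable borel" using assms by auto
  define f where "f = (\<lambda>x y. u x * K x y * v y)"
  have f [measurable]: "case_prod f \<in> borel_measurable (borel \<Otimes>\<^sub>M borel)"
    unfolding f_def case_prod_beta by measurable
  have K2: "(\<lambda>y. K x y) \<in> borel_measurable borel" for x
    using measurable_compose[OF measurable_Pair1'[of x borel borel] assms(3)] by simp
  have fb: "norm (f x y) \<le> norm (u x) * norm (v y)" for x y
    using mult_right_mono[OF mult_left_mono[OF K[of x y] norm_ge_zero[of "u x"]] norm_ge_zero[of "v y"]]
    by (simp add: f_def norm_mult)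
  have fi: "integrable lborel (f x)" for x
  proof (rule Bochner_Integration.integrable_bound)
    show "integrable lborel (\<lambda>y. u x * v y)" using assms by auto
    show "f x \<in> borel_measurable lborel" unfolding f_def using K2[of x] by measurable
  qed (use fb in \<open>auto simp: norm_mult\<close>)
  have "integrable (lborel \<Otimes>\<^sub>M lborel) (case_prod f)"
  proof (rule lborel_pair.Fubini_integrable)
    show "case_prod f \<in> borel_measurable (lborel \<Otimes>\<^sub>M lborel)" using f by simp
    show "integrable lborel (\<lambda>x. LINT y|lborel. norm (case_prod f (x, y)))"
    proof (rule Bochner_Integration.integrable_bound)
      show "integrable lborel (\<lambda>x. norm (u x) * (LINT y|lborel. norm (v y)))" using assms by auto
      show "AE x in lborel. norm (LINT y|lborel. norm (case_prod f (x, y)))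
          \<le> norm (norm (u x) * (LINT y|lborel. norm (v y)))"
      proof (intro AE_I2)
        fix x
        have "(LINT y|lborel. norm (f x y)) \<le> (LINT y|lborel. norm (u x) * norm (v y))"
          using fi assms by (intro integral_mono) (auto simp: fb)
        then show "norm (LINT y|lborel. norm (case_prod f (x, y)))
          \<le> norm (norm (u x) * (LINT y|lborel. norm (v y)))" by simp
      qed
    qed (use f in measurable)
  qed (use fi in auto)
  from lborel_pair.Fubini_integral[OF this] show ?thesis
    by (simp add: f_def mult.assoc flip: integral_mult_left_zero integral_mult_right_zero)
qed

text \<open>Fubini with the kernel \<open>wave\<close>, which is symmetric in its arguments. Moving
  the transform from one factor to the other is the source of the convolution formula, of Fourier
  inversion and of the Plancherel argument below.\<close>

lemma fourier_mult_formula: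
  assumes "integrable lborel u" "integrable lborel v"
  shows "(LINT s|lborel. fourier u s * v s) = (LINT z|lborel. u z * fourier v z)"
  using fubini_bounded_kernel[OF assms, where K="\<lambda>z s. wave s z"]
  by (simp add: fourier_eq wave_commute mult.commute)

lemma fourier_translate:
  assumes [measurable]: "u \<in> borel_measurable borel"
  shows "fourier (\<lambda>x. u (x - c)) y = wave y c * fourier u y"
proof -
  have "fourier (\<lambda>x. u (x - c)) y = (LINT x|lborel. u (x + c - c) * wave y (x + c))"
    unfolding fourier_eq by (rule lborel_integral_translate[symmetric]) measurable
  also have "\<dots> = (LINT x|lborel. wave y c * (u x * wave y x))"
    by (simp add: wave_add_right mult_ac)
  finally show ?thesis by (simp only: integral_mult_right_zero fourier_eq)
qed

lemma fourier_modulate: "fourier (\<lambda>x. u x * wave c x) y = fourier u (y + c)"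
  by (simp add: fourier_eq wave_add_left mult_ac)

lemma fourier_scale:
  fixes u :: "'a::euclidean_space \<Rightarrow> complex"
  assumes [measurable]: "u \<in> borel_measurable borel" and "c > 0"
  shows "fourier (\<lambda>x. u ((1 / c) *\<^sub>R x)) y = of_real (c ^ DIM('a)) * fourier u (c *\<^sub>R y)"
proof -
  have "fourier (\<lambda>x. u ((1 / c) *\<^sub>R x)) y =
     \<bar>c\<bar> ^ DIM('a) *\<^sub>R (LINT x|lborel. u ((1 / c) *\<^sub>R (0 + c *\<^sub>R x)) * wave y (0 + c *\<^sub>R x))"
    unfolding fourier_eq using assms(2) by (intro lborel_integral_affine) auto
  then show ?thesis using assms(2) by (simp add: fourier_eq wave_scaleR scaleR_conv_of_real)
qed

text \<open>Multiplication by \<open>wave x\<close> translates \<open>fourier \<eta>\<close> by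
  \<open>x\<close>, and the multiplication formula does the rest. Two applications of
  \<open>fourier\<close> reflect, so the kernel comes out as \<open>\<psi> (t - x)\<close>, exactly
  the functions on which almost periodicity of \<open>f\<close> is tested.\<close>

lemma fourier_mult_eq_convolution:
  fixes \<psi> \<eta> :: "'a::euclidean_space \<Rightarrow> complex"
  assumes "integrable lborel \<psi>" "integrable lborel \<eta>"
  shows "fourier (\<lambda>y. fourier \<psi> y * \<eta> y) x = (LINT t|lborel. \<psi> (t - x) * fourier \<eta> t)"
proof -
  have [measurable]: "\<psi> \<in> borel_measurable borel" "fourier \<eta> \<in> borel_measurable borel"
    using assms by (auto intro: fourier_measurable)
  have "fourier (\<lambda>y. fourier \<psi> y * \<eta> y) x = (LINT s|lborel. fourier \<psi> s * (\<eta> s * wave x s))"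
    by (simp add: fourier_eq mult.assoc)
  also have "\<dots> = (LINT z|lborel. \<psi> z * fourier \<eta> (z + x))"
    by (subst fourier_mult_formula) (use assms in \<open>auto simp: integrable_mult_wave fourier_modulate\<close>)
  also have "\<dots> = (LINT t|lborel. \<psi> (t - x) * fourier \<eta> t)"
    using lborel_integral_translate[of "\<lambda>t. \<psi> (t - x) * fourier \<eta> t" x] by simp
  finally show ?thesis .
qed

section \<open>Fourier transforms of test functions are Schwartz functions\<close>

text \<open>Each difference quotient has integral zero by translation invariance, and dominated
  convergence carries this over to the derivative. This is integration by parts without boundary
  terms.\<close>

lemma integral_partial_deriv_eq_0:
  fixes \<phi> :: "'a::euclidean_space \<Rightarrow> complex"
  assumes "\<phi> \<in> test_funs" "b \<in> Basis"
  shows "(LINT x|lborel. partial_deriv b \<phi> x) = 0"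
proof -
  define D where "D = partial_deriv b \<phi>"
  have D: "D \<in> test_funs" using assms by (simp add: D_def test_funs_partial_deriv)
  obtain M where M: "M > 0" "\<And>x. norm (D x) \<le> M" using test_funs_bounded[OF D] by blast
  obtain r where r: "r > 0" "\<And>x. norm x \<ge> r \<Longrightarrow> \<phi> x = 0"
    using test_funs_bounded_support[OF assms(1)] by blast
  note [measurable] = test_funs_measurable[OF assms(1)] test_funs_measurable[OF D]
  have der: "(\<phi> has_derivative (\<lambda>h. partial_deriv h \<phi> x)) (at x)" for x
    using assms test_funs_smooth smooth_fun_has_derivative by blast
  have scale: "partial_deriv (t *\<^sub>R b) \<phi> x = t *\<^sub>R D x" for t x
    unfolding D_def using linear_scale[OF has_derivative_linear[OF der]] by blast
  \<comment> \<open>The mean value inequality along the direction \<open>b\<close> bounds all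
    difference quotients by \<open>M\<close>.\<close>
  have lip: "norm (\<phi> (x + t *\<^sub>R b) - \<phi> x) \<le> M * \<bar>t\<bar>" for x t
  proof -
    have "((\<lambda>s. \<phi> (x + s *\<^sub>R b)) has_derivative (\<lambda>h. h *\<^sub>R D (x + s *\<^sub>R b))) (at s within UNIV)" for s
      unfolding scale[symmetric]
      by (rule has_derivative_compose[OF _ der, where f="\<lambda>s. x + s *\<^sub>R b"])
        (auto intro!: derivative_eq_intros)
    moreover have "onorm (\<lambda>h. h *\<^sub>R D (x + s *\<^sub>R b)) \<le> M" for s
      using mult_right_mono[OF M(2)[of "x + s *\<^sub>R b"] abs_ge_zero] by (intro onorm_le) (simp add: mult.commute)
    ultimately have "norm (\<phi> (x + t *\<^sub>R b) - \<phi> (x + 0 *\<^sub>R b)) \<le> M * norm (t - 0)"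
      by (intro differentiable_bound[OF convex_UNIV]) auto
    then show ?thesis by simp
  qed
  define s where "s = (\<lambda>n::nat. inverse (real (Suc n)))"
  have s: "s n > 0" "s n \<le> 1" for n by (auto simp: s_def field_simps)
  define q where "q = (\<lambda>n x. (1 / s n) *\<^sub>R (\<phi> (x + s n *\<^sub>R b) - \<phi> x))"
  have "(LINT x|lborel. q n x) = 0" for n
  proof -
    have "integrable lborel \<phi>" by (simp add: assms test_funs_integrable)
    then have "integrable lborel (\<lambda>x. \<phi> (x + s n *\<^sub>R b))"
      using lborel_integrable_affine[of \<phi> 1 "s n *\<^sub>R b"] by (simp add: add.commute)
    with \<open>integrable lborel \<phi>\<close> show ?thesis
      by (simp add: q_def lborel_integral_translate)
  qed
  moreover have "(\<lambda>n. LINT x|lborel. q n x) \<longlonglongrightarrow> (LINT x|lborel. D x)"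
  \<comment> \<open>The steps \<open>s n\<close> are at most 1, so all quotients vanish outside the
    ball of radius \<open>r + 1\<close>.\<close>
  proof (rule integral_dominated_convergence[where w="\<lambda>x. M * indicator (cball 0 (r + 1)) x"])
    show "integrable lborel (\<lambda>x::'a. M * indicator (cball 0 (r + 1)) x)"
      using emeasure_lborel_cball_finite[of "0::'a" "r + 1"]
      by (intro integrable_mult_right integrable_real_indicator) auto
    show "AE x in lborel. norm (q n x) \<le> M * indicator (cball 0 (r + 1)) x" for n
    proof (intro AE_I2)
      fix x
      have le: "norm (q n x) \<le> M"
        using lip[of x "s n"] s[of n] unfolding q_def norm_scaleR by (simp add: field_simps)
      show "norm (q n x) \<le> M * indicator (cball 0 (r + 1)) x"
      proof (cases "x \<in> cball 0 (r + 1)")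
        case False
        then have "norm x > r + 1" by simp
        moreover have "norm x - s n \<le> norm (x + s n *\<^sub>R b)"
          using norm_diff_ineq[of x "s n *\<^sub>R b"] assms(2) s(1)[of n] by simp
        ultimately have "norm (x + s n *\<^sub>R b) \<ge> r" "norm x \<ge> r" using s(2)[of n] by linarith+
        then show ?thesis using r M by (simp add: q_def)
      qed (use le in simp)
    qed
    show "AE x in lborel. (\<lambda>n. q n x) \<longlonglongrightarrow> D x"
    proof (intro AE_I2)
      fix x
      have "(\<lambda>h. norm (\<phi> (x + h) - \<phi> x - partial_deriv h \<phi> x) / norm h) \<midarrow>0\<rightarrow> 0"
        using der[of x] by (simp add: has_derivative_at)
      moreover have "filterlim (\<lambda>n. s n *\<^sub>R b) (at 0) sequentially"
      proof -
        have "(\<lambda>n. s n *\<^sub>R b) \<longlonglongrightarrow> 0 *\<^sub>R b"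
          unfolding s_def by (intro tendsto_intros LIMSEQ_inverse_real_of_nat)
        moreover have "s n *\<^sub>R b \<noteq> 0" for n using s(1)[of n] assms(2) nonzero_Basis by auto
        ultimately show ?thesis by (simp add: filterlim_at)
      qed
      ultimately have "(\<lambda>n. norm (\<phi> (x + s n *\<^sub>R b) - \<phi> x - partial_deriv (s n *\<^sub>R b) \<phi> x) / norm (s n *\<^sub>R b)) \<longlonglongrightarrow> 0"
        by (rule filterlim_compose)
      moreover have "norm (\<phi> (x + s n *\<^sub>R b) - \<phi> x - partial_deriv (s n *\<^sub>R b) \<phi> x) / norm (s n *\<^sub>R b)
          = norm (q n x - D x)" for n
      proof -
        have "q n x - D x = (1 / s n) *\<^sub>R (\<phi> (x + s n *\<^sub>R b) - \<phi> x - partial_deriv (s n *\<^sub>R b) \<phi> x)"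
          using s(1)[of n] by (simp add: q_def scale scaleR_diff_right)
        then show ?thesis using s(1)[of n] assms(2) by simp
      qed
      ultimately show "(\<lambda>n. q n x) \<longlonglongrightarrow> D x" by (simp add: tendsto_norm_zero_iff LIM_zero_iff)
    qed
  qed (auto simp: q_def)
  ultimately show ?thesis by (simp add: D_def LIMSEQ_const_iff)
qed

section \<open>Exchange of differentiation and multiplication under the Fourier transform\<close>

lemma partial_deriv_mult:
  assumes "smooth_fun \<phi>" "smooth_fun \<psi>"
  shows "partial_deriv b (\<lambda>x. \<phi> x * \<psi> x) x = \<phi> x * partial_deriv b \<psi> x + partial_deriv b \<phi> x * \<psi> x"
  by (intro partial_deriv_eq has_derivative_mult smooth_fun_has_derivative assms)

lemma partial_deriv_wave: "partial_deriv b (wave y) x = - 2 * of_real pi * \<i> * of_real (b \<bullet> y) * wave y x"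
proof (rule partial_deriv_eq)
  show "(wave y has_derivative (\<lambda>h. - 2 * of_real pi * \<i> * of_real (h \<bullet> y) * wave y x)) (at x)"
    unfolding wave_def
    by (rule has_derivative_eq_rhs[OF has_derivative_compose[OF _
          DERIV_exp[unfolded has_field_derivative_def], where f="\<lambda>x. - 2 * of_real pi * \<i> * of_real (x \<bullet> y)"]])
      (auto intro!: derivative_eq_intros)
qed

text \<open>Integration of the product rule for \<phi> times \<open>wave y\<close>: the total
  derivative contributes zero.\<close>

lemma fourier_partial_deriv:
  assumes "\<phi> \<in> test_funs" "b \<in> Basis"
  shows "fourier (partial_deriv b \<phi>) y = 2 * of_real pi * \<i> * of_real (y \<bullet> b) * fourier \<phi> y"
proof -
  have "(LINT x|lborel. partial_deriv b (\<lambda>x. \<phi> x * wave y x) x) = 0"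
    using assms by (intro integral_partial_deriv_eq_0 test_funs_mult smooth_fun_wave)
  moreover have "partial_deriv b (\<lambda>x. \<phi> x * wave y x) x =
      partial_deriv b \<phi> x * wave y x - (2 * of_real pi * \<i> * of_real (y \<bullet> b)) * (\<phi> x * wave y x)" for x
    using assms by (simp add: partial_deriv_mult test_funs_smooth smooth_fun_wave partial_deriv_wave inner_commute)
  moreover have "integrable lborel (\<lambda>x. partial_deriv b \<phi> x * wave y x)"
    "integrable lborel (\<lambda>x. \<phi> x * wave y x)"
    using assms by (simp_all add: integrable_mult_wave test_funs_integrable test_funs_partial_deriv)
  ultimately show ?thesis
    by (simp add: fourier_eq)
qed

lemma cmod_iexp_minus_affine_le: "cmod (exp (\<i> * of_real t) - 1 - \<i> * of_real t) \<le> t\<^sup>2"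
proof -
  have "cmod (exp (\<i> * of_real t) - 1 - \<i> * of_real t) \<le> \<bar>t\<bar> ^ Suc 1 / fact (Suc 1)"
    using iexp_approx1[of t 1] by (simp add: diff_diff_eq)
  also have "\<dots> \<le> t\<^sup>2" by (simp add: power2_eq_square)
  finally show ?thesis .
qed

text \<open>On the support |x| is less than some r, so the second-order remainder of the character
  is at most (2 pi r |h|)^2; integrated against |\<phi>| it becomes a quadratic remainder with a
  constant independent of \<open>h\<close>.\<close>

lemma fourier_has_derivative:
  assumes "\<phi> \<in> test_funs"
  shows "(fourier \<phi> has_derivative
     (\<lambda>h. fourier (\<lambda>x. - 2 * of_real pi * \<i> * of_real (x \<bullet> h) * \<phi> x) y)) (at y)"
proof -
  note [measurable] = test_funs_measurable[OF assms]
  define L where "L = (\<lambda>h. fourier (\<lambda>x. - 2 * of_real pi * \<i> * of_real (x \<bullet> h) * \<phi> x) y)"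
  have "(\<lambda>x. complex_of_real (x \<bullet> h) * \<phi> x) \<in> test_funs" for h
    using assms by (intro test_funs_mult2 smooth_fun_inner)
  note int = integrable_mult_right[OF integrable_mult_wave[OF test_funs_integrable[OF this]], of "- 2 * of_real pi * \<i>"]
  have L_eq: "L h = (LINT x|lborel. (- 2 * of_real pi * \<i>) * (of_real (x \<bullet> h) * \<phi> x * wave y x))" for h
    by (simp add: L_def fourier_eq mult_ac)
  obtain r where r: "r > 0" "\<And>x. norm x \<ge> r \<Longrightarrow> \<phi> x = 0"
    using test_funs_bounded_support[OF assms] by blast
  define K where "K = (LINT x|lborel. (2 * pi * r)\<^sup>2 * norm (\<phi> x))"
  have lin: "linear L"
  proof (rule linearI)
    show "L (h + k) = L h + L k" for h k
      unfolding L_eq by (subst Bochner_Integration.integral_add[OF int int, symmetric])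
        (simp add: inner_add_right algebra_simps)
    show "L (c *\<^sub>R h) = c *\<^sub>R L h" for c h
      unfolding L_eq by (subst integral_scaleR_right[symmetric])
        (simp add: scaleR_conv_of_real mult_ac)
  qed
  have "norm (fourier \<phi> (y + h) - fourier \<phi> y - L h) \<le> K * (norm h)\<^sup>2" for h
  proof -
    have i: "integrable lborel \<phi>" by (simp add: assms test_funs_integrable)
    let ?d = "\<lambda>x. \<phi> x * wave (y + h) x - \<phi> x * wave y x
        - (- 2 * of_real pi * \<i>) * (of_real (x \<bullet> h) * \<phi> x * wave y x)"
    have id: "integrable lborel ?d"
      using i by (intro Bochner_Integration.integrable_diff int integrable_mult_wave)
    have "fourier \<phi> (y + h) - fourier \<phi> y - L h = integral\<^sup>L lborel ?d"
      unfolding L_eq fourier_eq using int[of h] i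
      by (simp add: integrable_mult_wave)
    then have "norm (fourier \<phi> (y + h) - fourier \<phi> y - L h) \<le> (LINT x|lborel. norm (?d x))"
      using integral_norm_bound[of lborel ?d] by (simp only:)
    also have "\<dots> \<le> (LINT x|lborel. ((2 * pi * r)\<^sup>2 * norm (\<phi> x)) * (norm h)\<^sup>2)"
    proof (rule integral_mono)
      fix x
      have "?d x = \<phi> x * wave y x * (wave h x - 1 + 2 * of_real pi * \<i> * of_real (x \<bullet> h))"
        by (simp add: wave_add_left algebra_simps)
      moreover have "norm (wave h x - 1 + 2 * of_real pi * \<i> * of_real (x \<bullet> h)) \<le> (2 * pi * (x \<bullet> h))\<^sup>2"
        using cmod_iexp_minus_affine_le[of "- 2 * pi * (x \<bullet> h)"] by (simp add: wave_def mult_ac)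
      ultimately have "norm (?d x) \<le> norm (\<phi> x) * (2 * pi * (x \<bullet> h))\<^sup>2"
        by (simp add: norm_mult mult_left_mono)
      also have "\<dots> \<le> norm (\<phi> x) * (2 * pi * (r * norm h))\<^sup>2"
      proof (cases "norm x \<ge> r")
        case False
        then have "\<bar>x \<bullet> h\<bar> \<le> r * norm h"
          by (intro order_trans[OF Cauchy_Schwarz_ineq2] mult_right_mono) auto
        then have "\<bar>2 * pi * (x \<bullet> h)\<bar> \<le> \<bar>2 * pi * (r * norm h)\<bar>"
          using r by (simp add: abs_mult)
        then show ?thesis by (intro mult_left_mono) (auto simp: abs_le_square_iff)
      qed (use r in simp)
      finally show "norm (?d x) \<le> ((2 * pi * r)\<^sup>2 * norm (\<phi> x)) * (norm h)\<^sup>2"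
        by (simp add: power_mult_distrib mult_ac)
    qed (use id i in auto)
    finally show ?thesis by (simp add: K_def)
  qed
  moreover have "bounded_linear L" using lin by (simp add: linear_conv_bounded_linear)
  ultimately show ?thesis
    unfolding L_def[symmetric] by (intro has_derivative_quadratic_bound) auto
qed

text \<open>The symbol by which an iterated derivative of \<open>fourier \<phi>\<close> acts on
  \<phi>. Its factors have the opposite sign to those in \<open>fourier_partial_deriv\<close>,
  whence the sign in \<open>fourier_iter_deriv\<close>.\<close>

definition fourier_multiplier :: "'a::euclidean_space list \<Rightarrow> 'a \<Rightarrow> complex" where
  "fourier_multiplier bs x = (\<Prod>b\<leftarrow>bs. - 2 * of_real pi * \<i> * of_real (x \<bullet> b))"

lemma smooth_fun_fourier_multiplier: "smooth_fun (fourier_multiplier bs)"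
proof (induction bs)
  case Nil
  then show ?case by (simp add: fourier_multiplier_def[abs_def] smooth_fun_const)
next
  case (Cons b bs)
  then show ?case unfolding fourier_multiplier_def[abs_def] list.map prod_list.Cons
    by (intro smooth_fun_mult smooth_fun_const smooth_fun_inner)
qed

lemma iter_deriv_fourier:
  assumes "\<phi> \<in> test_funs"
  shows "iter_deriv bs (fourier \<phi>) = fourier (\<lambda>x. fourier_multiplier bs x * \<phi> x)"
proof (induction bs)
  case Nil
  then show ?case by (simp add: fourier_multiplier_def)
next
  case (Cons b bs)
  have "(\<lambda>x. fourier_multiplier bs x * \<phi> x) \<in> test_funs"
    using assms by (intro test_funs_mult2 smooth_fun_fourier_multiplier)
  from partial_deriv_eq[OF fourier_has_derivative[OF this], of b] show ?case
    by (simp add: iter_deriv_Cons Cons fourier_multiplier_def mult.assoc fun_eq_iff)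
qed

text \<open>A factor |x| is at most the sum of its absolute coordinates, and each coordinate is
  traded for a derivative of \<phi>, again a test function. Hence \<phi> is arbitrary in the
  induction.\<close>

lemma fourier_rapidly_decreasing:
  assumes "\<phi> \<in> test_funs"
  shows "\<exists>C. \<forall>x. norm x ^ k * norm (fourier \<phi> x) \<le> C"
  using assms
proof (induction k arbitrary: \<phi>)
  case 0
  show ?case by (auto intro: norm_fourier_le)
next
  case (Suc k)
  have "\<forall>b\<in>Basis. \<exists>C. \<forall>x. norm x ^ k * norm (fourier (partial_deriv b \<phi>) x) \<le> C"
    using Suc by (auto intro: test_funs_partial_deriv)
  then obtain C where C: "\<And>b x. b \<in> Basis \<Longrightarrow> norm x ^ k * norm (fourier (partial_deriv b \<phi>) x) \<le> C b"
    by metis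
  have "norm x ^ Suc k * norm (fourier \<phi> x) \<le> (\<Sum>b\<in>Basis. C b)" for x
  proof -
    have "norm x ^ Suc k * norm (fourier \<phi> x) \<le> (\<Sum>b\<in>Basis. \<bar>x \<bullet> b\<bar>) * (norm x ^ k * norm (fourier \<phi> x))"
      using mult_right_mono[OF norm_le_l1[of x], of "norm x ^ k * norm (fourier \<phi> x)"] by (simp add: mult_ac)
    also have "\<dots> = (\<Sum>b\<in>Basis. norm x ^ k * (\<bar>x \<bullet> b\<bar> * norm (fourier \<phi> x)))"
      by (simp add: sum_distrib_right sum_distrib_left mult_ac)
    also have "\<dots> \<le> (\<Sum>b\<in>Basis. norm x ^ k * norm (fourier (partial_deriv b \<phi>) x))"
    proof (intro sum_mono mult_left_mono)
      fix b :: 'a assume b: "b \<in> Basis"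
      \<comment> \<open>The factor 2 pi from \<open>fourier_partial_deriv\<close> is at least 1 and
        is dropped.\<close>
      have "1 * (\<bar>x \<bullet> b\<bar> * norm (fourier \<phi> x)) \<le> (2 * pi) * (\<bar>x \<bullet> b\<bar> * norm (fourier \<phi> x))"
        using pi_ge_two by (intro mult_right_mono) auto
      then show "\<bar>x \<bullet> b\<bar> * norm (fourier \<phi> x) \<le> norm (fourier (partial_deriv b \<phi>) x)"
        using b Suc.prems by (simp add: fourier_partial_deriv norm_mult mult_ac)
    qed auto
    also have "\<dots> \<le> (\<Sum>b\<in>Basis. C b)" by (intro sum_mono C)
    finally show ?thesis .
  qed
  then show ?case by blast
qed

lemma fourier_schwartz:
  assumes "\<phi> \<in> test_funs"
  shows "fourier \<phi> \<in> schwartz_funs"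
proof -
  have m: "(\<lambda>x. fourier_multiplier bs x * \<phi> x) \<in> test_funs" for bs
    using assms by (intro test_funs_mult2 smooth_fun_fourier_multiplier)
  have "smooth_fun (fourier \<phi>)"
    unfolding smooth_fun_def iter_deriv_fourier[OF assms]
    using fourier_has_derivative[OF m] differentiableI by blast
  moreover have "bounded (range (\<lambda>x. norm x ^ k *\<^sub>R iter_deriv bs (fourier \<phi>) x))" for k bs
    unfolding iter_deriv_fourier[OF assms] bounded_iff
    using fourier_rapidly_decreasing[OF m] by auto
  ultimately show ?thesis by (simp add: schwartz_funs_def)
qed

section \<open>Closure properties of the Schwartz space\<close>

lemma test_funs_schwartz:
  assumes "\<phi> \<in> test_funs"
  shows "\<phi> \<in> schwartz_funs"
proof -
  have "bounded (range (\<lambda>x. norm x ^ k *\<^sub>R iter_deriv bs \<phi> x))" if "bs \<in> lists Basis" for k bs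
  proof -
    have d: "iter_deriv bs \<phi> \<in> test_funs" using assms that by (rule test_funs_iter_deriv)
    obtain M where M: "M > 0" "\<And>x. norm (iter_deriv bs \<phi> x) \<le> M" using test_funs_bounded[OF d] by blast
    obtain r where r: "r > 0" "\<And>x. norm x \<ge> r \<Longrightarrow> iter_deriv bs \<phi> x = 0"
      using test_funs_bounded_support[OF d] by blast
    have "norm (norm x ^ k *\<^sub>R iter_deriv bs \<phi> x) \<le> r ^ k * M" for x
    proof (cases "norm x \<ge> r")
      case False
      then show ?thesis using M r by (auto intro!: mult_mono power_mono)
    qed (use M r in auto)
    then show ?thesis by (auto simp: bounded_iff)
  qed
  with assms show ?thesis by (simp add: schwartz_funs_def test_funs_smooth)
qed

lemma schwartz_funs_add:
  assumes "\<phi> \<in> schwartz_funs" "\<psi> \<in> schwartz_funs"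
  shows "(\<lambda>x. \<phi> x + \<psi> x) \<in> schwartz_funs"
proof -
  have "bounded (range (\<lambda>x. norm x ^ k *\<^sub>R iter_deriv bs (\<lambda>x. \<phi> x + \<psi> x) x))" if "bs \<in> lists Basis" for k bs
  proof -
    have "bounded (range (\<lambda>x. norm x ^ k *\<^sub>R iter_deriv bs \<phi> x + norm x ^ k *\<^sub>R iter_deriv bs \<psi> x))"
      using assms that by (intro bounded_plus_comp) (auto simp: schwartz_funs_def)
    then show ?thesis using assms that by (simp add: iter_deriv_add schwartz_funs_def scaleR_add_right)
  qed
  with assms show ?thesis by (simp add: schwartz_funs_def smooth_fun_add)
qed

lemma schwartz_funs_cmult:
  assumes "\<phi> \<in> schwartz_funs"
  shows "(\<lambda>x. c * \<phi> x) \<in> schwartz_funs"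
proof -
  have "bounded (range (\<lambda>x. norm x ^ k *\<^sub>R iter_deriv bs (\<lambda>x. c * \<phi> x) x))" if "bs \<in> lists Basis" for k bs
  proof -
    have "bounded (range (\<lambda>x. norm x ^ k *\<^sub>R iter_deriv bs \<phi> x))"
      using assms that by (simp add: schwartz_funs_def)
    then have "bounded ((\<lambda>z. c * z) ` range (\<lambda>x. norm x ^ k *\<^sub>R iter_deriv bs \<phi> x))"
      by (rule bounded_linear_image[OF _ bounded_linear_mult_right])
    then show ?thesis using assms that by (simp add: iter_deriv_cmult schwartz_funs_def image_image)
  qed
  with assms show ?thesis by (simp add: schwartz_funs_def smooth_fun_cmult)
qed

section \<open>Decay\<close>

text \<open>One of the \<open>DIM('a)\<close> factors 1 + |x|^2 is spent on each coordinate, where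
  it is at least 1 plus the squared coordinate. The integral is then at most a product of
  one-dimensional arctangent integrals.\<close>

lemma integrable_decay_weight: "integrable lborel (\<lambda>x::'a::euclidean_space. 1 / (1 + (norm x)\<^sup>2) ^ DIM('a))"
proof (rule integrableI_bounded)
  have 1: "(\<integral>\<^sup>+x. ennreal (inverse (1 + x\<^sup>2)) \<partial>lborel) < \<infinity>"
    using integrable_inverse_1_plus_square
    by (simp add: set_integrable_def integrable_iff_bounded)
  have "(\<integral>\<^sup>+x. ennreal (norm (1 / (1 + (norm (x::'a))\<^sup>2) ^ DIM('a))) \<partial>lborel)
      \<le> (\<integral>\<^sup>+x. (\<Prod>b\<in>Basis. ennreal (inverse (1 + ((x::'a) \<bullet> b)\<^sup>2))) \<partial>lborel)"
  proof (rule nn_integral_mono)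
    fix x :: 'a
    have "1 / (1 + (norm x)\<^sup>2) ^ DIM('a) = (\<Prod>b\<in>(Basis::'a set). inverse (1 + (norm x)\<^sup>2))"
      by (simp add: field_simps)
    also have "\<dots> \<le> (\<Prod>b\<in>Basis. inverse (1 + (x \<bullet> b)\<^sup>2))"
    proof (rule prod_mono)
      fix b :: 'a assume "b \<in> Basis"
      then have "\<bar>x \<bullet> b\<bar> \<le> norm x" by (rule Basis_le_norm)
      then have "(x \<bullet> b)\<^sup>2 \<le> (norm x)\<^sup>2" using power_mono[of "\<bar>x \<bullet> b\<bar>" "norm x" 2] by simp
      moreover have "1 + (x \<bullet> b)\<^sup>2 > 0" by (simp add: add_pos_nonneg)
      ultimately show "0 \<le> inverse (1 + (norm x)\<^sup>2) \<and> inverse (1 + (norm x)\<^sup>2) \<le> inverse (1 + (x \<bullet> b)\<^sup>2)"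
        by (auto intro!: le_imp_inverse_le)
    qed
    finally show "ennreal (norm (1 / (1 + (norm x)\<^sup>2) ^ DIM('a))) \<le> (\<Prod>b\<in>Basis. ennreal (inverse (1 + (x \<bullet> b)\<^sup>2)))"
      by (subst prod_ennreal) (auto simp: norm_divide norm_power intro!: ennreal_leI)
  qed
  also have "\<dots> = (\<Prod>b\<in>(Basis::'a set). (\<integral>\<^sup>+x. ennreal (inverse (1 + x\<^sup>2)) \<partial>lborel))"
    by (intro nn_integral_lborel_prod) auto
  also have "\<dots> < \<infinity>" using 1 by (simp add: power_less_top_ennreal)
  finally show "(\<integral>\<^sup>+x. ennreal (norm (1 / (1 + (norm (x::'a))\<^sup>2) ^ DIM('a))) \<partial>lborel) < \<infinity>" .
qed measurable

text \<open>Decay of all orders, without derivatives. The weights (1 + |x|^2)^-m are positive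
  everywhere, integrable for \<open>m = DIM('a)\<close>, and change by a bounded factor under
  translations of length at most 1.\<close>

definition rapid :: "('a::euclidean_space \<Rightarrow> complex) \<Rightarrow> bool" where
  "rapid g \<longleftrightarrow> continuous_on UNIV g \<and> (\<forall>m. \<exists>C\<ge>0. \<forall>x. norm (g x) \<le> C * (1 / (1 + (norm x)\<^sup>2) ^ m))"

lemma rapidD:
  assumes "rapid g"
  obtains C where "C \<ge> 0" "\<And>x. norm (g x) \<le> C * (1 / (1 + (norm x)\<^sup>2) ^ m)"
  using assms unfolding rapid_def by blast

lemma rapid_integrable:
  fixes g :: "'a::euclidean_space \<Rightarrow> complex"
  assumes "rapid g"
  shows "integrable lborel g"
proof -
  obtain C where C: "C \<ge> 0" "\<And>x. norm (g x) \<le> C * (1 / (1 + (norm x)\<^sup>2) ^ DIM('a))"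
    using rapidD[OF assms] by blast
  show ?thesis
  proof (rule Bochner_Integration.integrable_bound[OF integrable_mult_right[OF integrable_decay_weight, of C]])
    show "g \<in> borel_measurable lborel"
      using assms by (simp add: rapid_def borel_measurable_continuous_onI)
  qed (use C in auto)
qed

lemma fourier_rapid:
  assumes "\<phi> \<in> test_funs"
  shows "rapid (fourier \<phi>)"
  unfolding rapid_def
proof (intro conjI allI)
  show "continuous_on UNIV (fourier \<phi>)" using assms by (simp add: fourier_continuous test_funs_integrable)
  fix m
  obtain C0 where C0: "\<And>x. norm x ^ 0 * norm (fourier \<phi> x) \<le> C0"
    using fourier_rapidly_decreasing[OF assms] by blast
  obtain C1 where C1: "\<And>x. norm x ^ (2 * m) * norm (fourier \<phi> x) \<le> C1"
    using fourier_rapidly_decreasing[OF assms] by blast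
  have nn: "C0 \<ge> 0" "C1 \<ge> 0" using order_trans[OF _ C0] order_trans[OF _ C1] by auto
  have "norm (fourier \<phi> x) \<le> 2 ^ m * (C0 + C1) * (1 / (1 + (norm x)\<^sup>2) ^ m)" for x
  proof -
    \<comment> \<open>Up to radius 1 the constant term dominates, beyond it |x|^2 does; either way 1
      + |x|^2 is at most twice the larger one.\<close>
    have "(1 + (norm x)\<^sup>2) ^ m \<le> 2 ^ m * (1 + norm x ^ (2 * m))"
    proof (cases "norm x \<le> 1")
      case True
      then have "(1 + (norm x)\<^sup>2) ^ m \<le> 2 ^ m * 1"
        by (simp add: power_le_one power_mono)
      also have "\<dots> \<le> 2 ^ m * (1 + norm x ^ (2 * m))" by (intro mult_left_mono) auto
      finally show ?thesis .
    next
      case False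
      then have "(norm x)\<^sup>2 \<ge> 1" by (simp add: one_le_power)
      then have "(1 + (norm x)\<^sup>2) ^ m \<le> (2 * (norm x)\<^sup>2) ^ m" by (intro power_mono) auto
      also have "\<dots> = 2 ^ m * norm x ^ (2 * m)" by (simp add: power_mult_distrib power_mult)
      also have "\<dots> \<le> 2 ^ m * (1 + norm x ^ (2 * m))" by (intro mult_left_mono) auto
      finally show ?thesis .
    qed
    then have "(1 + (norm x)\<^sup>2) ^ m * norm (fourier \<phi> x) \<le> 2 ^ m * (1 + norm x ^ (2 * m)) * norm (fourier \<phi> x)"
      by (intro mult_right_mono) auto
    also have "\<dots> \<le> 2 ^ m * (C0 + C1)"
      using mult_left_mono[OF add_mono[OF C0[of x] C1[of x]], of "2 ^ m"] by (simp add: algebra_simps)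
    finally show ?thesis by (simp add: field_simps add_pos_nonneg)
  qed
  then show "\<exists>C\<ge>0. \<forall>x. norm (fourier \<phi> x) \<le> C * (1 / (1 + (norm x)\<^sup>2) ^ m)"
    using nn by (intro exI[of _ "2 ^ m * (C0 + C1)"]) auto
qed

section \<open>Fourier inversion up to a constant\<close>

text \<open>The zero set is closed and of full measure, hence everything.\<close>

lemma continuous_AE_zero:
  fixes g :: "'a::euclidean_space \<Rightarrow> complex"
  assumes "continuous_on UNIV g" "AE x in lborel. g x = 0"
  shows "g x = 0"
proof -
  have "closed {x. g x = 0}"
    by (intro closed_Collect_eq assms continuous_on_const)
  moreover have "AE x in lebesgue. x \<in> {x. g x = 0}"
    using AE_completion[OF assms(2)] by simp
  ultimately show ?thesis using mem_closed_if_AE_lebesgue by blast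
qed

lemma norm_integral_eq_0_imp_zero:
  fixes g :: "'a::euclidean_space \<Rightarrow> complex"
  assumes "continuous_on UNIV g" "integrable lborel g" "(LINT x|lborel. norm (g x)) = 0"
  shows "g x = 0"
proof (rule continuous_AE_zero[OF assms(1)])
  show "AE x in lborel. g x = 0"
    using integral_nonneg_eq_0_iff_AE[OF integrable_norm[OF assms(2)]] assms(3) by simp
qed

lemma unit_bump:
  obtains a :: "'a::euclidean_space \<Rightarrow> complex" where
    "a \<in> test_funs" "a 0 = 1" "\<And>x. norm (a x) \<le> 1" "(LINT x|lborel. a x) \<noteq> 0"
proof -
  obtain \<beta> :: "'a \<Rightarrow> real" where \<beta>:
    "(\<lambda>x. of_real (\<beta> x)) \<in> test_funs" "\<And>x. 0 \<le> \<beta> x" "\<And>x. \<beta> x \<le> 1"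
    "\<And>x. dist 0 x \<le> 1 \<Longrightarrow> \<beta> x = 1" "\<And>x. dist 0 x \<ge> 2 * 1 \<Longrightarrow> \<beta> x = 0"
    by (rule bump_exists[OF zero_less_one, of 0]) blast
  define a where "a = (\<lambda>x. complex_of_real (\<beta> x))"
  have a: "a \<in> test_funs" using \<beta>(1) by (simp add: a_def)
  have a0: "a 0 = 1" using \<beta>(4)[of 0] by (simp add: a_def)
  have "(LINT x|lborel. a x) \<noteq> 0"
  proof
    assume "(LINT x|lborel. a x) = 0"
    then have "(LINT x|lborel. norm (a x)) = 0"
      using \<beta>(2) by (simp add: a_def)
    then have "a 0 = 0"
      using norm_integral_eq_0_imp_zero[OF test_funs_continuous[OF a] test_funs_integrable[OF a]] by blast
    with a0 show False by simp
  qed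
  with a a0 show ?thesis using \<beta>(2,3) by (intro that[of a]) (auto simp: a_def)
qed

text \<open>
  The constant is in fact 1; its nonvanishing is all that is needed, and spares the computation
  of a Gaussian integral.
\<close>

lemma fourier_inversion_upto_const:
  obtains A :: complex where "A \<noteq> 0"
    "\<And>\<eta> y. \<eta> \<in> test_funs \<Longrightarrow>
       (LINT s|lborel. fourier \<eta> s * wave (- y) s) = A * \<eta> (y::'a::euclidean_space)"
proof -
  obtain a :: "'a \<Rightarrow> complex" where a: "a \<in> test_funs" and a0: "a 0 = 1"
    and a1: "\<And>x. norm (a x) \<le> 1" and a_int: "(LINT x|lborel. a x) \<noteq> 0"
    by (rule unit_bump) blast
  have aint: "integrable lborel a" using a by (rule test_funs_integrable)
  have Faint: "integrable lborel (fourier a)" using a by (simp add: fourier_rapid rapid_integrable)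
  define A where "A = (LINT x|lborel. fourier a x)"
  have inv: "(LINT s|lborel. fourier \<eta> s * wave (- y) s) = A * \<eta> y" if \<eta>: "\<eta> \<in> test_funs"
    for \<eta> :: "'a \<Rightarrow> complex" and y
  proof -
    have \<eta>i: "integrable lborel \<eta>" and F\<eta>i: "integrable lborel (fourier \<eta>)"
      using \<eta> by (simp_all add: test_funs_integrable fourier_rapid rapid_integrable)
    note [measurable] = test_funs_measurable[OF \<eta>] test_funs_measurable[OF a]
      fourier_measurable[OF aint] fourier_measurable[OF \<eta>i]
    obtain M where M: "M > 0" "\<And>x. norm (\<eta> x) \<le> M" using test_funs_bounded[OF \<eta>] by blast
    define c where "c = (\<lambda>n::nat. real (Suc n))"
    have c: "c n > 0" for n by (simp add: c_def)
    have clim: "(\<lambda>n. 1 / c n) \<longlonglongrightarrow> 0"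
      unfolding c_def using LIMSEQ_inverse_real_of_nat by (simp add: inverse_eq_divide)
    \<comment> \<open>Regularised inversion integral: the cut-off at scale \<open>c n\<close> tends
      to \<open>a 0 = 1\<close>, and the limit of \<open>L\<close> is computed in two ways.\<close>
    define L where "L = (\<lambda>n. LINT s|lborel. fourier \<eta> s * (a ((1 / c n) *\<^sub>R s) * wave (- y) s))"
    have "L \<longlonglongrightarrow> (LINT s|lborel. fourier \<eta> s * (1 * wave (- y) s))"
      unfolding L_def
    proof (rule integral_dominated_convergence[where w="\<lambda>s. norm (fourier \<eta> s)"])
      show "AE s in lborel. (\<lambda>n. fourier \<eta> s * (a ((1 / c n) *\<^sub>R s) * wave (- y) s))
          \<longlonglongrightarrow> fourier \<eta> s * (1 * wave (- y) s)"
      proof (intro AE_I2 tendsto_intros)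
        fix s :: 'a
        have "(\<lambda>n. (1 / c n) *\<^sub>R s) \<longlonglongrightarrow> 0 *\<^sub>R s" by (rule tendsto_scaleR[OF clim tendsto_const])
        then have "(\<lambda>n. a ((1 / c n) *\<^sub>R s)) \<longlonglongrightarrow> a (0 *\<^sub>R s)"
          by (rule continuous_on_tendsto_compose[OF test_funs_continuous[OF a, of UNIV]]) auto
        then show "(\<lambda>n. a ((1 / c n) *\<^sub>R s)) \<longlonglongrightarrow> 1" by (simp add: a0)
      qed
      show "AE s in lborel. norm (fourier \<eta> s * (a ((1 / c n) *\<^sub>R s) * wave (- y) s)) \<le> norm (fourier \<eta> s)" for n
        using a1 by (intro AE_I2) (simp add: norm_mult mult_left_le)
    qed (use F\<eta>i in auto)
    moreover have "L = (\<lambda>n. LINT w|lborel. \<eta> (y + (1 / c n) *\<^sub>R w) * fourier a w)"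
    proof
      fix n
      have v: "(\<lambda>s. a ((1 / c n) *\<^sub>R s)) \<in> test_funs"
        using test_funs_affine[OF a, of "1 / c n" 0] c[of n] by simp
      \<comment> \<open>The transform of the dilated and modulated cut-off concentrates near
        \<open>y\<close>; rescaling moves this concentration into the argument of \<eta>.\<close>
      have "L n = (LINT z|lborel. \<eta> z * fourier (\<lambda>s. a ((1 / c n) *\<^sub>R s) * wave (- y) s) z)"
        unfolding L_def
        by (rule fourier_mult_formula[OF \<eta>i integrable_mult_wave[OF test_funs_integrable[OF v]]])
      also have "\<dots> = (LINT z|lborel. \<eta> z * (of_real (c n ^ DIM('a)) * fourier a (c n *\<^sub>R (z - y))))"
        by (simp add: fourier_modulate fourier_scale[OF test_funs_measurable[OF a] c] del: of_real_power)
      also have "\<dots> = \<bar>1 / c n\<bar> ^ DIM('a) *\<^sub>R (LINT w|lborel. \<eta> (y + (1 / c n) *\<^sub>R w) *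
          (of_real (c n ^ DIM('a)) * fourier a (c n *\<^sub>R (y + (1 / c n) *\<^sub>R w - y))))"
        using c[of n] by (intro lborel_integral_affine) auto
      also have "\<dots> = (LINT w|lborel. \<bar>1 / c n\<bar> ^ DIM('a) *\<^sub>R (\<eta> (y + (1 / c n) *\<^sub>R w) *
          (of_real (c n ^ DIM('a)) * fourier a (c n *\<^sub>R (y + (1 / c n) *\<^sub>R w - y)))))"
        by (simp only: integral_scaleR_right)
      also have "\<dots> = (LINT w|lborel. \<eta> (y + (1 / c n) *\<^sub>R w) * fourier a w)"
      proof (rule Bochner_Integration.integral_cong[OF refl])
        fix w :: 'a
        have "c n *\<^sub>R (y + (1 / c n) *\<^sub>R w - y) = w" using c[of n] by simp
        moreover have "\<bar>1 / c n\<bar> ^ DIM('a) *\<^sub>R (p * (of_real (c n ^ DIM('a)) * q)) = p * q" for p q :: complex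
          using c[of n] by (simp add: scaleR_conv_of_real power_divide)
        ultimately show "\<bar>1 / c n\<bar> ^ DIM('a) *\<^sub>R (\<eta> (y + (1 / c n) *\<^sub>R w) *
          (of_real (c n ^ DIM('a)) * fourier a (c n *\<^sub>R (y + (1 / c n) *\<^sub>R w - y)))) =
          \<eta> (y + (1 / c n) *\<^sub>R w) * fourier a w" by simp
      qed
      finally show "L n = (LINT w|lborel. \<eta> (y + (1 / c n) *\<^sub>R w) * fourier a w)" .
    qed
    moreover have "(\<lambda>n. LINT w|lborel. \<eta> (y + (1 / c n) *\<^sub>R w) * fourier a w) \<longlonglongrightarrow> (LINT w|lborel. \<eta> y * fourier a w)"
    proof (rule integral_dominated_convergence[where w="\<lambda>w. M * norm (fourier a w)"])
      show "AE w in lborel. (\<lambda>n. \<eta> (y + (1 / c n) *\<^sub>R w) * fourier a w) \<longlonglongrightarrow> \<eta> y * fourier a w"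
      proof (intro AE_I2 tendsto_intros)
        fix w :: 'a
        have "(\<lambda>n. y + (1 / c n) *\<^sub>R w) \<longlonglongrightarrow> y + 0 *\<^sub>R w"
          by (intro tendsto_add tendsto_const tendsto_scaleR[OF clim])
        then have "(\<lambda>n. \<eta> (y + (1 / c n) *\<^sub>R w)) \<longlonglongrightarrow> \<eta> (y + 0 *\<^sub>R w)"
          by (rule continuous_on_tendsto_compose[OF test_funs_continuous[OF \<eta>, of UNIV]]) auto
        then show "(\<lambda>n. \<eta> (y + (1 / c n) *\<^sub>R w)) \<longlonglongrightarrow> \<eta> y" by simp
      qed
      show "AE w in lborel. norm (\<eta> (y + (1 / c n) *\<^sub>R w) * fourier a w) \<le> M * norm (fourier a w)" for n
        using M by (intro AE_I2) (simp add: norm_mult mult_right_mono)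
    qed (use Faint in auto)
    ultimately have "(LINT s|lborel. fourier \<eta> s * (1 * wave (- y) s)) = (LINT w|lborel. \<eta> y * fourier a w)"
      by (auto intro: LIMSEQ_unique)
    then show ?thesis by (simp add: A_def mult.commute)
  qed
  have "A \<noteq> 0"
  proof
    assume "A = 0"
    \<comment> \<open>Plancherel's identity for \<open>a\<close> would give \<open>\<parallel>fourier a\<parallel>\<^sub>2 = 0\<close>.\<close>
    let ?v = "\<lambda>s. cnj (fourier a s)"
    have vi: "integrable lborel ?v" using Faint by simp
    \<comment> \<open>Conjugation turns the transform of \<open>?v\<close> into the inversion
      integral of \<open>a\<close>, which is \<open>A\<close> times a value of
      \<open>a\<close>.\<close>
    have "fourier ?v z = 0" for z
    proof -
      have "fourier ?v z = (LINT s|lborel. cnj (fourier a s * wave (- z) s))"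
        by (simp add: fourier_eq cnj_wave)
      also have "\<dots> = cnj (A * a z)" by (simp only: Bochner_Integration.integral_cnj inv[OF a])
      also have "\<dots> = 0" using \<open>A = 0\<close> by simp
      finally show ?thesis .
    qed
    then have "(LINT s|lborel. fourier a s * ?v s) = 0"
      by (subst fourier_mult_formula[OF aint vi]) simp
    moreover have "complex_of_real (norm (z * cnj z)) = z * cnj z" for z
      by (simp add: norm_power flip: complex_norm_square power2_eq_square)
    ultimately have "complex_of_real (LINT s|lborel. norm (fourier a s * ?v s)) = 0"
      by (subst integral_complex_of_real[symmetric]) (simp only:)
    then have "(LINT s|lborel. norm (fourier a s * ?v s)) = 0" by simp
    moreover have "continuous_on UNIV (\<lambda>s. fourier a s * ?v s)"
      using fourier_continuous[OF aint] by (intro continuous_intros)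
    moreover have "integrable lborel (\<lambda>s. fourier a s * ?v s)"
    proof (rule Bochner_Integration.integrable_bound[OF integrable_mult_right[OF Faint, of "of_real (LINT x|lborel. norm (a x))"]])
      show "(\<lambda>s. fourier a s * ?v s) \<in> borel_measurable lborel"
        using fourier_continuous[OF aint] by (auto intro!: borel_measurable_continuous_onI continuous_intros)
      show "AE s in lborel. norm (fourier a s * ?v s) \<le> norm (of_real (LINT x|lborel. norm (a x)) * fourier a s)"
        using norm_fourier_le[of a] by (intro AE_I2) (simp add: norm_mult mult_right_mono abs_of_nonneg)
    qed
    ultimately have "fourier a 0 * ?v 0 = 0" by (rule norm_integral_eq_0_imp_zero[rotated 2])
    \<comment> \<open>\<open>fourier a 0\<close> is the integral of \<open>a\<close>, which was
      chosen nonzero.\<close>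
    then have "(LINT x|lborel. a x) = 0" by (simp add: fourier_eq)
    with a_int show False by simp
  qed
  then show ?thesis using that inv by blast
qed

lemma decay_weight_shift:
  assumes "norm (x - y) \<le> 1"
  shows "1 / (1 + (norm y)\<^sup>2) ^ m \<le> 3 ^ m * (1 / (1 + (norm x)\<^sup>2) ^ m)"
proof -
  have "norm x \<le> norm y + 1" using norm_triangle_sub[of x y] assms by simp
  then have "(norm x)\<^sup>2 \<le> (norm y + 1)\<^sup>2" by (intro power_mono) auto
  also have "\<dots> \<le> 2 * (norm y)\<^sup>2 + 2"
    using zero_le_power2[of "norm y - 1"] by (simp add: power2_eq_square algebra_simps)
  \<comment> \<open>The coefficient is rounded up to 3 to match the constant term 1 + 2 of the next
    line.\<close>
  also have "\<dots> \<le> 3 * (norm y)\<^sup>2 + 2" by (intro add_right_mono mult_right_mono) auto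
  finally have "1 + (norm x)\<^sup>2 \<le> 3 * (1 + (norm y)\<^sup>2)" by simp
  then have "(1 + (norm x)\<^sup>2) ^ m \<le> (3 * (1 + (norm y)\<^sup>2)) ^ m"
    by (intro power_mono) (auto intro: add_nonneg_nonneg)
  then have le: "(1 + (norm x)\<^sup>2) ^ m \<le> 3 ^ m * (1 + (norm y)\<^sup>2) ^ m"
    by (simp only: power_mult_distrib)
  have "(1 + (norm x)\<^sup>2) ^ m > 0" "(1 + (norm y)\<^sup>2) ^ m > 0"
    by (auto intro!: zero_less_power add_pos_nonneg)
  with le show ?thesis by (simp add: field_simps)
qed

text \<open>One integrable majorant for all translates of length at most 1 is what dominated
  convergence requires, in \<open>L1_translation_continuous\<close> as well as in
  \<open>tempered_convolution_bound\<close>.\<close>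

lemma rapid_translate_dominated:
  fixes G :: "'a::euclidean_space \<Rightarrow> complex"
  assumes "rapid G"
  obtains w where "integrable lborel w" "\<And>x v. norm v \<le> 1 \<Longrightarrow> norm (G (x - v)) \<le> w x"
proof -
  obtain C where C: "C \<ge> 0" "\<And>x. norm (G x) \<le> C * (1 / (1 + (norm x)\<^sup>2) ^ DIM('a))"
    using rapidD[OF assms] by blast
  show ?thesis
  proof (rule that[of "\<lambda>x. C * (3 ^ DIM('a) * (1 / (1 + (norm x)\<^sup>2) ^ DIM('a)))"])
    show "norm (G (x - v)) \<le> C * (3 ^ DIM('a) * (1 / (1 + (norm x)\<^sup>2) ^ DIM('a)))" if "norm v \<le> 1" for x v
      using C(2)[of "x - v"] mult_left_mono[OF decay_weight_shift[of x "x - v" "DIM('a)"] C(1)] that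
      by (simp only: diff_diff_eq2 add_diff_cancel_left' order_trans)
  qed (intro integrable_mult_right integrable_decay_weight)
qed

lemma L1_translation_continuous:
  fixes G :: "'a::euclidean_space \<Rightarrow> complex"
  assumes "rapid G" "V \<longlonglongrightarrow> 0"
  shows "(\<lambda>n. LINT x|lborel. norm (G (x - V n) - G x)) \<longlonglongrightarrow> 0"
proof -
  obtain w where w: "integrable lborel w" "\<And>x v. norm v \<le> 1 \<Longrightarrow> norm (G (x - v)) \<le> w x"
    using rapid_translate_dominated[OF assms(1)] by blast
  have cont: "continuous_on UNIV G" using assms(1) by (simp add: rapid_def)
  have [measurable]: "G \<in> borel_measurable borel" using cont by (rule borel_measurable_continuous_onI)
  \<comment> \<open>The majorant covers only translates of length at most 1, so finitely many terms
    are skipped.\<close>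
  obtain N where "\<forall>n\<ge>N. norm (V n - 0) < 1"
    using LIMSEQ_D[OF assms(2) zero_less_one] by blast
  then have N: "norm (V n) < 1" if "n \<ge> N" for n using that by simp
  have "(\<lambda>n. LINT x|lborel. norm (G (x - V (n + N)) - G x)) \<longlonglongrightarrow> (LINT x|lborel. norm (G (x - 0) - G x))"
  proof (rule integral_dominated_convergence[where w="\<lambda>x. w x + w x"])
    show "AE x in lborel. (\<lambda>n. norm (G (x - V (n + N)) - G x)) \<longlonglongrightarrow> norm (G (x - 0) - G x)"
    proof (rule AE_I2)
      fix x
      have "(\<lambda>n. V (n + N)) \<longlonglongrightarrow> 0" using assms(2) by (rule LIMSEQ_ignore_initial_segment)
      from tendsto_diff[OF tendsto_const[of x] this]
      have "(\<lambda>n. G (x - V (n + N))) \<longlonglongrightarrow> G (x - 0)"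
        by (rule continuous_on_tendsto_compose[OF cont]) auto
      from tendsto_norm[OF tendsto_diff[OF this tendsto_const[of "G x"]]]
      show "(\<lambda>n. norm (G (x - V (n + N)) - G x)) \<longlonglongrightarrow> norm (G (x - 0) - G x)" .
    qed
    show "AE x in lborel. norm (norm (G (x - V (n + N)) - G x)) \<le> w x + w x" for n
    proof (intro AE_I2)
      fix x
      have "norm (G (x - V (n + N)) - G x) \<le> norm (G (x - V (n + N))) + norm (G (x - 0))"
        using norm_triangle_ineq4 by simp
      also have "\<dots> \<le> w x + w x" using N[of "n + N"] by (intro add_mono w) auto
      finally show "norm (norm (G (x - V (n + N)) - G x)) \<le> w x + w x" by simp
    qed
  qed (use w in auto)
  then have "(\<lambda>n. LINT x|lborel. norm (G (x - V (n + N)) - G x)) \<longlonglongrightarrow> 0" by simp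
  then show ?thesis by (rule LIMSEQ_offset)
qed

section \<open>Wiener's lemma on small neighbourhoods\<close>

text \<open>Since \<eta> vanishes at 0, the integral of \<open>fourier \<eta>\<close> is
  \<open>A * \<eta> 0 = 0\<close>. Hence \<open>fourier \<kappa> x\<close> may be subtracted inside
  the convolution, which leaves a difference of translates. The bound is an extended integral so
  that Tonelli applies to it directly.\<close>

lemma wiener_pointwise_bound:
  fixes \<eta> \<kappa> :: "'a::euclidean_space \<Rightarrow> complex"
  assumes \<eta>: "\<eta> \<in> test_funs" and \<kappa>: "\<kappa> \<in> test_funs" and "\<eta> 0 = 0" and "A \<noteq> 0"
    and A: "\<And>y. (LINT s|lborel. fourier \<eta> s * wave (- y) s) = A * \<eta> y"
  shows "ennreal (norm (fourier (\<lambda>y. \<eta> y * \<kappa> y) x)) \<le>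
    (\<integral>\<^sup>+s. ennreal (norm (fourier \<eta> s) * norm (fourier \<kappa> (x - s) - fourier \<kappa> x) / norm A) \<partial>lborel)"
proof -
  define H where "H = fourier \<eta>"
  define G where "G = fourier \<kappa>"
  have Hi: "integrable lborel H" using \<eta> by (simp add: H_def fourier_rapid rapid_integrable)
  have \<kappa>i: "integrable lborel \<kappa>" using \<kappa> by (rule test_funs_integrable)
  have [measurable]: "H \<in> borel_measurable borel" "G \<in> borel_measurable borel"
    using Hi \<kappa>i by (auto simp: G_def intro: fourier_measurable)
  have "integrable lborel (\<lambda>s. H (0 + (-1) *\<^sub>R s))"
    using Hi by (rule lborel_integrable_affine) simp
  then have H'i: "integrable lborel (\<lambda>s. H (- s))" by simp
  have Gb: "norm (G t) \<le> (LINT x|lborel. norm (\<kappa> x))" for t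
    unfolding G_def by (rule norm_fourier_le)
  \<comment> \<open>\<open>A * \<eta>\<close> is itself a transform, namely of the reflection of
    \<open>H\<close>, so \<open>fourier_mult_eq_convolution\<close> applies to its product with
    \<kappa>.\<close>
  have inv: "A * \<eta> y = fourier (\<lambda>s. H (- s)) y" for y
  proof -
    have "(LINT s|lborel. H (0 - s) * wave (- y) (0 - s)) = (LINT s|lborel. H s * wave (- y) s)"
      by (rule lborel_integral_reflect) measurable
    then show ?thesis using A[of y] by (simp add: fourier_eq[of "\<lambda>s. H (- s)"] wave_minus flip: H_def)
  qed
  have "fourier (\<lambda>y. A * (\<eta> y * \<kappa> y)) x = (LINT t|lborel. H (x - t) * G t)"
    using fourier_mult_eq_convolution[OF H'i \<kappa>i, of x] by (simp add: G_def mult.assoc flip: inv)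
  also have "\<dots> = (LINT s|lborel. H s * G (x - s))"
  proof -
    have "(LINT s|lborel. H (x - (x - s)) * G (x - s)) = (LINT t|lborel. H (x - t) * G t)"
      by (rule lborel_integral_reflect) measurable
    then show ?thesis by simp
  qed
  also have "\<dots> = (LINT s|lborel. H s * G (x - s)) - (LINT s|lborel. H s) * G x"
    using A[of 0] \<open>\<eta> 0 = 0\<close> by (simp flip: H_def)
  also have "\<dots> = (LINT s|lborel. H s * (G (x - s) - G x))"
  proof -
    have "integrable lborel (\<lambda>s. H s * G (x - s))"
    proof (rule Bochner_Integration.integrable_bound)
      show "integrable lborel (\<lambda>s. H s * of_real (LINT x|lborel. norm (\<kappa> x)))" using Hi by simp
      show "AE s in lborel. norm (H s * G (x - s)) \<le> norm (H s * of_real (LINT x|lborel. norm (\<kappa> x)))"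
        using Gb order_trans[OF _ abs_ge_self] by (intro AE_I2) (auto simp: norm_mult intro!: mult_left_mono)
    qed measurable
    then show ?thesis using Hi by (simp add: right_diff_distrib)
  qed
  finally have eq: "fourier (\<lambda>y. A * (\<eta> y * \<kappa> y)) x = (LINT s|lborel. H s * (G (x - s) - G x))" .
  have eq: "fourier (\<lambda>y. \<eta> y * \<kappa> y) x = (LINT s|lborel. H s * (G (x - s) - G x) / A)"
  proof -
    have "fourier (\<lambda>y. A * (\<eta> y * \<kappa> y)) x = A * fourier (\<lambda>y. \<eta> y * \<kappa> y) x"
      by (simp add: fourier_eq mult.assoc)
    with eq show ?thesis using \<open>A \<noteq> 0\<close> by (simp add: field_simps)
  qed
  have "integrable lborel (\<lambda>s. H s * (G (x - s) - G x) / A)"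
  proof (rule Bochner_Integration.integrable_bound)
    let ?M = "(LINT x|lborel. norm (\<kappa> x))"
    show "integrable lborel (\<lambda>s. H s * of_real (2 * ?M / norm A))" using Hi by simp
    show "AE s in lborel. norm (H s * (G (x - s) - G x) / A) \<le> norm (H s * of_real (2 * ?M / norm A))"
    proof (intro AE_I2)
      fix s
      have "norm (G (x - s) - G x) \<le> 2 * ?M"
        using norm_triangle_ineq4[of "G (x - s)" "G x"] Gb[of "x - s"] Gb[of x] by linarith
      then have "norm (H s) * (norm (G (x - s) - G x) / norm A) \<le> norm (H s) * (2 * ?M / norm A)"
        by (intro mult_left_mono divide_right_mono) auto
      also have "\<dots> = norm (H s * of_real (2 * ?M / norm A))"
        by (simp add: norm_mult norm_divide)
      finally show "norm (H s * (G (x - s) - G x) / A) \<le> norm (H s * of_real (2 * ?M / norm A))"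
        by (simp add: norm_mult norm_divide)
    qed
  qed measurable
  from integral_norm_bound_ennreal[OF this] show ?thesis
    unfolding eq by (simp add: H_def G_def norm_mult norm_divide)
qed

text \<open>Squeezing \<kappa> by a factor c spreads its transform, and a spread-out function hardly
  changes in L^1 under a fixed translation by s: the change equals that of
  \<open>fourier \<kappa>\<close> under translation by s / c. Dominated convergence in s, with
  |\<open>fourier \<eta>\<close>| as weight, concludes.\<close>

lemma wiener_local:
  fixes \<eta> \<kappa> :: "'a::euclidean_space \<Rightarrow> complex"
  assumes \<eta>: "\<eta> \<in> test_funs" and \<kappa>: "\<kappa> \<in> test_funs" and "\<eta> 0 = 0"
  shows "(\<lambda>n. LINT x|lborel. norm (fourier (\<lambda>y. \<eta> y * \<kappa> (real (Suc n) *\<^sub>R y)) x)) \<longlonglongrightarrow> 0"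
proof -
  obtain A where A: "A \<noteq> 0"
    "\<And>\<eta> y. \<eta> \<in> test_funs \<Longrightarrow> (LINT s|lborel. fourier \<eta> s * wave (- y) s) = A * \<eta> (y::'a)"
    using fourier_inversion_upto_const by blast
  define H where "H = fourier \<eta>"
  define G where "G = fourier \<kappa>"
  define c where "c = (\<lambda>n::nat. real (Suc n))"
  have c: "c n > 0" for n by (simp add: c_def)
  have clim: "(\<lambda>n. 1 / c n) \<longlonglongrightarrow> 0"
    unfolding c_def using LIMSEQ_inverse_real_of_nat by (simp add: inverse_eq_divide)
  \<comment> \<open>The L^1 modulus of continuity of \<open>G\<close>.\<close>
  define \<omega> where "\<omega> = (\<lambda>v. LINT x|lborel. norm (G (x - v) - G x))"
  have Hi: "integrable lborel H" and Gi: "integrable lborel G" and Gr: "rapid G"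
    using \<eta> \<kappa> by (simp_all add: H_def G_def fourier_rapid rapid_integrable)
  have [measurable]: "H \<in> borel_measurable borel" "G \<in> borel_measurable borel"
    using Hi Gi by auto
  have \<omega>_meas [measurable]: "\<omega> \<in> borel_measurable borel"
    unfolding \<omega>_def by measurable
  have Gt: "integrable lborel (\<lambda>x. G (x - v))" for v
    using lborel_integrable_affine[OF Gi, of 1 "- v"] by simp
  have \<omega>_nonneg: "\<omega> v \<ge> 0" for v by (simp add: \<omega>_def)
  have \<omega>_bound: "\<omega> v \<le> 2 * (LINT x|lborel. norm (G x))" for v
  proof -
    have "\<omega> v \<le> (LINT x|lborel. norm (G (x - v)) + norm (G x))"
      unfolding \<omega>_def using Gt Gi by (intro integral_mono norm_triangle_ineq4) auto
    also have "\<dots> = 2 * (LINT x|lborel. norm (G x))"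
      using Gt Gi lborel_integral_translate[of "\<lambda>x. norm (G x)" "- v"] by simp
    finally show ?thesis .
  qed
  define \<kappa>' where "\<kappa>' = (\<lambda>n y. \<kappa> (c n *\<^sub>R y))"
  have \<kappa>': "\<kappa>' n \<in> test_funs" for n
    using test_funs_affine[OF \<kappa>, of "c n" 0] c[of n] by (simp add: \<kappa>'_def)
  have G': "fourier (\<kappa>' n) x = of_real ((1 / c n) ^ DIM('a)) * G ((1 / c n) *\<^sub>R x)" for n x
    using fourier_scale[OF test_funs_measurable[OF \<kappa>], of "1 / c n" x] c[of n]
    by (simp add: \<kappa>'_def G_def)
  define F where "F = (\<lambda>n. fourier (\<lambda>y. \<eta> y * \<kappa>' n y))"
  have Fi: "integrable lborel (F n)" for n
    unfolding F_def using \<eta> \<kappa>' by (intro rapid_integrable fourier_rapid test_funs_mult test_funs_smooth)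
  \<comment> \<open>The amplitude factor of the dilated transform is exactly the Jacobian of the
    substitution.\<close>
  have \<omega>': "(LINT x|lborel. norm (fourier (\<kappa>' n) (x - s) - fourier (\<kappa>' n) x)) = \<omega> ((1 / c n) *\<^sub>R s)" for n s
  proof -
    have "\<omega> ((1 / c n) *\<^sub>R s) = \<bar>1 / c n\<bar> ^ DIM('a) *\<^sub>R
        (LINT x|lborel. norm (G ((0 + (1 / c n) *\<^sub>R x) - (1 / c n) *\<^sub>R s) - G (0 + (1 / c n) *\<^sub>R x)))"
      unfolding \<omega>_def using c[of n] by (intro lborel_integral_affine) auto
    also have "\<dots> = (LINT x|lborel. norm (fourier (\<kappa>' n) (x - s) - fourier (\<kappa>' n) x))"
      using c[of n] unfolding G' integral_scaleR_right[symmetric]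
      by (simp add: scaleR_diff_right norm_mult norm_power norm_divide flip: right_diff_distrib)
    finally show ?thesis ..
  qed
  have bound: "(LINT x|lborel. norm (F n x)) \<le> (LINT s|lborel. norm (H s) * \<omega> ((1 / c n) *\<^sub>R s) / norm A)" for n
  proof -
    let ?G = "fourier (\<kappa>' n)"
    have Ggi: "integrable lborel ?G" using \<kappa>' by (simp add: fourier_rapid rapid_integrable)
    have [measurable]: "?G \<in> borel_measurable borel" using Ggi by auto
    have i2: "integrable lborel (\<lambda>x. norm (?G (x - s) - ?G x))" for s
      using lborel_integrable_affine[OF Ggi, of 1 "- s"] Ggi by simp
    have i1: "integrable lborel (\<lambda>s. norm (H s) * \<omega> ((1 / c n) *\<^sub>R s) / norm A)"
    proof (rule Bochner_Integration.integrable_bound)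
      show "integrable lborel (\<lambda>s. norm (H s) * (2 * (LINT x|lborel. norm (G x))) / norm A)"
        using Hi by simp
      show "AE s in lborel. norm (norm (H s) * \<omega> ((1 / c n) *\<^sub>R s) / norm A)
          \<le> norm (norm (H s) * (2 * (LINT x|lborel. norm (G x))) / norm A)"
        using \<omega>_bound \<omega>_nonneg by (intro AE_I2) (auto simp: abs_mult intro!: divide_right_mono mult_left_mono)
    qed measurable
    have "ennreal (LINT x|lborel. norm (F n x)) = (\<integral>\<^sup>+x. ennreal (norm (F n x)) \<partial>lborel)"
      using Fi by (simp add: nn_integral_eq_integral)
    also have "\<dots> \<le> (\<integral>\<^sup>+x. (\<integral>\<^sup>+s. ennreal (norm (H s) * norm (?G (x - s) - ?G x) / norm A) \<partial>lborel) \<partial>lborel)"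
      unfolding F_def H_def
      by (intro nn_integral_mono wiener_pointwise_bound) (use assms \<kappa>' A in auto)
    also have "\<dots> = (\<integral>\<^sup>+s. (\<integral>\<^sup>+x. ennreal (norm (H s) * norm (?G (x - s) - ?G x) / norm A) \<partial>lborel) \<partial>lborel)"
      by (rule lborel_pair.Fubini') measurable
    also have "\<dots> = (\<integral>\<^sup>+s. ennreal (norm (H s) * \<omega> ((1 / c n) *\<^sub>R s) / norm A) \<partial>lborel)"
    proof (rule nn_integral_cong)
      fix s
      have "(\<integral>\<^sup>+x. ennreal (norm (H s) * norm (?G (x - s) - ?G x) / norm A) \<partial>lborel) =
          ennreal (LINT x|lborel. norm (H s) * norm (?G (x - s) - ?G x) / norm A)"
        by (intro nn_integral_eq_integral) (use i2 in auto)
      also have "(LINT x|lborel. norm (H s) * norm (?G (x - s) - ?G x) / norm A) =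
          norm (H s) * \<omega> ((1 / c n) *\<^sub>R s) / norm A"
        by (simp add: \<omega>')
      finally show "(\<integral>\<^sup>+x. ennreal (norm (H s) * norm (?G (x - s) - ?G x) / norm A) \<partial>lborel) =
          ennreal (norm (H s) * \<omega> ((1 / c n) *\<^sub>R s) / norm A)" .
    qed
    also have "\<dots> = ennreal (LINT s|lborel. norm (H s) * \<omega> ((1 / c n) *\<^sub>R s) / norm A)"
      using i1 \<omega>_nonneg by (intro nn_integral_eq_integral) auto
    finally show ?thesis
      using \<omega>_nonneg by (subst (asm) ennreal_le_iff) (auto intro!: integral_nonneg)
  qed
  have "(\<lambda>n. LINT s|lborel. norm (H s) * \<omega> ((1 / c n) *\<^sub>R s) / norm A) \<longlonglongrightarrow> (LINT s|(lborel::'a measure). 0)"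
  proof (rule integral_dominated_convergence[where w="\<lambda>s. norm (H s) * (2 * (LINT x|lborel. norm (G x))) / norm A"])
    show "AE s in lborel. (\<lambda>n. norm (H s) * \<omega> ((1 / c n) *\<^sub>R s) / norm A) \<longlonglongrightarrow> 0"
    proof (intro AE_I2)
      fix s :: 'a
      have "(\<lambda>n. (1 / c n) *\<^sub>R s) \<longlonglongrightarrow> 0 *\<^sub>R s" by (rule tendsto_scaleR[OF clim tendsto_const])
      then have "(\<lambda>n. \<omega> ((1 / c n) *\<^sub>R s)) \<longlonglongrightarrow> 0"
        unfolding \<omega>_def by (intro L1_translation_continuous[OF Gr]) simp
      then have "(\<lambda>n. norm (H s) * \<omega> ((1 / c n) *\<^sub>R s) / norm A) \<longlonglongrightarrow> norm (H s) * 0 / norm A"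
        using A(1) by (intro tendsto_intros) auto
      then show "(\<lambda>n. norm (H s) * \<omega> ((1 / c n) *\<^sub>R s) / norm A) \<longlonglongrightarrow> 0" by simp
    qed
    show "AE s in lborel. norm (norm (H s) * \<omega> ((1 / c n) *\<^sub>R s) / norm A)
        \<le> norm (H s) * (2 * (LINT x|lborel. norm (G x))) / norm A" for n
      using \<omega>_bound \<omega>_nonneg by (intro AE_I2) (auto simp: abs_mult intro!: divide_right_mono mult_left_mono)
  qed (use Hi in auto)
  then have lim: "(\<lambda>n. LINT s|lborel. norm (H s) * \<omega> ((1 / c n) *\<^sub>R s) / norm A) \<longlonglongrightarrow> 0" by simp
  have "(\<lambda>n. LINT x|lborel. norm (F n x)) \<longlonglongrightarrow> 0"
    by (rule tendsto_sandwich[OF _ _ tendsto_const lim]) (use bound in auto)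
  then show ?thesis by (simp add: F_def \<kappa>'_def c_def)
qed

section \<open>Tempered distributions and simple approximations of convolutions\<close>

text \<open>Convergence can be tested on the generating sets, since finite intersections and
  arbitrary unions inherit it.\<close>

lemma eventually_in_generated_topology:
  assumes "openin (topology_generated_by S) U" "l \<in> U"
    and "\<And>B. B \<in> S \<Longrightarrow> l \<in> B \<Longrightarrow> eventually (\<lambda>n. X n \<in> B) F"
  shows "eventually (\<lambda>n. X n \<in> U) F"
proof -
  have "generate_topology_on S U" using assms(1) by (simp add: openin_topology_generated_by_iff)
  then show ?thesis using assms(2)
  proof (induction rule: generate_topology_on.induct)
    case (Int a b)
    then show ?case by (auto intro: eventually_conj)
  next
    case (UN K)
    then obtain k where k: "k \<in> K" "l \<in> k" by blast
    with UN have "eventually (\<lambda>n. X n \<in> k) F" by blast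
    then show ?case by eventually_elim (use k in blast)
  next
    case (Basis s)
    then show ?case using assms(3) by blast
  qed auto
qed

lemma schwartz_bdd_above:
  assumes "\<phi> \<in> schwartz_funs" "bs \<in> lists Basis"
  shows "bdd_above (range (\<lambda>x. norm x ^ k * norm (iter_deriv bs \<phi> x)))"
proof -
  have "bounded (range (\<lambda>x. norm x ^ k *\<^sub>R iter_deriv bs \<phi> x))"
    using assms by (simp add: schwartz_funs_def)
  then obtain C where "\<And>x. norm x ^ k * norm (iter_deriv bs \<phi> x) \<le> C"
    by (auto simp: bounded_iff)
  then show ?thesis by (auto simp: bdd_above_def)
qed

lemma schwartz_funs_diff:
  "\<phi> \<in> schwartz_funs \<Longrightarrow> \<psi> \<in> schwartz_funs \<Longrightarrow> (\<lambda>x. \<phi> x - \<psi> x) \<in> schwartz_funs"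
  using schwartz_funs_add[of \<phi> "\<lambda>x. (-1) * \<psi> x"] schwartz_funs_cmult[of \<psi> "-1"] by simp

lemma schwartz_funs_smooth: "\<phi> \<in> schwartz_funs \<Longrightarrow> smooth_fun \<phi>"
  by (simp add: schwartz_funs_def)

lemma tempered_distribution_tendsto:
  fixes f :: "('a::euclidean_space \<Rightarrow> complex) \<Rightarrow> complex"
  assumes f: "tempered_distribution f" and X: "\<And>n. X n \<in> schwartz_funs" and \<phi>: "\<phi> \<in> schwartz_funs"
    and conv: "\<And>k bs e. bs \<in> lists Basis \<Longrightarrow> e > 0 \<Longrightarrow>
      eventually (\<lambda>n::nat. \<forall>x. norm x ^ k * norm (iter_deriv bs (\<lambda>x. X n x - \<phi> x) x) \<le> e) sequentially"
  shows "(\<lambda>n. f (X n)) \<longlonglongrightarrow> f \<phi>"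
proof (rule topological_tendstoI)
  fix U assume U: "open U" "f \<phi> \<in> U"
  let ?S = "{{\<psi> \<in> schwartz_funs. schwartz_seminorm k bs (\<lambda>x. \<psi> x - \<phi>0 x) < \<epsilon>} | k bs (\<phi>0::'a \<Rightarrow> complex) \<epsilon>.
        bs \<in> lists Basis \<and> \<phi>0 \<in> schwartz_funs \<and> \<epsilon> > 0}"
  \<comment> \<open>Continuity concerns the topspace, the union of the generating sets; \<phi>
    belongs to it as the centre of a unit ball.\<close>
  have "iter_deriv [] (\<lambda>x. \<phi> x - \<phi> x) = (\<lambda>_. 0)" by simp
  then have "schwartz_seminorm 0 [] (\<lambda>x. \<phi> x - \<phi> x) = 0" by (simp add: schwartz_seminorm_def)
  then have "\<phi> \<in> {\<psi> \<in> schwartz_funs. schwartz_seminorm 0 [] (\<lambda>x. \<psi> x - \<phi> x) < 1}"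
    using \<phi> by simp
  moreover have "{\<psi> \<in> schwartz_funs. schwartz_seminorm 0 [] (\<lambda>x. \<psi> x - \<phi> x) < 1} \<in> ?S"
    using \<phi> by (intro CollectI exI[of _ 0] exI[of _ "[]"] exI[of _ \<phi>] exI[of _ 1]) auto
  ultimately have top: "\<phi> \<in> topspace schwartz_topology"
    unfolding schwartz_topology_def topology_generated_by_topspace by blast
  have "continuous_map schwartz_topology euclidean f"
    using f by (simp add: tempered_distribution_def)
  then have op: "openin schwartz_topology {x \<in> topspace schwartz_topology. f x \<in> U}"
    using U(1) by (simp add: continuous_map_def)
  define T where "T = {x \<in> topspace schwartz_topology. f x \<in> U}"
  have "eventually (\<lambda>n. X n \<in> T) sequentially"
  proof (rule eventually_in_generated_topology)
    show "openin (topology_generated_by ?S) T"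
      using op by (simp only: T_def schwartz_topology_def)
    show "\<phi> \<in> T" using top U(2) by (simp add: T_def)
  next
    fix B assume "B \<in> ?S" "\<phi> \<in> B"
    then obtain k bs \<phi>0 \<epsilon> where B: "B = {\<psi> \<in> schwartz_funs. schwartz_seminorm k bs (\<lambda>x. \<psi> x - \<phi>0 x) < \<epsilon>}"
      "bs \<in> lists Basis" "\<phi>0 \<in> schwartz_funs" by blast
    define \<sigma> where "\<sigma> = schwartz_seminorm k bs (\<lambda>x. \<phi> x - \<phi>0 x)"
    have "\<sigma> < \<epsilon>" using \<open>\<phi> \<in> B\<close> by (simp add: B \<sigma>_def)
    \<comment> \<open>The generating set is centred at \<open>\<phi>0\<close>, not at \<phi>, so
      only the gap between \<sigma> and \<epsilon> is available. Half of it keeps the inequality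
      strict after passing to the supremum.\<close>
    then have "(\<epsilon> - \<sigma>) / 2 > 0" by simp
    from conv[OF B(2) this, of k] show "eventually (\<lambda>n. X n \<in> B) sequentially"
    proof eventually_elim
      case (elim n)
      have "norm x ^ k * norm (iter_deriv bs (\<lambda>x. X n x - \<phi>0 x) x) \<le> (\<epsilon> - \<sigma>) / 2 + \<sigma>" for x
      proof -
        have d: "(\<lambda>x. X n x - \<phi> x) \<in> schwartz_funs" "(\<lambda>x. \<phi> x - \<phi>0 x) \<in> schwartz_funs"
          using X \<phi> B(3) by (auto intro: schwartz_funs_diff)
        have "iter_deriv bs (\<lambda>x. X n x - \<phi>0 x) = iter_deriv bs (\<lambda>x. (X n x - \<phi> x) + (\<phi> x - \<phi>0 x))"
          by simp
        also have "\<dots> = (\<lambda>x. iter_deriv bs (\<lambda>x. X n x - \<phi> x) x + iter_deriv bs (\<lambda>x. \<phi> x - \<phi>0 x) x)"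
          using d B(2) by (intro iter_deriv_add) (auto intro: schwartz_funs_smooth)
        finally have "norm x ^ k * norm (iter_deriv bs (\<lambda>x. X n x - \<phi>0 x) x) \<le>
            norm x ^ k * norm (iter_deriv bs (\<lambda>x. X n x - \<phi> x) x) +
            norm x ^ k * norm (iter_deriv bs (\<lambda>x. \<phi> x - \<phi>0 x) x)"
          by (simp add: norm_triangle_ineq mult_left_mono flip: distrib_left)
        moreover have "norm x ^ k * norm (iter_deriv bs (\<lambda>x. \<phi> x - \<phi>0 x) x) \<le> \<sigma>"
          unfolding \<sigma>_def schwartz_seminorm_def
          using schwartz_bdd_above[OF d(2) B(2)] by (intro cSUP_upper) auto
        ultimately show ?thesis using elim[rule_format, of x] by linarith
      qed
      then have "schwartz_seminorm k bs (\<lambda>x. X n x - \<phi>0 x) \<le> (\<epsilon> - \<sigma>) / 2 + \<sigma>"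
        unfolding schwartz_seminorm_def by (intro cSUP_least) auto
      also have "\<dots> < \<epsilon>" using \<open>\<sigma> < \<epsilon>\<close> by (simp add: field_simps)
      finally show ?case using X by (simp add: B)
    qed
  qed
  then show "eventually (\<lambda>n. f (X n) \<in> U) sequentially"
    by eventually_elim (simp add: T_def)
qed

section \<open>Finite linear combinations\<close>

lemma tempered_distribution_linear:
  assumes "tempered_distribution f" "\<phi> \<in> schwartz_funs" "\<psi> \<in> schwartz_funs"
  shows "f (\<lambda>x. a * \<phi> x + b * \<psi> x) = a * f \<phi> + b * f \<psi>"
  using assms by (simp add: tempered_distribution_def)

lemma schwartz_funs_sum:
  assumes "finite V" "\<And>v. v \<in> V \<Longrightarrow> \<phi> v \<in> schwartz_funs"
  shows "(\<lambda>x. \<Sum>v\<in>V. c v * \<phi> v x) \<in> schwartz_funs"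
  using assms
proof (induction V)
  case empty
  show ?case using test_funs_schwartz[of "\<lambda>_. 0"] by (simp add: test_funs_iff smooth_fun_const)
next
  case (insert v V)
  have "(\<lambda>x. c v * \<phi> v x + (\<Sum>v\<in>V. c v * \<phi> v x)) \<in> schwartz_funs"
    using insert by (intro schwartz_funs_add schwartz_funs_cmult) auto
  then show ?case using insert by simp
qed

lemma tempered_distribution_sum:
  assumes "tempered_distribution f" "finite V" "\<And>v. v \<in> V \<Longrightarrow> \<phi> v \<in> schwartz_funs"
  shows "f (\<lambda>x. \<Sum>v\<in>V. c v * \<phi> v x) = (\<Sum>v\<in>V. c v * f (\<phi> v))"
  using assms(2,3)
proof (induction V)
  case empty
  have "(\<lambda>x. 0) \<in> schwartz_funs" using schwartz_funs_sum[of "{}"] by simp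
  from tempered_distribution_linear[OF assms(1) this this, of 0 0] show ?case by simp
next
  case (insert v V)
  have "f (\<lambda>x. c v * \<phi> v x + 1 * (\<Sum>v\<in>V. c v * \<phi> v x)) = c v * f (\<phi> v) + 1 * f (\<lambda>x. \<Sum>v\<in>V. c v * \<phi> v x)"
    using insert by (intro tempered_distribution_linear assms(1) schwartz_funs_sum) auto
  then show ?case using insert by simp
qed

lemma iter_deriv_sum:
  assumes "finite V" "\<And>v. v \<in> V \<Longrightarrow> \<phi> v \<in> schwartz_funs" "bs \<in> lists Basis"
  shows "iter_deriv bs (\<lambda>x. \<Sum>v\<in>V. c v * \<phi> v x) = (\<lambda>x. \<Sum>v\<in>V. c v * iter_deriv bs (\<phi> v) x)"
  using assms(1,2)
proof (induction V)
  case empty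
  show ?case using iter_deriv_cmult[OF smooth_fun_const[of 0] assms(3), of 0] by simp
next
  case (insert v V)
  have "iter_deriv bs (\<lambda>x. c v * \<phi> v x + (\<Sum>v\<in>V. c v * \<phi> v x)) =
      (\<lambda>x. iter_deriv bs (\<lambda>x. c v * \<phi> v x) x + iter_deriv bs (\<lambda>x. \<Sum>v\<in>V. c v * \<phi> v x) x)"
    using insert assms(3)
    by (intro iter_deriv_add schwartz_funs_smooth schwartz_funs_sum schwartz_funs_cmult) auto
  then show ?case using insert assms(3) by (simp add: iter_deriv_cmult schwartz_funs_smooth)
qed

text \<open>Turning the polynomial symbol back into derivatives of \<psi> makes every derivative of
  the convolution in \<open>tempered_convolution_bound\<close> a convolution again, with
  \<open>iter_deriv bs \<psi>\<close> in place of \<psi>.\<close>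

lemma fourier_iter_deriv:
  assumes "\<psi> \<in> test_funs" "bs \<in> lists Basis"
  shows "fourier_multiplier bs y * fourier \<psi> y = (-1) ^ length bs * fourier (iter_deriv bs \<psi>) y"
  using assms(2)
proof (induction bs)
  case Nil
  show ?case by (simp add: fourier_multiplier_def)
next
  case (Cons b bs)
  have "fourier (partial_deriv b (iter_deriv bs \<psi>)) y =
      2 * of_real pi * \<i> * of_real (y \<bullet> b) * fourier (iter_deriv bs \<psi>) y"
    using Cons assms(1) by (intro fourier_partial_deriv test_funs_iter_deriv) auto
  moreover have "fourier_multiplier (b # bs) y * fourier \<psi> y =
      - 2 * of_real pi * \<i> * of_real (y \<bullet> b) * (fourier_multiplier bs y * fourier \<psi> y)"
    by (simp add: fourier_multiplier_def mult_ac)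
  moreover have "fourier_multiplier bs y * fourier \<psi> y = (-1) ^ length bs * fourier (iter_deriv bs \<psi>) y"
    using Cons by simp
  ultimately show ?case by (simp add: iter_deriv_Cons)
qed

text \<open>Where \<open>\<psi> (u - x)\<close> is nonzero, |x| exceeds |u| by at most the radius of
  the support of \<psi>, so the growth of |x|^k costs \<open>k\<close> powers of the decay of
  \<open>H\<close>. Starting from \<open>k + DIM('a)\<close> powers leaves an integrable majorant
  that does not depend on \<open>x\<close>.\<close>

lemma convolution_kernel_bound:
  fixes \<psi> H :: "'a::euclidean_space \<Rightarrow> complex"
  assumes "\<psi> \<in> test_funs" "rapid H"
  obtains K where "\<And>u x. norm (norm x ^ k *\<^sub>R (\<psi> (u - x) * H u)) \<le> K * (1 / (1 + (norm u)\<^sup>2) ^ DIM('a))"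
proof -
  obtain M where M: "M > 0" "\<And>x. norm (\<psi> x) \<le> M" using test_funs_bounded[OF assms(1)] by blast
  obtain r where r: "r > 0" "\<And>x. norm x \<ge> r \<Longrightarrow> \<psi> x = 0"
    using test_funs_bounded_support[OF assms(1)] by blast
  obtain C where C: "C \<ge> 0" "\<And>x. norm (H x) \<le> C * (1 / (1 + (norm x)\<^sup>2) ^ (k + DIM('a)))"
    using rapidD[OF assms(2)] by blast
  define K where "K = (2 * (1 + r)) ^ k * (M * C)"
  have "norm (norm x ^ k *\<^sub>R (\<psi> (u - x) * H u)) \<le> K * (1 / (1 + (norm u)\<^sup>2) ^ DIM('a))" for u x
  proof (cases "norm (u - x) \<ge> r")
    case True
    then show ?thesis using r M C by (simp add: K_def)
  next
    case False
    define w where "w = 1 + (norm u)\<^sup>2"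
    have w: "w > 0" by (simp add: w_def add_pos_nonneg)
    \<comment> \<open>Together with w \<ge> 1 this leads to |x| \<le> 2 (1 + r) w, the origin of the
      base in \<open>K\<close>.\<close>
    have "norm u \<le> 1 + (norm u)\<^sup>2"
      using zero_le_power2[of "norm u - 1 / 2"] by (simp add: power2_eq_square algebra_simps)
    moreover have "(norm u)\<^sup>2 = w - 1" "w - 1 \<ge> 0" by (simp_all add: w_def)
    ultimately have "1 + norm u \<le> 2 * w" by linarith
    then have "(1 + r) * (1 + norm u) \<le> (1 + r) * (2 * w)" using r by (intro mult_left_mono) auto
    moreover have "norm x \<le> norm u + r" using norm_triangle_sub[of x u] False by (simp add: norm_minus_commute)
    moreover have "norm u + r \<le> (1 + r) * (1 + norm u)" using r by (simp add: algebra_simps)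
    ultimately have "norm x \<le> 2 * (1 + r) * w" by (simp add: mult_ac)
    then have 1: "norm x ^ k \<le> (2 * (1 + r)) ^ k * w ^ k"
      using power_mono[of "norm x" "2 * (1 + r) * w" k] by (simp only: power_mult_distrib norm_ge_zero)
    have "norm x ^ k * (norm (\<psi> (u - x)) * norm (H u)) \<le>
        ((2 * (1 + r)) ^ k * w ^ k) * (M * (C * (1 / w ^ (k + DIM('a)))))"
      using 1 M C(2)[of u] r w by (intro mult_mono) (auto simp: w_def)
    also have "\<dots> = K * (1 / w ^ DIM('a))"
      using w by (simp add: K_def power_add)
    finally show ?thesis by (simp add: norm_mult w_def)
  qed
  then show ?thesis by (rule that)
qed

text \<open>Sampling a convolution at the points \<open>s n t\<close> must converge in every
  Schwartz seminorm, hence uniformly in \<open>x\<close> against polynomial weights. The sets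
  \<open>A n\<close> keep \<open>s n t\<close> within distance 1 of \<open>t\<close>, so that one
  majorant serves for all \<open>n\<close> and \<open>x\<close>.\<close>

lemma convolution_approx_uniform:
  fixes \<psi> H :: "'a::euclidean_space \<Rightarrow> complex"
  assumes \<psi>: "\<psi> \<in> test_funs" and H: "rapid H"
    and [measurable]: "\<And>n. s n \<in> borel_measurable borel" "\<And>n. A n \<in> sets borel"
    and s: "\<And>t. (\<lambda>n. s n t) \<longlonglongrightarrow> t" "\<And>n t. t \<in> A n \<Longrightarrow> norm (s n t - t) \<le> 1"
    and A: "\<And>t. eventually (\<lambda>n::nat. t \<in> A n) sequentially" and "e > 0"
  shows "eventually (\<lambda>n. \<forall>x. norm x ^ k *
      norm ((LINT t|lborel. indicator (A n) t *\<^sub>R (\<psi> (s n t - x) * H (s n t))) -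
            (LINT t|lborel. \<psi> (t - x) * H t)) \<le> e) sequentially"
proof -
  have cH: "continuous_on UNIV H" using H by (simp add: rapid_def)
  have c\<psi>: "continuous_on UNIV \<psi>" using \<psi> by (rule test_funs_continuous)
  note [measurable] = borel_measurable_continuous_onI[OF cH] borel_measurable_continuous_onI[OF c\<psi>]
  obtain r where r: "r > 0" "\<And>x. norm x \<ge> r \<Longrightarrow> \<psi> x = 0"
    using test_funs_bounded_support[OF \<psi>] by blast
  define Q where "Q = (\<lambda>u x. norm x ^ k *\<^sub>R (\<psi> (u - x) * H u))"
  have [measurable]: "(\<lambda>u. Q u x) \<in> borel_measurable borel" for x
    unfolding Q_def by measurable
  define W where "W = (\<lambda>u::'a. 1 / (1 + (norm u)\<^sup>2) ^ DIM('a))"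
  obtain K where K: "\<And>u x. norm (Q u x) \<le> K * W u"
    using convolution_kernel_bound[OF \<psi> H, of k] unfolding Q_def W_def by blast
  have W: "W u > 0" for u by (auto simp: W_def intro!: zero_less_power add_pos_nonneg)
  have Wi: "integrable lborel W" unfolding W_def by (rule integrable_decay_weight)
  have "K * W 0 \<ge> 0" using order_trans[OF norm_ge_zero K] by blast
  then have K0: "K \<ge> 0" using W[of 0] by (simp add: zero_le_mult_iff)
  define D where "D = (\<lambda>n x t. indicator (A n) t *\<^sub>R Q (s n t) x - Q t x)"
  have Q1: "norm (indicator (A n) t *\<^sub>R Q (s n t) x) \<le> K * 3 ^ DIM('a) * W t" for n t x
  proof (cases "t \<in> A n")
    case True
    have "norm (Q (s n t) x) \<le> K * W (s n t)" by (rule K)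
    also have "\<dots> \<le> K * (3 ^ DIM('a) * W t)"
      unfolding W_def using s(2)[OF True] K0 by (intro mult_left_mono decay_weight_shift) (auto simp: norm_minus_commute)
    finally show ?thesis using True by (simp add: mult.assoc)
  next
    case False
    then show ?thesis using K0 W[of t] by simp
  qed
  have i1: "integrable lborel (\<lambda>t. indicator (A n) t *\<^sub>R Q (s n t) x)" for n x
  proof (rule Bochner_Integration.integrable_bound[OF integrable_mult_right[OF Wi, of "K * 3 ^ DIM('a)"]])
    show "(\<lambda>t. indicator (A n) t *\<^sub>R Q (s n t) x) \<in> borel_measurable lborel"
      unfolding Q_def by measurable
    show "AE t in lborel. norm (indicator (A n) t *\<^sub>R Q (s n t) x) \<le> norm (K * 3 ^ DIM('a) * W t)"
      by (intro AE_I2) (simp only: real_norm_def order_trans[OF Q1 abs_ge_self])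
  qed
  have i2: "integrable lborel (\<lambda>t. Q t x)" for x
  proof (rule Bochner_Integration.integrable_bound[OF integrable_mult_right[OF Wi, of K]])
    show "AE t in lborel. norm (Q t x) \<le> norm (K * W t)"
      by (intro AE_I2) (simp only: real_norm_def order_trans[OF K abs_ge_self])
  qed measurable
  \<comment> \<open>The points \<open>X n\<close> need not converge: at fixed \<open>t\<close> the
    integrand tends to 0 uniformly in the second argument.\<close>
  have lim: "(\<lambda>n. LINT t|lborel. norm (D n (X n) t)) \<longlonglongrightarrow> 0" for X
  proof -
    have "(\<lambda>n. LINT t|lborel. norm (D n (X n) t)) \<longlonglongrightarrow> (LINT t|(lborel::'a measure). 0)"
    proof (rule integral_dominated_convergence[where w="\<lambda>t. K * 3 ^ DIM('a) * W t + K * W t"])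
      show "integrable lborel (\<lambda>t. K * 3 ^ DIM('a) * W t + K * W t)" using Wi by simp
      show "(\<lambda>t. norm (D n (X n) t)) \<in> borel_measurable lborel" for n
        using i1 i2 by (auto simp: D_def)
      show "AE t in lborel. norm (norm (D n (X n) t)) \<le> K * 3 ^ DIM('a) * W t + K * W t" for n
      proof (intro AE_I2)
        fix t
        have "norm (D n (X n) t) \<le> norm (indicator (A n) t *\<^sub>R Q (s n t) (X n)) + norm (Q t (X n))"
          unfolding D_def by (rule norm_triangle_ineq4)
        also have "\<dots> \<le> K * 3 ^ DIM('a) * W t + K * W t" by (intro add_mono Q1 K)
        finally show "norm (norm (D n (X n) t)) \<le> K * 3 ^ DIM('a) * W t + K * W t" by simp
      qed
      show "AE t in lborel. (\<lambda>n. norm (D n (X n) t)) \<longlonglongrightarrow> 0"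
      proof (intro AE_I2 tendstoI)
        fix t :: 'a and \<delta> :: real assume "\<delta> > 0"
        \<comment> \<open>Beyond \<rho> both values of \<psi> vanish, because \<open>s n t\<close>
          has norm at most |t| + 1 eventually; inside, compactness gives uniform continuity.\<close>
        define \<rho> where "\<rho> = norm t + 1 + r"
        let ?K = "cball 0 (norm t + 1) \<times> cball (0::'a) \<rho>"
        have "continuous_on ?K (\<lambda>p. Q (fst p) (snd p))"
          unfolding Q_def
          by (intro continuous_intros continuous_on_compose2[OF cH] continuous_on_compose2[OF c\<psi>]) auto
        then have "uniformly_continuous_on ?K (\<lambda>p. Q (fst p) (snd p))"
          by (intro compact_uniformly_continuous compact_Times) auto
        then obtain d where d: "d > 0"
          "\<And>p q. p \<in> ?K \<Longrightarrow> q \<in> ?K \<Longrightarrow> dist p q < d \<Longrightarrow> dist (Q (fst p) (snd p)) (Q (fst q) (snd q)) < \<delta>"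
          using \<open>\<delta> > 0\<close> unfolding uniformly_continuous_on_def by metis
        have "eventually (\<lambda>n. dist (s n t) t < min d 1) sequentially"
          using s(1)[of t] d(1) by (intro tendstoD) auto
        with A[of t] show "eventually (\<lambda>n. dist (norm (D n (X n) t)) 0 < \<delta>) sequentially"
        proof eventually_elim
          case (elim n)
          then have D: "D n (X n) t = Q (s n t) (X n) - Q t (X n)" by (simp add: D_def)
          have st: "norm (s n t) \<le> norm t + 1"
            using norm_triangle_sub[of "s n t" t] elim by (simp add: dist_norm)
          show ?case
          proof (cases "norm (X n) \<le> \<rho>")
            case True
            have "dist (s n t, X n) (t, X n) < d" using elim by (simp add: dist_Pair_Pair)
            then have "dist (Q (s n t) (X n)) (Q t (X n)) < \<delta>"
              using d(2)[of "(s n t, X n)" "(t, X n)"] True st by simp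
            then show ?thesis by (simp add: D dist_norm)
          next
            case False
            then have "norm (s n t - X n) \<ge> r" "norm (t - X n) \<ge> r"
              using norm_triangle_sub[of "X n" "s n t"] norm_triangle_sub[of "X n" t] st
              by (simp_all add: \<rho>_def norm_minus_commute)
            then show ?thesis using r \<open>\<delta> > 0\<close> by (simp add: D Q_def)
          qed
        qed
      qed
    qed simp
    then show ?thesis by simp
  qed
  define P where "P = (\<lambda>n x. norm x ^ k *
      norm ((LINT t|lborel. indicator (A n) t *\<^sub>R (\<psi> (s n t - x) * H (s n t))) -
            (LINT t|lborel. \<psi> (t - x) * H t)) \<le> e)"
  have P: "P n x" if "(LINT t|lborel. norm (D n x t)) < e" for n x
  proof -
    have "norm x ^ k *\<^sub>R ((LINT t|lborel. indicator (A n) t *\<^sub>R (\<psi> (s n t - x) * H (s n t))) -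
            (LINT t|lborel. \<psi> (t - x) * H t)) =
       (LINT t|lborel. indicator (A n) t *\<^sub>R Q (s n t) x) - (LINT t|lborel. Q t x)"
      unfolding Q_def scaleR_diff_right integral_scaleR_right[symmetric] by (simp add: mult.commute)
    also have "\<dots> = (LINT t|lborel. D n x t)"
      unfolding D_def using i1 i2 by simp
    finally have "norm (norm x ^ k *\<^sub>R ((LINT t|lborel. indicator (A n) t *\<^sub>R (\<psi> (s n t - x) * H (s n t))) -
            (LINT t|lborel. \<psi> (t - x) * H t))) \<le> (LINT t|lborel. norm (D n x t))"
      using integral_norm_bound[of lborel "D n x"] by (simp only:)
    with that show ?thesis unfolding P_def by simp
  qed
  \<comment> \<open>The points \<open>X n\<close> are worst cases, which turns uniformity in \<open>x\<close> into a sequential limit.\<close>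
  define X where "X = (\<lambda>n. SOME x. \<not> P n x)"
  have "eventually (\<lambda>n. (LINT t|lborel. norm (D n (X n) t)) < e) sequentially"
    using lim[of X] \<open>e > 0\<close> by (rule order_tendstoD)
  then have "eventually (\<lambda>n. \<forall>x. P n x) sequentially"
  proof eventually_elim
    case (elim n)
    then have "P n (X n)" by (rule P)
    then show ?case unfolding X_def by (metis someI)
  qed
  then show ?thesis by (simp add: P_def)
qed

text \<open>The level sets of \<open>s\<close> within the bounded set \<open>A\<close> have finite
  measure, so the integral is a finite combination of values, to which a linear functional can be
  applied term by term.\<close>

lemma integral_finite_range:
  fixes F :: "'a::euclidean_space \<Rightarrow> complex"
  assumes [measurable]: "s \<in> borel_measurable borel" "A \<in> sets borel"
    and "finite (range s)" "bounded A"
  shows "(LINT t|lborel. indicator A t *\<^sub>R F (s t)) =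
    (\<Sum>v\<in>range s. of_real (measure lborel (A \<inter> s -` {v})) * F v)"
proof -
  have m: "A \<inter> s -` {v} \<in> sets lborel" for v
    using measurable_sets[OF assms(1), of "{v}"] assms(2) by (simp add: sets.Int)
  have fin: "emeasure lborel (A \<inter> s -` {v}) < \<infinity>" for v
    by (rule emeasure_bounded_finite[OF bounded_subset[OF assms(4)]]) simp
  have "indicator A t *\<^sub>R F (s t) = (\<Sum>v\<in>range s. indicator (A \<inter> s -` {v}) t *\<^sub>R F v)" for t
  proof -
    have "(\<Sum>v\<in>range s. indicator (A \<inter> s -` {v}) t *\<^sub>R F v) =
        (\<Sum>v\<in>{s t}. indicator (A \<inter> s -` {v}) t *\<^sub>R F v)"
      using assms(3) by (intro sum.mono_neutral_right) (auto simp: indicator_def)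
    then show ?thesis by (simp add: indicator_def)
  qed
  then have "(LINT t|lborel. indicator A t *\<^sub>R F (s t)) =
      (LINT t|lborel. (\<Sum>v\<in>range s. indicator (A \<inter> s -` {v}) t *\<^sub>R F v))" by simp
  also have "\<dots> = (\<Sum>v\<in>range s. (LINT t|lborel. indicator (A \<inter> s -` {v}) t *\<^sub>R F v))"
    using m fin by (intro Bochner_Integration.integral_sum integrable_scaleR_left) auto
  also have "\<dots> = (\<Sum>v\<in>range s. of_real (measure lborel (A \<inter> s -` {v})) * F v)"
    using m fin by (intro sum.cong refl) (simp add: scaleR_conv_of_real)
  finally show ?thesis .
qed

text \<open>A bump with nonzero integral is modulated so that this integral becomes the value of the
  transform at \<gamma>, and then normalised.\<close>

lemma test_fun_with_fourier_eq_1: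
  obtains \<psi> :: "'a::euclidean_space \<Rightarrow> complex" where "\<psi> \<in> test_funs" "fourier \<psi> \<gamma> = 1"
proof -
  obtain a :: "'a \<Rightarrow> complex" where a: "a \<in> test_funs" "(LINT x|lborel. a x) \<noteq> 0"
    using unit_bump by blast
  define c where "c = (LINT x|lborel. a x)"
  show ?thesis
  proof (rule that)
    show "(\<lambda>x. (1 / c) * (a x * wave (- \<gamma>) x)) \<in> test_funs"
      by (intro test_funs_cmult test_funs_mult a smooth_fun_wave)
    have "fourier (\<lambda>x. (1 / c) * (a x * wave (- \<gamma>) x)) \<gamma> = (LINT x|lborel. (1 / c) * a x)"
      by (simp add: fourier_eq mult.assoc)
    then show "fourier (\<lambda>x. (1 / c) * (a x * wave (- \<gamma>) x)) \<gamma> = 1"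
      using a(2) by (simp add: c_def)
  qed
qed

text \<open>An almost period near -t carries \<open>t\<close> into a fixed ball, where continuity
  bounds \<open>g\<close>, and changes the value by less than 1.\<close>

lemma almost_periodic_bounded:
  assumes "almost_periodic g"
  obtains B where "\<And>t. norm (g t) \<le> B"
proof -
  have cont: "continuous_on UNIV g" using assms by (simp add: almost_periodic_def)
  define E where "E = {\<tau>. (SUP x. ennreal (norm (g (x + \<tau>) - g x))) < ennreal 1}"
  have "\<forall>\<epsilon>>0. relatively_dense {\<tau>. (SUP x. ennreal (norm (g (x + \<tau>) - g x))) < ennreal \<epsilon>}"
    using assms unfolding almost_periodic_def by (rule conjunct2)
  from this[rule_format, of 1] have "relatively_dense E" unfolding E_def by simp
  then obtain R where R: "\<And>x. E \<inter> ball x R \<noteq> {}" by (auto simp: relatively_dense_def)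
  have "compact (g ` cball 0 R)"
    by (intro compact_continuous_image continuous_on_subset[OF cont]) auto
  then obtain M where M: "\<And>x. norm x \<le> R \<Longrightarrow> norm (g x) \<le> M"
    by (force dest!: compact_imp_bounded simp: bounded_iff)
  show ?thesis
  proof (rule that)
    fix t
    obtain \<tau> where \<tau>: "\<tau> \<in> E" "\<tau> \<in> ball (- t) R" using R[of "- t"] by blast
    have "norm (t + \<tau>) \<le> R" using \<tau>(2) norm_minus_cancel[of "t + \<tau>"] by (simp add: dist_norm)
    then have "norm (g (t + \<tau>)) \<le> M" by (rule M)
    moreover have "norm (g (t + \<tau>) - g t) < 1"
    proof -
      have "ennreal (norm (g (t + \<tau>) - g t)) \<le> (SUP x. ennreal (norm (g (x + \<tau>) - g x)))"
        by (rule SUP_upper) simp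
      also have "\<dots> < ennreal 1" using \<tau>(1) by (simp only: E_def mem_Collect_eq)
      finally show ?thesis by (simp only: ennreal_less_iff norm_ge_zero)
    qed
    ultimately show "norm (g t) \<le> M + 1"
      using norm_triangle_sub[of "g t" "g (t + \<tau>)"] by (simp add: norm_minus_commute)
  qed
qed

text \<open>Formally the value is the integral of
  \<open>f (\<lambda>x. \<psi> (t - x)) * H t\<close> over t. To move \<open>f\<close> under the
  integral, the convolution is replaced by finite sums \<open>X n\<close> of reflected translates of
  \<psi>, which converge to \<open>R\<close> in all seminorms; the triangle inequality for the sums
  gives the bound in the limit.\<close>

lemma tempered_convolution_bound:
  fixes f :: "('a::euclidean_space \<Rightarrow> complex) \<Rightarrow> complex"
  assumes f: "tempered_distribution f" and \<psi>: "\<psi> \<in> test_funs" and \<eta>: "\<eta> \<in> test_funs"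
    and B: "\<And>t. norm (f (\<lambda>x. \<psi> (t - x))) \<le> B"
  shows "norm (fourier_dist f (\<lambda>y. fourier \<psi> y * \<eta> y)) \<le> B * (LINT t|lborel. norm (fourier \<eta> t))"
proof -
  define H where "H = fourier \<eta>"
  define R where "R = fourier (\<lambda>y. fourier \<psi> y * \<eta> y)"
  have Hr: "rapid H" unfolding H_def using \<eta> by (rule fourier_rapid)
  have cH: "continuous_on UNIV H" using Hr by (simp add: rapid_def)
  note [measurable] = borel_measurable_continuous_onI[OF cH]
  have sm: "smooth_fun (fourier \<psi>)" using \<psi> by (intro schwartz_funs_smooth fourier_schwartz)
  have \<psi>\<eta>: "(\<lambda>y. fourier \<psi> y * \<eta> y) \<in> test_funs" using \<eta> sm by (rule test_funs_mult2)
  have RS: "R \<in> schwartz_funs" unfolding R_def using \<psi>\<eta> by (rule fourier_schwartz)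
  obtain s :: "nat \<Rightarrow> 'a \<Rightarrow> 'a" where s: "\<And>n. simple_function borel (s n)" "\<And>t. (\<lambda>n. s n t) \<longlonglongrightarrow> t"
    using borel_measurable_implies_sequence_metric[of "\<lambda>x::'a. x" borel 0] by auto
  have [measurable]: "s n \<in> borel_measurable borel" for n using s(1) by (rule borel_measurable_simple_function)
  have fin: "finite (range (s n))" for n using simple_functionD(1)[OF s(1)] by simp
  \<comment> \<open>The bound on |t| makes the level sets of finite measure, and closeness of
    \<open>s n t\<close> to \<open>t\<close> provides the majorant; every \<open>t\<close>
    eventually satisfies both.\<close>
  define A where "A = (\<lambda>n. {t \<in> space borel. norm t \<le> real n \<and> norm (s n t - t) \<le> 1})"
  have A_meas [measurable]: "A n \<in> sets borel" for n unfolding A_def by measurable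
  have A_bdd: "bounded (A n)" for n by (auto simp: A_def bounded_iff)
  have A1: "norm (s n t - t) \<le> 1" if "t \<in> A n" for n t using that by (simp add: A_def)
  have A_ev: "eventually (\<lambda>n. t \<in> A n) sequentially" for t
  proof -
    have "eventually (\<lambda>n. dist (s n t) t < 1) sequentially" using s(2)[of t] by (rule tendstoD) simp
    moreover have "eventually (\<lambda>n. norm t \<le> real n) sequentially"
      using eventually_ge_at_top[of "nat \<lceil>norm t\<rceil>"] by eventually_elim linarith
    ultimately show ?thesis by eventually_elim (simp add: A_def dist_norm)
  qed
  define m where "m = (\<lambda>n v. measure lborel (A n \<inter> s n -` {v}))"
  have simple: "(LINT t|lborel. indicator (A n) t *\<^sub>R F (s n t)) = (\<Sum>v\<in>range (s n). of_real (m n v) * F v)"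
    for n and F :: "'a \<Rightarrow> complex"
    unfolding m_def by (intro integral_finite_range fin A_bdd) measurable
  define X where "X = (\<lambda>n x. \<Sum>v\<in>range (s n). (of_real (m n v) * H v) * \<psi> (v - x))"
  have \<psi>S: "(\<lambda>x. \<psi> (v - x)) \<in> schwartz_funs" for v
    using \<psi> by (intro test_funs_schwartz test_funs_reflect)
  have XS: "X n \<in> schwartz_funs" for n
    unfolding X_def by (intro schwartz_funs_sum fin \<psi>S)
  have "(\<lambda>n. f (X n)) \<longlonglongrightarrow> f R"
  proof (rule tempered_distribution_tendsto[OF f XS RS])
    fix k :: nat and bs :: "'a list" and e :: real assume bs: "bs \<in> lists Basis" and e: "e > 0"
    \<comment> \<open>Derivatives in \<open>x\<close> fall on \<psi> alone, so one approximation
      result, applied to \<open>\<psi>'\<close>, handles all seminorms.\<close>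
    define \<psi>' where "\<psi>' = iter_deriv bs \<psi>"
    have \<psi>': "\<psi>' \<in> test_funs" unfolding \<psi>'_def using \<psi> bs by (rule test_funs_iter_deriv)
    have dX: "iter_deriv bs (X n) x = (-1) ^ length bs *
        (LINT t|lborel. indicator (A n) t *\<^sub>R (\<psi>' (s n t - x) * H (s n t)))" for n x
      unfolding X_def simple[where F="\<lambda>v. \<psi>' (v - x) * H v"] iter_deriv_sum[OF fin \<psi>S bs]
      by (simp add: iter_deriv_reflect[OF test_funs_smooth[OF \<psi>] bs] \<psi>'_def sum_distrib_left mult_ac)
    have dR: "iter_deriv bs R x = (-1) ^ length bs * (LINT t|lborel. \<psi>' (t - x) * H t)" for x
    proof -
      have "iter_deriv bs R x = fourier (\<lambda>y. fourier_multiplier bs y * (fourier \<psi> y * \<eta> y)) x"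
        unfolding R_def by (simp add: iter_deriv_fourier[OF \<psi>\<eta>])
      also have "(\<lambda>y. fourier_multiplier bs y * (fourier \<psi> y * \<eta> y)) =
          (\<lambda>y. (-1) ^ length bs * (fourier \<psi>' y * \<eta> y))"
        using fourier_iter_deriv[OF \<psi> bs] by (simp add: \<psi>'_def mult.assoc[symmetric] fun_eq_iff)
      also have "fourier \<dots> x = (-1) ^ length bs * fourier (\<lambda>y. fourier \<psi>' y * \<eta> y) x"
        by (simp add: fourier_eq mult.assoc)
      also have "fourier (\<lambda>y. fourier \<psi>' y * \<eta> y) x = (LINT t|lborel. \<psi>' (t - x) * H t)"
        unfolding H_def using \<psi>' \<eta> by (intro fourier_mult_eq_convolution test_funs_integrable)
      finally show ?thesis .
    qed
    have d: "iter_deriv bs (\<lambda>x. X n x - R x) x = iter_deriv bs (X n) x - iter_deriv bs R x" for n x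
      using iter_deriv_add[OF schwartz_funs_smooth[OF XS] schwartz_funs_smooth[OF schwartz_funs_cmult[OF RS]] bs, of n "-1"]
      by (simp add: iter_deriv_cmult[OF schwartz_funs_smooth[OF RS] bs, of "-1", simplified])
    have "eventually (\<lambda>n. \<forall>x. norm x ^ k *
      norm ((LINT t|lborel. indicator (A n) t *\<^sub>R (\<psi>' (s n t - x) * H (s n t))) -
            (LINT t|lborel. \<psi>' (t - x) * H t)) \<le> e) sequentially"
      using s(2) A1 A_ev e by (intro convolution_approx_uniform[OF \<psi>' Hr]) auto
    moreover have "norm (iter_deriv bs (\<lambda>x. X n x - R x) x) =
       norm ((LINT t|lborel. indicator (A n) t *\<^sub>R (\<psi>' (s n t - x) * H (s n t))) -
            (LINT t|lborel. \<psi>' (t - x) * H t))" for n x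
      unfolding d dX dR right_diff_distrib[symmetric] by (simp add: norm_mult norm_power)
    ultimately show "eventually (\<lambda>n. \<forall>x. norm x ^ k * norm (iter_deriv bs (\<lambda>x. X n x - R x) x) \<le> e) sequentially"
      by simp
  qed
  then have lim1: "(\<lambda>n. norm (f (X n))) \<longlonglongrightarrow> norm (f R)" by (rule tendsto_norm)
  \<comment> \<open>Each translate contributes at most \<open>B\<close> times the modulus of its
    coefficient; as the masses \<open>m n v\<close> are nonnegative, these moduli add up to the
    integral of the sampled |H|.\<close>
  have bound: "norm (f (X n)) \<le> B * (LINT t|lborel. indicator (A n) t *\<^sub>R norm (H (s n t)))" for n
  proof -
    have m0: "m n v \<ge> 0" for v by (simp add: m_def)
    \<comment> \<open>\<open>simple\<close> speaks of complex integrands, so the real identity is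
      obtained by embedding.\<close>
    have "complex_of_real (LINT t|lborel. indicator (A n) t *\<^sub>R norm (H (s n t))) =
        (LINT t|lborel. indicator (A n) t *\<^sub>R complex_of_real (norm (H (s n t))))"
      by (simp add: scaleR_conv_of_real flip: integral_complex_of_real of_real_mult)
    also have "\<dots> = complex_of_real (\<Sum>v\<in>range (s n). m n v * norm (H v))"
      by (subst simple) simp
    finally have eq: "(LINT t|lborel. indicator (A n) t *\<^sub>R norm (H (s n t))) = (\<Sum>v\<in>range (s n). m n v * norm (H v))"
      using of_real_eq_iff by blast
    have "norm (f (X n)) = norm (\<Sum>v\<in>range (s n). (of_real (m n v) * H v) * f (\<lambda>x. \<psi> (v - x)))"
      unfolding X_def by (subst tempered_distribution_sum[OF f fin \<psi>S]) simp
    also have "\<dots> \<le> (\<Sum>v\<in>range (s n). norm ((of_real (m n v) * H v) * f (\<lambda>x. \<psi> (v - x))))"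
      by (rule norm_sum)
    also have "\<dots> \<le> (\<Sum>v\<in>range (s n). B * (m n v * norm (H v)))"
    proof (rule sum_mono)
      fix v
      have "norm ((of_real (m n v) * H v) * f (\<lambda>x. \<psi> (v - x))) = (m n v * norm (H v)) * norm (f (\<lambda>x. \<psi> (v - x)))"
        using m0 by (simp add: norm_mult)
      also have "\<dots> \<le> (m n v * norm (H v)) * B" using m0 B by (intro mult_left_mono) auto
      finally show "norm ((of_real (m n v) * H v) * f (\<lambda>x. \<psi> (v - x))) \<le> B * (m n v * norm (H v))"
        by (simp add: mult.commute)
    qed
    finally show ?thesis unfolding eq sum_distrib_left .
  qed
  obtain w where w: "integrable lborel w" "\<And>x v. norm v \<le> 1 \<Longrightarrow> norm (H (x - v)) \<le> w x"
    using rapid_translate_dominated[OF Hr] by blast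
  have "(\<lambda>n. LINT t|lborel. indicator (A n) t *\<^sub>R norm (H (s n t))) \<longlonglongrightarrow> (LINT t|lborel. norm (H t))"
  proof (rule integral_dominated_convergence[OF _ _ w(1)])
    show "AE t in lborel. norm (indicator (A n) t *\<^sub>R norm (H (s n t))) \<le> w t" for n
    proof (rule AE_I2)
      fix t
      show "norm (indicator (A n) t *\<^sub>R norm (H (s n t))) \<le> w t"
      proof (cases "t \<in> A n")
        case True
        then show ?thesis using w(2)[of "t - s n t" t] A1[OF True] by (simp add: norm_minus_commute)
      next
        case False
        then show ?thesis using order_trans[OF norm_ge_zero w(2)[of 0 t]] by simp
      qed
    qed
    show "AE t in lborel. (\<lambda>n. indicator (A n) t *\<^sub>R norm (H (s n t))) \<longlonglongrightarrow> norm (H t)"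
    proof (rule AE_I2)
      fix t
      have "(\<lambda>n. H (s n t)) \<longlonglongrightarrow> H t"
        by (rule continuous_on_tendsto_compose[OF cH s(2)]) auto
      from tendsto_norm[OF this] show "(\<lambda>n. indicator (A n) t *\<^sub>R norm (H (s n t))) \<longlonglongrightarrow> norm (H t)"
      proof (rule Lim_transform_eventually)
        show "eventually (\<lambda>n. norm (H (s n t)) = indicator (A n) t *\<^sub>R norm (H (s n t))) sequentially"
          using A_ev[of t] by eventually_elim simp
      qed
    qed
  qed measurable
  from tendsto_mult_left[OF this, of B] have "norm (f R) \<le> B * (LINT t|lborel. norm (H t))"
    using bound by (intro LIMSEQ_le[OF lim1]) auto
  then show ?thesis by (simp add: fourier_dist_def R_def H_def)
qed

lemma fourier_dist_linear:
  assumes "tempered_distribution f" "\<phi> \<in> test_funs" "\<psi> \<in> test_funs"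
  shows "fourier_dist f (\<lambda>x. a * \<phi> x + b * \<psi> x) = a * fourier_dist f \<phi> + b * fourier_dist f \<psi>"
proof -
  have i: "integrable lborel (\<lambda>x. \<phi> x * wave y x)" "integrable lborel (\<lambda>x. \<psi> x * wave y x)" for y
    using assms by (simp_all add: integrable_mult_wave test_funs_integrable)
  have "fourier (\<lambda>x. a * \<phi> x + b * \<psi> x) = (\<lambda>y. a * fourier \<phi> y + b * fourier \<psi> y)"
    using i by (simp add: fourier_eq distrib_right mult.assoc fun_eq_iff)
  then show ?thesis
    using assms by (simp add: fourier_dist_def tempered_distribution_linear fourier_schwartz)
qed

section \<open>The spectral measure\<close>

lemma fourier_dist_diff:
  assumes "tempered_distribution f" "\<phi> \<in> test_funs" "\<psi> \<in> test_funs"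
  shows "fourier_dist f (\<lambda>x. \<phi> x - \<psi> x) = fourier_dist f \<phi> - fourier_dist f \<psi>"
  using fourier_dist_linear[OF assms, of 1 "-1"] by simp

lemma fourier_dist_zero:
  assumes "tempered_distribution f"
  shows "fourier_dist f (\<lambda>x. 0) = 0"
proof -
  have "(\<lambda>x. 0) \<in> test_funs" by (simp add: test_funs_iff smooth_fun_const)
  from fourier_dist_linear[OF assms this this, of 0 0] show ?thesis by simp
qed

text \<open>By definition of the support, the value is known to vanish only on test functions
  supported in a single one of the open sets. Over a compact support these are joined by multiplying
  \<phi> with factors 1 - \<beta>, each of which leaves the value unchanged, until the product is
  identically zero. This does the work of a partition of unity.\<close>

lemma fourier_dist_vanishes_off_spectrum:
  fixes f :: "('a::euclidean_space \<Rightarrow> complex) \<Rightarrow> complex"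
  assumes f: "tempered_distribution f" and \<phi>: "\<phi> \<in> test_funs"
    and disj: "fun_support \<phi> \<inter> spectrum f = {}"
  shows "fourier_dist f \<phi> = 0"
proof -
  let ?K = "fun_support \<phi>"
  have "compact ?K" using \<phi> by (simp add: test_funs_def)
  \<comment> \<open>The radius 2 r is where the cut-off of \<open>bump_exists\<close> reaches 0; its
    plateau of radius r will be used for the covering.\<close>
  have "\<exists>r>0. \<forall>\<psi>\<in>test_funs. fun_support \<psi> \<subseteq> cball y (2 * r) \<longrightarrow> fourier_dist f \<psi> = 0" if "y \<in> ?K" for y
  proof -
    have "y \<notin> spectrum f" using that disj by blast
    then obtain U where U: "open U" "y \<in> U"
      "\<forall>\<psi>\<in>test_funs. fun_support \<psi> \<subseteq> U \<longrightarrow> fourier_dist f \<psi> = 0"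
      unfolding spectrum_def dist_support_def by blast
    then obtain e where e: "e > 0" "cball y e \<subseteq> U" by (auto simp: open_contains_cball)
    have "cball y (2 * (e / 2)) \<subseteq> U" using e(2) by simp
    with U(3) have "\<forall>\<psi>\<in>test_funs. fun_support \<psi> \<subseteq> cball y (2 * (e / 2)) \<longrightarrow> fourier_dist f \<psi> = 0"
      by (meson subset_trans)
    with e(1) show ?thesis by (intro exI[of _ "e / 2"]) simp
  qed
  then obtain r where r: "\<And>y. y \<in> ?K \<Longrightarrow> r y > 0"
    "\<And>y \<psi>. y \<in> ?K \<Longrightarrow> \<psi> \<in> test_funs \<Longrightarrow> fun_support \<psi> \<subseteq> cball y (2 * r y) \<Longrightarrow> fourier_dist f \<psi> = 0"
    by metis
  have "\<exists>\<beta>. smooth_fun \<beta> \<and> (\<forall>x. dist y x \<le> r y \<longrightarrow> \<beta> x = 1) \<and> (\<forall>x. dist y x \<ge> 2 * r y \<longrightarrow> \<beta> x = 0)"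
    if y: "y \<in> ?K" for y
  proof -
    obtain \<beta> :: "'a \<Rightarrow> real" where "(\<lambda>x. of_real (\<beta> x)) \<in> test_funs"
      "\<And>x. 0 \<le> \<beta> x" "\<And>x. \<beta> x \<le> 1"
      "\<And>x. dist y x \<le> r y \<Longrightarrow> \<beta> x = 1" "\<And>x. dist y x \<ge> 2 * r y \<Longrightarrow> \<beta> x = 0"
      by (rule bump_exists[OF r(1)[OF y], of y]) blast
    then show ?thesis by (intro exI[of _ "\<lambda>x. of_real (\<beta> x)"]) (simp add: test_funs_smooth)
  qed
  then obtain \<beta> where \<beta>: "\<And>y. y \<in> ?K \<Longrightarrow> smooth_fun (\<beta> y)"
    "\<And>y x. y \<in> ?K \<Longrightarrow> dist y x \<le> r y \<Longrightarrow> \<beta> y x = 1"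
    "\<And>y x. y \<in> ?K \<Longrightarrow> dist y x \<ge> 2 * r y \<Longrightarrow> \<beta> y x = 0"
    by metis
  have "?K \<subseteq> (\<Union>y\<in>?K. ball y (r y))" using r(1) by auto
  then obtain Y where Y: "Y \<subseteq> ?K" "finite Y" "?K \<subseteq> (\<Union>y\<in>Y. ball y (r y))"
    by (rule compactE_image[OF \<open>compact ?K\<close> open_ball])
  have "(\<lambda>x. \<phi> x * (\<Prod>y\<in>Z. 1 - \<beta> y x)) \<in> test_funs \<and>
      fourier_dist f (\<lambda>x. \<phi> x * (\<Prod>y\<in>Z. 1 - \<beta> y x)) = fourier_dist f \<phi>" if "finite Z" "Z \<subseteq> ?K" for Z
    using that
  proof (induction Z)
    case empty
    then show ?case using \<phi> by simp
  next
    case (insert y Z)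
    define h where "h = (\<lambda>x. \<phi> x * (\<Prod>y\<in>Z. 1 - \<beta> y x))"
    have h: "h \<in> test_funs" "fourier_dist f h = fourier_dist f \<phi>" using insert by (auto simp: h_def)
    have y: "y \<in> ?K" using insert by auto
    have h\<beta>: "(\<lambda>x. h x * \<beta> y x) \<in> test_funs" using h(1) \<beta>(1)[OF y] by (rule test_funs_mult)
    have "fun_support (\<lambda>x. h x * \<beta> y x) \<subseteq> cball y (2 * r y)"
      unfolding fun_support_altdef
    proof (rule closure_minimal)
      show "{x. h x * \<beta> y x \<noteq> 0} \<subseteq> cball y (2 * r y)" using \<beta>(3)[OF y] by force
    qed simp
    then have "fourier_dist f (\<lambda>x. h x * \<beta> y x) = 0" using r(2)[OF y h\<beta>] by simp
    moreover have "(\<lambda>x. \<phi> x * (\<Prod>y\<in>insert y Z. 1 - \<beta> y x)) = (\<lambda>x. h x - h x * \<beta> y x)"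
      using insert by (simp add: h_def fun_eq_iff algebra_simps)
    ultimately show ?case
      using fourier_dist_diff[OF f h(1) h\<beta>] h h\<beta> by (simp add: test_funs_diff)
  qed
  from this[OF Y(2,1)] have "fourier_dist f \<phi> = fourier_dist f (\<lambda>x. \<phi> x * (\<Prod>y\<in>Y. 1 - \<beta> y x))" by simp
  \<comment> \<open>Where \<phi> is nonzero, the factor belonging to a covering ball is 0.\<close>
  also have "(\<lambda>x. \<phi> x * (\<Prod>y\<in>Y. 1 - \<beta> y x)) = (\<lambda>x. 0)"
  proof
    fix x
    show "\<phi> x * (\<Prod>y\<in>Y. 1 - \<beta> y x) = 0"
    proof (cases "\<phi> x = 0")
      case False
      then obtain y where y: "y \<in> Y" "dist y x < r y"
        using in_fun_supportI[of \<phi> x] Y(3) by auto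
      then have "1 - \<beta> y x = 0" using \<beta>(2)[of y x] Y(1) by auto
      then show ?thesis using y Y(2) by auto
    qed simp
  qed
  finally show ?thesis using fourier_dist_zero[OF f] by simp
qed

text \<open>The discarded part, \<phi> minus \<phi> times \<kappa>, vanishes near \<gamma>, so its
  support misses the spectrum.\<close>

lemma fourier_dist_localize:
  assumes f: "tempered_distribution f" and \<phi>: "\<phi> \<in> test_funs" and \<kappa>: "smooth_fun \<kappa>"
    and supp: "fun_support \<phi> \<inter> spectrum f \<subseteq> {\<gamma>}"
    and "r > 0" "\<And>x. dist \<gamma> x < r \<Longrightarrow> \<kappa> x = 1"
  shows "fourier_dist f (\<lambda>x. \<phi> x * \<kappa> x) = fourier_dist f \<phi>"
proof -
  let ?d = "\<lambda>x. \<phi> x - \<phi> x * \<kappa> x"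
  have t: "(\<lambda>x. \<phi> x * \<kappa> x) \<in> test_funs" using \<phi> \<kappa> by (rule test_funs_mult)
  have "fun_support ?d \<subseteq> fun_support \<phi>" by (rule fun_support_mono) simp
  moreover have "\<gamma> \<notin> fun_support ?d"
    unfolding not_in_fun_support_iff using assms(5,6) by (intro exI[of _ "ball \<gamma> r"]) simp
  ultimately have "fun_support ?d \<inter> spectrum f = {}" using supp by blast
  then have "fourier_dist f ?d = 0"
    by (rule fourier_dist_vanishes_off_spectrum[OF f test_funs_diff[OF \<phi> t]])
  then show ?thesis using fourier_dist_diff[OF f \<phi> t] by simp
qed

lemma fourier_dist_vanishes_at_spectral_point:
  fixes f :: "('a::euclidean_space \<Rightarrow> complex) \<Rightarrow> complex"
  assumes f: "tempered_distribution f" and ap: "almost_periodic_distribution f"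
    and \<phi>: "\<phi> \<in> test_funs" and supp: "fun_support \<phi> \<inter> spectrum f \<subseteq> {\<gamma>}" and "\<phi> \<gamma> = 0"
  shows "fourier_dist f \<phi> = 0"
proof -
  obtain \<psi> where \<psi>: "\<psi> \<in> test_funs" "fourier \<psi> \<gamma> = 1" by (rule test_fun_with_fourier_eq_1)
  have "almost_periodic (\<lambda>t. f (\<lambda>x. \<psi> (t - x)))"
    using ap \<psi>(1) by (simp add: almost_periodic_distribution_def)
  then obtain B where B: "\<And>t. norm (f (\<lambda>x. \<psi> (t - x))) \<le> B" by (rule almost_periodic_bounded) blast
  have sm: "smooth_fun (fourier \<psi>)" using \<psi>(1) by (intro schwartz_funs_smooth fourier_schwartz)
  have "isCont (fourier \<psi>) \<gamma>"
    using fourier_continuous[OF test_funs_integrable[OF \<psi>(1)]] by (simp add: continuous_on_eq_continuous_at)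
  \<comment> \<open>Within distance \<delta> of \<gamma> the transform of \<psi> differs from 1 by
    less than 1, so it has no zero there.\<close>
  then obtain \<delta> where \<delta>: "\<delta> > 0" "\<And>y. dist y \<gamma> < \<delta> \<Longrightarrow> dist (fourier \<psi> y) 1 < 1"
    unfolding continuous_at_eps_delta using \<psi>(2) zero_less_one by metis
  \<comment> \<open>Nested radii: \<theta> is 1 up to \<delta>/4, where \<kappa> has reached 0, and
    is itself 0 from \<delta>/2 on, well inside the ball of radius \<delta>.\<close>
  obtain \<theta> :: "'a \<Rightarrow> real" where \<theta>: "(\<lambda>x. of_real (\<theta> x)) \<in> test_funs"
    "\<And>x. 0 \<le> \<theta> x" "\<And>x. \<theta> x \<le> 1"
    "\<And>x. dist \<gamma> x \<le> \<delta> / 4 \<Longrightarrow> \<theta> x = 1" "\<And>x. dist \<gamma> x \<ge> 2 * (\<delta> / 4) \<Longrightarrow> \<theta> x = 0"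
    by (rule bump_exists[of "\<delta> / 4" \<gamma>]) (use \<delta>(1) in auto)
  obtain \<kappa> :: "'a \<Rightarrow> real" where \<kappa>: "(\<lambda>x. of_real (\<kappa> x)) \<in> test_funs"
    "\<And>x. 0 \<le> \<kappa> x" "\<And>x. \<kappa> x \<le> 1"
    "\<And>x. dist \<gamma> x \<le> \<delta> / 8 \<Longrightarrow> \<kappa> x = 1" "\<And>x. dist \<gamma> x \<ge> 2 * (\<delta> / 8) \<Longrightarrow> \<kappa> x = 0"
    by (rule bump_exists[of "\<delta> / 8" \<gamma>]) (use \<delta>(1) in auto)
  obtain \<omega> :: "'a \<Rightarrow> real" where \<omega>: "(\<lambda>x. of_real (\<omega> x)) \<in> test_funs"
    "\<And>x. 0 \<le> \<omega> x" "\<And>x. \<omega> x \<le> 1"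
    "\<And>x. dist 0 x \<le> 1 \<Longrightarrow> \<omega> x = 1" "\<And>x. dist 0 x \<ge> 2 * (1) \<Longrightarrow> \<omega> x = 0"
    by (rule bump_exists[of "1" 0]) (use \<delta>(1) in auto)
  note smooth = test_funs_smooth[OF \<theta>(1)] test_funs_smooth[OF \<kappa>(1)]
  define \<phi>1 where "\<phi>1 = (\<lambda>x. \<phi> x * of_real (\<kappa> x))"
  have \<phi>1: "\<phi>1 \<in> test_funs" unfolding \<phi>1_def using \<phi> smooth(2) by (rule test_funs_mult)
  have \<phi>1_eq: "fourier_dist f \<phi>1 = fourier_dist f \<phi>"
    unfolding \<phi>1_def using \<delta>(1) \<kappa>(4)
    by (intro fourier_dist_localize[OF f \<phi> smooth(2) supp, of "\<delta> / 8"]) auto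
  have supp1: "fun_support \<phi>1 \<inter> spectrum f \<subseteq> {\<gamma>}"
    using fun_support_mono[of \<phi> \<phi>1] supp by (auto simp: \<phi>1_def)
  \<comment> \<open>\<open>q\<close> is a globally invertible modification of \<open>fourier \<psi>\<close>.\<close>
  define q where "q = (\<lambda>y. 1 + of_real (\<theta> y) * (fourier \<psi> y - 1))"
  \<comment> \<open>Inside the ball of radius \<delta>, \<open>q\<close> is 1 plus a term of modulus
    below 1; outside it equals 1.\<close>
  have q0: "q y \<noteq> 0" for y
  proof (cases "dist y \<gamma> < \<delta>")
    case True
    then have "norm (fourier \<psi> y - 1) < 1" using \<delta>(2) by (simp add: dist_norm)
    moreover have "norm (of_real (\<theta> y) * (fourier \<psi> y - 1)) \<le> norm (fourier \<psi> y - 1)"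
      using \<theta>(2,3)[of y] by (simp add: norm_mult mult_left_le_one_le)
    ultimately have "norm (of_real (\<theta> y) * (fourier \<psi> y - 1)) < 1" by linarith
    moreover have "norm (of_real (\<theta> y) * (fourier \<psi> y - 1)) = 1" if "q y = 0"
      using that unfolding q_def by (simp add: add_eq_0_iff2) (metis norm_minus_cancel norm_one add.inverse_inverse norm_mult norm_of_real)
    ultimately show ?thesis by auto
  next
    case False
    then show ?thesis using \<theta>(5)[of y] \<delta>(1) by (simp add: q_def dist_commute)
  qed
  have q_sm: "smooth_fun q"
    unfolding q_def by (intro smooth_fun_add smooth_fun_mult smooth_fun_diff smooth_fun_const smooth sm)
  define \<eta> where "\<eta> = (\<lambda>y. \<phi>1 y * inverse (q y))"
  have \<eta>: "\<eta> \<in> test_funs"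
    unfolding \<eta>_def using \<phi>1 q_sm q0 by (intro test_funs_mult smooth_fun_inverse)
  \<comment> \<open>Wherever \<open>\<phi>1\<close> is nonzero the cut-off \<theta> is 1, so
    \<open>q\<close> is \<open>fourier \<psi>\<close> there.\<close>
  have factor: "\<phi>1 y = fourier \<psi> y * \<eta> y" for y
  proof (cases "dist \<gamma> y \<le> \<delta> / 4")
    case True
    then have "q y = fourier \<psi> y" by (simp add: q_def \<theta>(4))
    then show ?thesis using q0[of y] by (simp add: \<eta>_def)
  next
    case False
    then have "\<phi>1 y = 0" using \<kappa>(5)[of y] by (simp add: \<phi>1_def)
    then show ?thesis by (simp add: \<eta>_def)
  qed
  \<comment> \<open>\<open>wiener_local\<close> is stated at the origin; the form
    \<open>1 *\<^sub>R y + \<gamma>\<close> fits \<open>test_funs_affine\<close>.\<close>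
  define \<eta>' where "\<eta>' = (\<lambda>y. \<eta> (1 *\<^sub>R y + \<gamma>))"
  have \<eta>': "\<eta>' \<in> test_funs" "\<eta>' 0 = 0"
    using test_funs_affine[OF \<eta>, of 1 \<gamma>] \<open>\<phi> \<gamma> = 0\<close> by (simp_all add: \<eta>'_def \<eta>_def \<phi>1_def)
  define \<Omega> where "\<Omega> = (\<lambda>x. complex_of_real (\<omega> x))"
  have \<Omega>: "\<Omega> \<in> test_funs" using \<omega>(1) by (simp add: \<Omega>_def)
  have \<Omega>': "smooth_fun (\<lambda>y. \<Omega> (real (Suc n) *\<^sub>R (y - \<gamma>)))" for n
    using smooth_fun_affine[OF test_funs_smooth[OF \<Omega>], of "real (Suc n)" "- real (Suc n) *\<^sub>R \<gamma>"]
    by (simp add: scaleR_diff_right del: of_nat_Suc)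
  \<comment> \<open>The left side does not depend on \<open>n\<close>: cutting off to a ball around
    \<gamma> whose radius shrinks like 1/n keeps the value, while the right side will tend to
    0.\<close>
  have bound: "norm (fourier_dist f \<phi>) \<le>
      B * (LINT x|lborel. norm (fourier (\<lambda>y. \<eta>' y * \<Omega> (real (Suc n) *\<^sub>R y)) x))" for n
  proof -
    define c where "c = real (Suc n)"
    have c: "c > 0" by (simp add: c_def)
    let ?\<eta> = "\<lambda>y. \<eta> y * \<Omega> (c *\<^sub>R (y - \<gamma>))"
    have \<eta>n: "?\<eta> \<in> test_funs" unfolding c_def using \<eta> \<Omega>' by (rule test_funs_mult)
    have "fourier_dist f \<phi> = fourier_dist f (\<lambda>y. \<phi>1 y * \<Omega> (c *\<^sub>R (y - \<gamma>)))"
      unfolding \<phi>1_eq[symmetric]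
    proof (rule fourier_dist_localize[OF f \<phi>1 _ supp1, symmetric])
      show "smooth_fun (\<lambda>y. \<Omega> (c *\<^sub>R (y - \<gamma>)))" unfolding c_def by (rule \<Omega>')
      show "1 / c > 0" using c by simp
      show "\<Omega> (c *\<^sub>R (x - \<gamma>)) = 1" if "dist \<gamma> x < 1 / c" for x
      proof -
        have "norm (c *\<^sub>R (x - \<gamma>)) \<le> 1"
          unfolding norm_scaleR using that c by (simp add: dist_norm norm_minus_commute field_simps)
        then show ?thesis by (simp add: \<Omega>_def \<omega>(4))
      qed
    qed
    also have "(\<lambda>y. \<phi>1 y * \<Omega> (c *\<^sub>R (y - \<gamma>))) = (\<lambda>y. fourier \<psi> y * ?\<eta> y)"
      by (simp add: factor mult.assoc)
    also have "norm (fourier_dist f (\<lambda>y. fourier \<psi> y * ?\<eta> y)) \<le> B * (LINT x|lborel. norm (fourier ?\<eta> x))"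
      by (rule tempered_convolution_bound[OF f \<psi>(1) \<eta>n B])
    \<comment> \<open>Translation by \<gamma> multiplies the transform by a factor of modulus
      1.\<close>
    also have "(\<lambda>x. norm (fourier ?\<eta> x)) = (\<lambda>x. norm (fourier (\<lambda>y. \<eta>' y * \<Omega> (c *\<^sub>R y)) x))"
    proof
      fix x
      have [measurable]: "\<eta>' \<in> borel_measurable borel" "\<Omega> \<in> borel_measurable borel"
        using \<eta>' \<Omega> by (simp_all add: test_funs_measurable)
      have "fourier (\<lambda>y. \<eta>' (y - \<gamma>) * \<Omega> (c *\<^sub>R (y - \<gamma>))) x = wave x \<gamma> * fourier (\<lambda>y. \<eta>' y * \<Omega> (c *\<^sub>R y)) x"
        by (rule fourier_translate[where u="\<lambda>y. \<eta>' y * \<Omega> (c *\<^sub>R y)"]) measurable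
      moreover have "(\<lambda>y. \<eta>' (y - \<gamma>) * \<Omega> (c *\<^sub>R (y - \<gamma>))) = ?\<eta>" by (simp add: \<eta>'_def)
      ultimately show "norm (fourier ?\<eta> x) = norm (fourier (\<lambda>y. \<eta>' y * \<Omega> (c *\<^sub>R y)) x)"
        by (simp add: norm_mult)
    qed
    finally show ?thesis by (simp only: c_def)
  qed
  have "(\<lambda>n. B * (LINT x|lborel. norm (fourier (\<lambda>y. \<eta>' y * \<Omega> (real (Suc n) *\<^sub>R y)) x))) \<longlonglongrightarrow> B * 0"
    by (intro tendsto_mult_left wiener_local \<eta>' \<Omega>)
  then have "norm (fourier_dist f \<phi>) \<le> B * 0"
    by (rule LIMSEQ_le_const) (use bound in blast)
  then show ?thesis by simp
qed

text \<open>One spectral point \<gamma> is split off by its cut-off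
  \<open>\<theta> \<gamma>\<close>. The function (\<phi> - \<phi>(\<gamma>)) times
  \<open>\<theta> \<gamma>\<close> vanishes at \<gamma>, the only spectral point in its support,
  hence is annihilated; what remains of \<phi> has support away from \<gamma>. As the remainder is a
  new test function, \<phi> is arbitrary in the induction.\<close>

lemma fourier_dist_eq_sum:
  fixes f :: "('a::euclidean_space \<Rightarrow> complex) \<Rightarrow> complex"
  assumes f: "tempered_distribution f" and ap: "almost_periodic_distribution f"
    and \<theta>: "\<And>\<gamma>. \<gamma> \<in> spectrum f \<Longrightarrow> \<theta> \<gamma> \<in> test_funs"
    and \<theta>_supp: "\<And>\<gamma>. \<gamma> \<in> spectrum f \<Longrightarrow> fun_support (\<theta> \<gamma>) \<inter> spectrum f \<subseteq> {\<gamma>}"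
    and \<rho>: "\<And>\<gamma>. \<gamma> \<in> spectrum f \<Longrightarrow> \<rho> \<gamma> > 0"
      "\<And>\<gamma> x. \<gamma> \<in> spectrum f \<Longrightarrow> dist \<gamma> x < \<rho> \<gamma> \<Longrightarrow> \<theta> \<gamma> x = 1"
    and "finite S" "S \<subseteq> spectrum f" "\<phi> \<in> test_funs" "fun_support \<phi> \<inter> spectrum f \<subseteq> S"
  shows "fourier_dist f \<phi> = (\<Sum>\<gamma>\<in>S. fourier_dist f (\<theta> \<gamma>) * \<phi> \<gamma>)"
  using assms(7-10)
proof (induction S arbitrary: \<phi>)
  case empty
  then show ?case using fourier_dist_vanishes_off_spectrum[OF f] by auto
next
  case (insert \<gamma> S)
  have \<gamma>: "\<gamma> \<in> spectrum f" using insert by auto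
  have sm: "smooth_fun (\<theta> \<gamma>)" using \<theta>[OF \<gamma>] by (rule test_funs_smooth)
  define \<phi>1 where "\<phi>1 = (\<lambda>x. \<phi> x - \<phi> x * \<theta> \<gamma> x)"
  have t: "(\<lambda>x. \<phi> x * \<theta> \<gamma> x) \<in> test_funs" using insert.prems(2) sm by (rule test_funs_mult)
  have \<phi>1: "\<phi>1 \<in> test_funs" unfolding \<phi>1_def using insert.prems(2) t by (rule test_funs_diff)
  have "\<gamma> \<notin> fun_support \<phi>1"
    unfolding not_in_fun_support_iff \<phi>1_def using \<rho>[OF \<gamma>] by (intro exI[of _ "ball \<gamma> (\<rho> \<gamma>)"]) simp
  moreover have "fun_support \<phi>1 \<subseteq> fun_support \<phi>" by (rule fun_support_mono) (simp add: \<phi>1_def)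
  ultimately have "fun_support \<phi>1 \<inter> spectrum f \<subseteq> S" using insert.prems(3) by blast
  with \<phi>1 have "fourier_dist f \<phi>1 = (\<Sum>\<gamma>\<in>S. fourier_dist f (\<theta> \<gamma>) * \<phi>1 \<gamma>)"
    using insert by (intro insert.IH) auto
  also have "\<dots> = (\<Sum>\<gamma>\<in>S. fourier_dist f (\<theta> \<gamma>) * \<phi> \<gamma>)"
  proof (intro sum.cong refl)
    fix s assume s: "s \<in> S"
    \<comment> \<open>Only \<gamma> among the spectral points lies in the support of
      \<open>\<theta> \<gamma>\<close>, so the remainder has the same values as \<phi> on
      \<open>S\<close>.\<close>
    then have "\<theta> \<gamma> s = 0"
      using \<theta>_supp[OF \<gamma>] in_fun_supportI[of "\<theta> \<gamma>" s] insert.hyps(2) insert.prems(1) by blast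
    then show "fourier_dist f (\<theta> s) * \<phi>1 s = fourier_dist f (\<theta> s) * \<phi> s"
      by (simp add: \<phi>1_def)
  qed
  finally have 1: "fourier_dist f \<phi>1 = (\<Sum>\<gamma>\<in>S. fourier_dist f (\<theta> \<gamma>) * \<phi> \<gamma>)" .
  have d: "(\<lambda>x. \<phi> x * \<theta> \<gamma> x - \<phi> \<gamma> * \<theta> \<gamma> x) \<in> test_funs"
    using t \<theta>[OF \<gamma>] by (intro test_funs_diff test_funs_cmult)
  have "fourier_dist f (\<lambda>x. \<phi> x * \<theta> \<gamma> x - \<phi> \<gamma> * \<theta> \<gamma> x) = 0"
  proof (rule fourier_dist_vanishes_at_spectral_point[OF f ap d])
    have "fun_support (\<lambda>x. \<phi> x * \<theta> \<gamma> x - \<phi> \<gamma> * \<theta> \<gamma> x) \<subseteq> fun_support (\<theta> \<gamma>)"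
      by (rule fun_support_mono) simp
    then show "fun_support (\<lambda>x. \<phi> x * \<theta> \<gamma> x - \<phi> \<gamma> * \<theta> \<gamma> x) \<inter> spectrum f \<subseteq> {\<gamma>}"
      using \<theta>_supp[OF \<gamma>] by blast
  qed simp
  then have "fourier_dist f (\<lambda>x. \<phi> x * \<theta> \<gamma> x) = \<phi> \<gamma> * fourier_dist f (\<theta> \<gamma>)"
    using fourier_dist_linear[OF f t \<theta>[OF \<gamma>], of 1 "- \<phi> \<gamma>"] by simp
  moreover have "fourier_dist f \<phi>1 = fourier_dist f \<phi> - fourier_dist f (\<lambda>x. \<phi> x * \<theta> \<gamma> x)"
    unfolding \<phi>1_def using f insert.prems(2) t by (rule fourier_dist_diff)
  ultimately show ?case using 1 insert.hyps by (simp add: algebra_simps)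
qed

section \<open>Discrete Radon measures and the final assembly\<close>

lemma locally_finite_set_bounded:
  fixes \<Gamma> :: "'a::real_normed_vector set"
  assumes "locally_finite_set \<Gamma>" "bounded K"
  shows "finite (\<Gamma> \<inter> K)"
proof -
  obtain r where "K \<subseteq> ball 0 r" using bounded_subset_ballD[OF assms(2), of 0] by auto
  then have "\<Gamma> \<inter> K \<subseteq> \<Gamma> \<inter> ball 0 r" by blast
  moreover have "finite (\<Gamma> \<inter> ball 0 r)" using assms(1) by (simp add: locally_finite_set_def)
  ultimately show ?thesis by (rule finite_subset)
qed

text \<open>The weighted counting measure lives on all subsets of \<Gamma>, so it is pushed forward
  to the Borel sets of the whole space. Compact sets and supports of test functions meet \<Gamma> in
  finitely many points, which makes the masses finite and the integrals finite sums.\<close>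

lemma discrete_radon_measure:
  fixes w :: "'a::euclidean_space \<Rightarrow> real"
  assumes \<Gamma>: "locally_finite_set \<Gamma>" and w: "\<And>x. w x \<ge> 0"
  obtains \<mu> where "radon_measure \<mu>"
    "\<And>\<phi>. \<phi> \<in> test_funs \<Longrightarrow> integral\<^sup>L \<mu> \<phi> = (\<Sum>\<gamma>\<in>\<Gamma> \<inter> fun_support \<phi>. of_real (w \<gamma>) * \<phi> \<gamma>)"
proof -
  note fin = locally_finite_set_bounded[OF \<Gamma>]
  let ?D = "density (count_space \<Gamma>) (\<lambda>x. ennreal (w x))"
  define \<mu> where "\<mu> = distr ?D borel (\<lambda>x. x)"
  have m: "(\<lambda>x. x) \<in> measurable ?D borel" by simp
  show ?thesis
  proof (rule that[of \<mu>])
    show "radon_measure \<mu>"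
      unfolding radon_measure_def
    proof (intro conjI allI impI)
      show "sets \<mu> = sets borel" by (simp add: \<mu>_def)
      fix K :: "'a set" assume K: "compact K"
      have "emeasure \<mu> K = emeasure ?D (\<Gamma> \<inter> K)"
        unfolding \<mu>_def using K by (subst emeasure_distr[OF m]) (auto simp: compact_imp_closed Int_commute)
      also have "\<dots> = (\<integral>\<^sup>+x. ennreal (w x) * indicator (\<Gamma> \<inter> K) x \<partial>count_space \<Gamma>)"
        by (subst emeasure_density) auto
      also have "\<dots> = (\<integral>\<^sup>+x. ennreal (w x) * indicator (\<Gamma> \<inter> K) x \<partial>count_space (\<Gamma> \<inter> K))"
        by (rule nn_integral_count_space_eq) (auto simp: indicator_def)
      also have "\<dots> = (\<Sum>x\<in>\<Gamma> \<inter> K. ennreal (w x) * indicator (\<Gamma> \<inter> K) x)"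
        using fin[OF compact_imp_bounded[OF K]] by (rule nn_integral_count_space_finite)
      also have "\<dots> < \<infinity>" by (simp add: sum_ennreal w)
      finally show "emeasure \<mu> K < \<infinity>" .
    qed
  next
    fix \<phi> :: "'a \<Rightarrow> complex" assume \<phi>: "\<phi> \<in> test_funs"
    have S: "finite (\<Gamma> \<inter> fun_support \<phi>)"
      using \<phi> by (intro fin compact_imp_bounded) (simp add: test_funs_def)
    have sub: "{\<gamma> \<in> \<Gamma>. w \<gamma> *\<^sub>R \<phi> \<gamma> \<noteq> 0} \<subseteq> \<Gamma> \<inter> fun_support \<phi>" using in_fun_supportI[of \<phi>] by auto
    have "integral\<^sup>L \<mu> \<phi> = integral\<^sup>L ?D \<phi>"
      unfolding \<mu>_def by (rule integral_distr[OF m test_funs_measurable[OF \<phi>]])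
    also have "\<dots> = (\<integral>\<gamma>. w \<gamma> *\<^sub>R \<phi> \<gamma> \<partial>count_space \<Gamma>)"
      using w by (intro integral_density) auto
    also have "\<dots> = (\<Sum>\<gamma> | \<gamma> \<in> \<Gamma> \<and> w \<gamma> *\<^sub>R \<phi> \<gamma> \<noteq> 0. w \<gamma> *\<^sub>R \<phi> \<gamma>)"
      by (rule lebesgue_integral_count_space_finite_support[OF finite_subset[OF sub S]])
    also have "\<dots> = (\<Sum>\<gamma>\<in>\<Gamma> \<inter> fun_support \<phi>. w \<gamma> *\<^sub>R \<phi> \<gamma>)"
      by (rule sum.mono_neutral_left[OF S sub]) auto
    finally show "integral\<^sup>L \<mu> \<phi> = (\<Sum>\<gamma>\<in>\<Gamma> \<inter> fun_support \<phi>. of_real (w \<gamma>) * \<phi> \<gamma>)"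
      by (simp add: scaleR_conv_of_real)
  qed
qed

theorem theorem4:
  fixes f :: "('a::euclidean_space \<Rightarrow> complex) \<Rightarrow> complex"
  assumes "tempered_distribution f"
    and "almost_periodic_distribution f"
    and "locally_finite_set (spectrum f)"
  shows "is_complex_measure (fourier_dist f)"
proof -
  let ?\<Gamma> = "spectrum f"
  have "\<exists>\<theta> \<rho>. \<theta> \<in> test_funs \<and> fun_support \<theta> \<inter> ?\<Gamma> \<subseteq> {\<gamma>} \<and> \<rho> > 0 \<and> (\<forall>x. dist \<gamma> x < \<rho> \<longrightarrow> \<theta> x = 1)"
    for \<gamma> :: 'a
  proof -
    have "finite (?\<Gamma> \<inter> ball \<gamma> 1)" using assms(3) by (simp add: locally_finite_set_def)
    from finite_set_avoid[OF this, of \<gamma>] obtain d where d: "d > 0"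
      "\<And>x. x \<in> ?\<Gamma> \<Longrightarrow> dist \<gamma> x < 1 \<Longrightarrow> x \<noteq> \<gamma> \<Longrightarrow> d \<le> dist \<gamma> x" by auto
    \<comment> \<open>The spectrum is controlled only within distance 1 of \<gamma>, hence the
      minimum; the support has radius at most 2 \<rho>, which is strictly below both
      \<open>d\<close> and 1.\<close>
    define \<rho> where "\<rho> = min d 1 / 4"
    have \<rho>: "\<rho> > 0" using d(1) by (simp add: \<rho>_def)
    obtain \<beta> :: "'a \<Rightarrow> real" where \<beta>: "(\<lambda>x. of_real (\<beta> x)) \<in> test_funs"
      "\<And>x. 0 \<le> \<beta> x" "\<And>x. \<beta> x \<le> 1"
      "\<And>x. dist \<gamma> x \<le> \<rho> \<Longrightarrow> \<beta> x = 1" "\<And>x. dist \<gamma> x \<ge> 2 * \<rho> \<Longrightarrow> \<beta> x = 0"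
      by (rule bump_exists[OF \<rho>, of \<gamma>]) blast
    let ?\<theta> = "\<lambda>x. complex_of_real (\<beta> x)"
    have sub: "{x. ?\<theta> x \<noteq> 0} \<subseteq> cball \<gamma> (2 * \<rho>)" using \<beta>(5) by force
    have "fun_support ?\<theta> \<subseteq> cball \<gamma> (2 * \<rho>)"
      unfolding fun_support_altdef using sub by (rule closure_minimal) simp
    then have "fun_support ?\<theta> \<inter> ?\<Gamma> \<subseteq> {\<gamma>}"
    proof (intro subsetI)
      fix x assume *: "fun_support ?\<theta> \<subseteq> cball \<gamma> (2 * \<rho>)" "x \<in> fun_support ?\<theta> \<inter> ?\<Gamma>"
      then have "dist \<gamma> x \<le> 2 * \<rho>" by auto
      then have "dist \<gamma> x < 1" "dist \<gamma> x < d" using d(1) by (auto simp: \<rho>_def min_def split: if_splits)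
      then show "x \<in> {\<gamma>}" using d(2)[of x] * by auto
    qed
    then show ?thesis using \<rho> \<beta>(1,4) by (intro exI[of _ ?\<theta>] exI[of _ \<rho>]) auto
  qed
  then obtain \<theta> \<rho> where \<theta>: "\<And>\<gamma>. \<theta> \<gamma> \<in> test_funs" "\<And>\<gamma>. fun_support (\<theta> \<gamma>) \<inter> ?\<Gamma> \<subseteq> {\<gamma>}"
    "\<And>\<gamma>. \<rho> \<gamma> > 0" "\<And>\<gamma> x. dist \<gamma> x < \<rho> \<gamma> \<Longrightarrow> \<theta> \<gamma> x = 1"
    by metis
  \<comment> \<open>The mass at \<gamma>; the four measures below carry the positive and negative
    parts of its real and imaginary parts.\<close>
  define c where "c = (\<lambda>\<gamma>. fourier_dist f (\<theta> \<gamma>))"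
  obtain \<mu>\<^sub>1 where 1: "radon_measure \<mu>\<^sub>1" "\<And>\<phi>. \<phi> \<in> test_funs \<Longrightarrow>
      integral\<^sup>L \<mu>\<^sub>1 \<phi> = (\<Sum>\<gamma>\<in>?\<Gamma> \<inter> fun_support \<phi>. of_real (max 0 (Re (c \<gamma>))) * \<phi> \<gamma>)"
    by (rule discrete_radon_measure[OF assms(3), of "\<lambda>\<gamma>. max 0 (Re (c \<gamma>))"]) auto
  obtain \<mu>\<^sub>2 where 2: "radon_measure \<mu>\<^sub>2" "\<And>\<phi>. \<phi> \<in> test_funs \<Longrightarrow>
      integral\<^sup>L \<mu>\<^sub>2 \<phi> = (\<Sum>\<gamma>\<in>?\<Gamma> \<inter> fun_support \<phi>. of_real (max 0 (- Re (c \<gamma>))) * \<phi> \<gamma>)"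
    by (rule discrete_radon_measure[OF assms(3), of "\<lambda>\<gamma>. max 0 (- Re (c \<gamma>))"]) auto
  obtain \<mu>\<^sub>3 where 3: "radon_measure \<mu>\<^sub>3" "\<And>\<phi>. \<phi> \<in> test_funs \<Longrightarrow>
      integral\<^sup>L \<mu>\<^sub>3 \<phi> = (\<Sum>\<gamma>\<in>?\<Gamma> \<inter> fun_support \<phi>. of_real (max 0 (Im (c \<gamma>))) * \<phi> \<gamma>)"
    by (rule discrete_radon_measure[OF assms(3), of "\<lambda>\<gamma>. max 0 (Im (c \<gamma>))"]) auto
  obtain \<mu>\<^sub>4 where 4: "radon_measure \<mu>\<^sub>4" "\<And>\<phi>. \<phi> \<in> test_funs \<Longrightarrow>
      integral\<^sup>L \<mu>\<^sub>4 \<phi> = (\<Sum>\<gamma>\<in>?\<Gamma> \<inter> fun_support \<phi>. of_real (max 0 (- Im (c \<gamma>))) * \<phi> \<gamma>)"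
    by (rule discrete_radon_measure[OF assms(3), of "\<lambda>\<gamma>. max 0 (- Im (c \<gamma>))"]) auto
  have c_eq: "c \<gamma> = (of_real (max 0 (Re (c \<gamma>))) - of_real (max 0 (- Re (c \<gamma>)))) +
      \<i> * (of_real (max 0 (Im (c \<gamma>))) - of_real (max 0 (- Im (c \<gamma>))))" for \<gamma>
    by (simp add: complex_eq_iff max_def)
  have "fourier_dist f \<phi> = (integral\<^sup>L \<mu>\<^sub>1 \<phi> - integral\<^sup>L \<mu>\<^sub>2 \<phi>) + \<i> * (integral\<^sup>L \<mu>\<^sub>3 \<phi> - integral\<^sup>L \<mu>\<^sub>4 \<phi>)"
    if \<phi>: "\<phi> \<in> test_funs" for \<phi>
  proof -
    let ?S = "?\<Gamma> \<inter> fun_support \<phi>"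
    have "finite ?S"
      using \<phi> by (intro locally_finite_set_bounded assms(3)) (simp add: test_funs_def compact_imp_bounded)
    then have "fourier_dist f \<phi> = (\<Sum>\<gamma>\<in>?S. c \<gamma> * \<phi> \<gamma>)"
      unfolding c_def using \<theta> \<phi> by (intro fourier_dist_eq_sum[OF assms(1,2), of \<theta> \<rho>]) auto
    also have "\<dots> = (integral\<^sup>L \<mu>\<^sub>1 \<phi> - integral\<^sup>L \<mu>\<^sub>2 \<phi>) + \<i> * (integral\<^sup>L \<mu>\<^sub>3 \<phi> - integral\<^sup>L \<mu>\<^sub>4 \<phi>)"
      unfolding 1(2)[OF \<phi>] 2(2)[OF \<phi>] 3(2)[OF \<phi>] 4(2)[OF \<phi>]
        sum_distrib_left sum_subtractf[symmetric] sum.distrib[symmetric]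
    proof (intro sum.cong refl)
      fix \<gamma>
      show "c \<gamma> * \<phi> \<gamma> = of_real (max 0 (Re (c \<gamma>))) * \<phi> \<gamma> - of_real (max 0 (- Re (c \<gamma>))) * \<phi> \<gamma> +
        \<i> * (of_real (max 0 (Im (c \<gamma>))) * \<phi> \<gamma> - of_real (max 0 (- Im (c \<gamma>))) * \<phi> \<gamma>)"
        by (subst c_eq) (simp only: distrib_right left_diff_distrib mult.assoc right_diff_distrib)
    qed
    finally show ?thesis .
  qed
  with 1(1) 2(1) 3(1) 4(1) show ?thesis unfolding is_complex_measure_def by blast
qed

end
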